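(* Let $k$ be a field of characteristic $0$ and $\mu\in k^\times$. The Grothendieck–Teichmüller torsor $M_\mu$ is embedded in the double shuffle torsor $DMR_\mu$ as pro-torsors; that is, the inclusion of sets of series gives an embedding $M_\mu\hookrightarrow DMR_\mu$ which is compatible with the right actions of $GRT_1$ on $M_\mu$ and of $DMR_0$ on $DMR_\mu$ via the inclusion of groups $GRT_1\hookrightarrow DMR_0$.
   Context: Let $k$ be a field of characteristic $0$. $k\langle\langle X_0,X_1\rangle\rangle$ is the ring of non-commutative formal power series. A series $\varphi$ is group-like if its constant term is $1$ and $\Delta(\varphi)=\varphi\widehat\otimes\varphi$, where $\Delta$ is the (continuous algebra) coproduct with $\Delta(X_i)=X_i\otimes1+1\otimes X_i$. For a (continuous) algebra homomorphism $\iota$ the image $\iota(\varphi)$ is denoted $\varphi(\iota(X_0),\iota(X_1))$. $c_W(\varphi)$ is the coefficient of the word $W$ in $\varphi$. $\mathfrak a_4$ is the completion (for the natural grading) of the Lie algebra over $k$ with generators $t_{ij}$ ($1\le i,j\le4$) and relations $t_{ii}=0$, $t_{ij}=t_{ji}$, $[t_{ij},t_{ik}+t_{jk}]=0$ ($i,j,k$ all distinct), $[t_{ij},t_{kl}]=0$ ($i,j,k,l$ all distinct). For $\mu\in k$ and $\varphi$ group-like, the GT-relations for $(\mu,\varphi)$ are the following equations in the completed universal enveloping algebra of $\mathfrak a_4$: $$\varphi(t_{12},t_{23}+t_{24})\varphi(t_{13}+t_{23},t_{34})=\varphi(t_{23},t_{34})\varphi(t_{12}+t_{13},t_{24}+t_{34})\varphi(t_{12},t_{23}),$$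 $$e^{\mu(t_{13}+t_{23})/2}=\varphi(t_{13},t_{12})e^{\mu t_{13}/2}\varphi(t_{13},t_{23})^{-1}e^{\mu t_{23}/2}\varphi(t_{12},t_{23}),$$ $$e^{\mu(t_{12}+t_{13})/2}=\varphi(t_{23},t_{13})^{-1}e^{\mu t_{13}/2}\varphi(t_{12},t_{13})e^{\mu t_{12}/2}\varphi(t_{12},t_{23})^{-1}.$$ $M_\mu$ has as $k$-points the group-like $\varphi$ satisfying the GT-relations for $(\mu,\varphi)$. $GRT_1$ is the pro-unipotent group whose $k$-points are the group-like $\varphi$ satisfying the GT-relations for $(0,\varphi)$. The generalized double shuffle relation for a group-like $\varphi$ is $\Delta_*(\varphi_* )=\varphi_*\widehat\otimes\varphi_*$, where $\pi_Y:k\langle\langle X_0,X_1\rangle\rangle\to k\langle\langle Y_1,Y_2,\dots\rangle\rangle$ is the (continuous) $k$-linear map sending words ending in $X_0$ to $0$ and $X_0^{n_m-1}X_1\cdots X_0^{n_1-1}X_1$ to $(-1)^mY_{n_m}\cdots Y_{n_1}$ (and $1\mapsto1$); $\Delta_*$ is the (continuous algebra) coproduct with $\Delta_*(Y_n)=\sum_{i=0}^nY_i\otimes Y_{n-i}$, $Y_0:=1$; and $\varphi_*=\varphi_{\mathrm{corr}}\cdot\pi_Y(\varphi)$ with $\varphi_{\mathrm{corr}}=\exp\bigl(\sum_{n\ge1}\frac{(-1)^n}{n}c_{X_0^{n-1}X_1}(\varphi)Y_1^n\bigr)$. $DMR_\mu$ has as $k$-points the group-like $\varphi$ satisfying the generalized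 double shuffle relation, $c_{X_0}(\varphi)=c_{X_1}(\varphi)=0$ and $c_{X_0X_1}(\varphi)=\frac{\mu^2}{24}$. $DMR_0$ (the case $\mu=0$, i.e. $c_{X_0X_1}(\varphi)=0$) is a pro-unipotent group. The group multiplications of $GRT_1$ and $DMR_0$, and the right actions $(\varphi_1,\varphi_2)\mapsto\varphi_1\circ\varphi_2$ making $M_\mu$ a right $GRT_1$-torsor (Drinfel'd) and $DMR_\mu$ a right $DMR_0$-torsor (Racinet), are all given by $$\varphi_1\circ\varphi_2:=\varphi_1(\varphi_2X_0\varphi_2^{-1},X_1)\cdot\varphi_2=\varphi_2\cdot\varphi_1(X_0,\varphi_2^{-1}X_1\varphi_2).$$ The pro-algebraic structures are those given by the polynomial equations in the coefficients of $\varphi$ which express that $\varphi$ is group-like together with: the GT-relations for $(\mu,\varphi)$ in the case of $M_\mu$; the GT-relations for $(0,\varphi)$ in the case of $GRT_1$; the generalized double shuffle relation $\Delta_*(\varphi_* )=\varphi_*\widehat\otimes\varphi_*$ and the conditions $c_{X_0}(\varphi)=c_{X_1}(\varphi)=0$, $c_{X_0X_1}(\varphi)=\frac{\mu^2}{24}$ in the case of $DMR_\mu$ (with $\mu=0$ in the case of $DMR_0$). *)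

theory Defs
  imports "HOL-Library.Groups_Big_Fun" "HOL-Algebra.Group"
begin

section \<open>Non-commutative formal power series\<close>

typedef ('x, 'r) ncps = "UNIV :: ('x list \<Rightarrow> 'r) set"
  morphisms coeff Abs_ncps ..

lemma coeff_Abs_ncps [simp]: "coeff (Abs_ncps f) = f"
  by (simp add: Abs_ncps_inverse)

lemma ncps_eqI: "(\<And>w. coeff f w = coeff g w) \<Longrightarrow> f = g"
  by (metis coeff_inverse ext)

definition splits :: "'x list \<Rightarrow> ('x list \<times> 'x list) set" where
  "splits w = {(u, v). u @ v = w}"

lemma finite_splits [simp]: "finite (splits w)"
proof (rule finite_subset)
  show "splits w \<subseteq> (\<lambda>i. (take i w, drop i w)) ` {..length w}"
  proof
    fix p assume "p \<in> splits w"
    then have "p = (take (length (fst p)) w, drop (length (fst p)) w)" "length (fst p) \<le> length w"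
      by (auto simp: splits_def)
    then show "p \<in> (\<lambda>i. (take i w, drop i w)) ` {..length w}" by blast
  qed
qed simp

lemma splits_Nil [simp]: "splits [] = {([], [])}"
  by (auto simp: splits_def)

lemma Nil_split: "([], w) \<in> splits w" and split_Nil: "(w, []) \<in> splits w"
  by (simp_all add: splits_def)

instantiation ncps :: (type, ring_1) ring_1
begin

definition "0 = Abs_ncps (\<lambda>_. 0)"
definition "1 = Abs_ncps (\<lambda>w. if w = [] then 1 else 0)"
definition "f + g = Abs_ncps (\<lambda>w. coeff f w + coeff g w)"
definition "f - g = Abs_ncps (\<lambda>w. coeff f w - coeff g w)"
definition "- f = Abs_ncps (\<lambda>w. - coeff f w)"
definition "f * g = Abs_ncps (\<lambda>w. \<Sum>(u, v)\<in>splits w. coeff f u * coeff g v)"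

instance
proof
  fix a b c :: "('a, 'b) ncps"
  show "a * b * c = a * (b * c)"
  proof (rule ncps_eqI)
    fix w
    have "coeff (a * b * c) w
        = (\<Sum>p\<in>splits w. \<Sum>q\<in>splits (fst p). coeff a (fst q) * coeff b (snd q) * coeff c (snd p))"
      by (simp add: times_ncps_def case_prod_unfold sum_distrib_right)
    also have "\<dots> = (\<Sum>(p, q)\<in>(SIGMA p:splits w. splits (fst p)).
        coeff a (fst q) * coeff b (snd q) * coeff c (snd p))"
      by (rule sum.Sigma) auto
    also have "\<dots> = (\<Sum>(p, q)\<in>(SIGMA p:splits w. splits (snd p)).
        coeff a (fst p) * (coeff b (fst q) * coeff c (snd q)))"
      by (rule sum.reindex_bij_witness
            [where j = "\<lambda>(p, q). ((fst q, snd q @ snd p), (snd q, snd p))"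
               and i = "\<lambda>(p, q). ((fst p @ fst q, snd q), (fst p, fst q))"])
        (auto simp: splits_def mult.assoc)
    also have "\<dots>
        = (\<Sum>p\<in>splits w. \<Sum>q\<in>splits (snd p). coeff a (fst p) * (coeff b (fst q) * coeff c (snd q)))"
      by (rule sum.Sigma [symmetric]) auto
    also have "\<dots> = coeff (a * (b * c)) w"
      by (simp add: times_ncps_def case_prod_unfold sum_distrib_left)
    finally show "coeff (a * b * c) w = coeff (a * (b * c)) w" .
  qed
  show "1 * a = a"
  proof (rule ncps_eqI)
    fix w
    have "coeff (1 * a) w = (\<Sum>p\<in>splits w. if p = ([], w) then coeff a w else 0)"
      unfolding times_ncps_def one_ncps_def coeff_Abs_ncps case_prod_unfold
      by (rule sum.cong) (auto simp: splits_def)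
    also have "\<dots> = coeff a w" by (simp add: Nil_split split_Nil)
    finally show "coeff (1 * a) w = coeff a w" .
  qed
  show "a * 1 = a"
  proof (rule ncps_eqI)
    fix w
    have "coeff (a * 1) w = (\<Sum>p\<in>splits w. if p = (w, []) then coeff a w else 0)"
      unfolding times_ncps_def one_ncps_def coeff_Abs_ncps case_prod_unfold
      by (rule sum.cong) (auto simp: splits_def)
    also have "\<dots> = coeff a w" by (simp add: Nil_split split_Nil)
    finally show "coeff (a * 1) w = coeff a w" .
  qed
  show "(a + b) * c = a * c + b * c" "a * (b + c) = a * b + a * c"
    by (rule ncps_eqI;
        simp add: times_ncps_def plus_ncps_def case_prod_unfold distrib_left distrib_right sum.distrib)+
  show "(0 :: ('a, 'b) ncps) \<noteq> 1"
  proof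
    assume "(0 :: ('a, 'b) ncps) = 1"
    then have "coeff (0 :: ('a, 'b) ncps) [] = coeff 1 []" by simp
    then show False by (simp add: zero_ncps_def one_ncps_def)
  qed
qed (auto intro!: ncps_eqI simp: plus_ncps_def zero_ncps_def uminus_ncps_def minus_ncps_def)

end

lemma coeff_simps [simp]:
  "coeff 0 w = 0"
  "coeff 1 w = (if w = [] then 1 else 0)"
  "coeff (f + g) w = coeff f w + coeff g w"
  "coeff (f - g) w = coeff f w - coeff g w"
  "coeff (- f) w = - coeff f w"
  by (simp_all add: zero_ncps_def one_ncps_def plus_ncps_def minus_ncps_def uminus_ncps_def)

lemma coeff_mult: "coeff (f * g) w = (\<Sum>(u, v)\<in>splits w. coeff f u * coeff g v)"
  by (simp add: times_ncps_def)

definition nc_var :: "'x \<Rightarrow> ('x, 'r::ring_1) ncps" where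
  "nc_var x = Abs_ncps (\<lambda>w. if w = [x] then 1 else 0)"

definition nc_const :: "'r \<Rightarrow> ('x, 'r::ring_1) ncps" where
  "nc_const c = Abs_ncps (\<lambda>w. if w = [] then c else 0)"

text \<open>
  Infinite sums of series are taken coefficientwise. \<^const>\<open>Sum_any\<close> is the sum over the support,
  which is finite wherever it is used below.
\<close>

definition nc_Sum :: "('i \<Rightarrow> ('x, 'r::ring_1) ncps) \<Rightarrow> ('x, 'r) ncps" where
  "nc_Sum F = Abs_ncps (\<lambda>w. Sum_any (\<lambda>i. coeff (F i) w))"

definition nc_inv :: "('x, 'r::ring_1) ncps \<Rightarrow> ('x, 'r) ncps" where
  "nc_inv f = (THE g. f * g = 1 \<and> g * f = 1)"

text \<open>
  The continuous algebra homomorphism with \<open>x \<mapsto> h x\<close>, where the series \<open>h x\<close> have constant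
  term \<open>0\<close>.
\<close>

definition nc_subst :: "('x \<Rightarrow> ('y, 'r::comm_ring_1) ncps) \<Rightarrow> ('x, 'r) ncps \<Rightarrow> ('y, 'r) ncps" where
  "nc_subst h f = nc_Sum (\<lambda>u. nc_const (coeff f u) * prod_list (map h u))"

lemma coeff_prod_list_nonzero:
  assumes "\<And>x. coeff (h x) [] = 0" "coeff (prod_list (map h u)) w \<noteq> 0"
  shows "length u \<le> length w"
  using assms(2)
proof (induction u arbitrary: w)
  case (Cons x u)
  then have "(\<Sum>p\<in>splits w. coeff (h x) (fst p) * coeff (prod_list (map h u)) (snd p)) \<noteq> 0"
    by (simp add: coeff_mult case_prod_unfold)
  then obtain p where p: "p \<in> splits w"
      "coeff (h x) (fst p) * coeff (prod_list (map h u)) (snd p) \<noteq> 0"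
    by (rule sum.not_neutral_contains_not_neutral)
  have "fst p \<noteq> []" using p(2) assms(1) by auto
  have "coeff (prod_list (map h u)) (snd p) \<noteq> 0" using p(2) by auto
  then have "length u \<le> length (snd p)" by (rule Cons.IH)
  moreover have "length w = length (fst p) + length (snd p)"
    using p(1) by (auto simp: splits_def)
  moreover from \<open>fst p \<noteq> []\<close> have "length (fst p) > 0" by simp
  ultimately show ?case unfolding list.size by linarith
qed simp

lemma coeff_const_mult [simp]: "coeff (nc_const c * f) w = c * coeff f w"
proof -
  have "coeff (nc_const c * f) w = (\<Sum>p\<in>splits w. if p = ([], w) then c * coeff f w else 0)"
    unfolding coeff_mult nc_const_def coeff_Abs_ncps case_prod_unfold
    by (rule sum.cong) (auto simp: splits_def)
  also have "\<dots> = c * coeff f w" by (simp add: Nil_split split_Nil)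
  finally show ?thesis .
qed

lemma finite_support_nc_subst:
  fixes h :: "'x::finite \<Rightarrow> ('y, 'r::comm_ring_1) ncps"
  assumes "\<And>x. coeff (h x) [] = 0"
  shows "finite {u. coeff (nc_const (coeff f u) * prod_list (map h u)) w \<noteq> 0}"
proof (rule finite_subset)
  show "{u. coeff (nc_const (coeff f u) * prod_list (map h u)) w \<noteq> 0}
      \<subseteq> {u. set u \<subseteq> UNIV \<and> length u \<le> length w}"
  proof
    fix u assume "u \<in> {u. coeff (nc_const (coeff f u) * prod_list (map h u)) w \<noteq> 0}"
    then have "coeff (prod_list (map h u)) w \<noteq> 0" by auto
    with assms have "length u \<le> length w" by (rule coeff_prod_list_nonzero)
    then show "u \<in> {u. set u \<subseteq> UNIV \<and> length u \<le> length w}" by simp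
  qed
  show "finite {u :: 'x list. set u \<subseteq> UNIV \<and> length u \<le> length w}"
    by (rule finite_lists_length_le) simp
qed


section \<open>Coefficient algebras\<close>

text \<open>
  The pro-algebraic sets below are treated through their points: for a commutative \<open>k\<close>-algebra
  \<open>R\<close> with structure map \<open>\<iota> : k \<rightarrow> R\<close>, the \<open>R\<close>-points are the solutions in \<open>R\<close> of the defining
  polynomial equations, whose coefficients lie in \<open>k\<close>. The \<open>k\<close>-points are the case \<open>\<iota> = id\<close>.
\<close>

locale k_algebra =
  fixes \<iota> :: "'k::field_char_0 \<Rightarrow> 'r::comm_ring_1"
  assumes map_one: "\<iota> 1 = 1"
    and map_add: "\<iota> (a + b) = \<iota> a + \<iota> b"
    and map_mult: "\<iota> (a * b) = \<iota> a * \<iota> b"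

text \<open>The exponential of a series with constant term \<open>0\<close>.\<close>

definition nc_exp :: "('k::field_char_0 \<Rightarrow> 'r::comm_ring_1) \<Rightarrow> ('x, 'r) ncps \<Rightarrow> ('x, 'r) ncps" where
  "nc_exp \<iota> f = nc_Sum (\<lambda>n. nc_const (\<iota> (1 / fact n)) * f ^ n)"

lemma finite_support_nc_exp:
  assumes "coeff f [] = 0"
  shows "finite {n. coeff (nc_const (\<iota> (1 / fact n)) * f ^ n) w \<noteq> 0}"
proof (rule finite_subset)
  show "{n. coeff (nc_const (\<iota> (1 / fact n)) * f ^ n) w \<noteq> 0} \<subseteq> {..length w}"
  proof
    fix n assume "n \<in> {n. coeff (nc_const (\<iota> (1 / fact n)) * f ^ n) w \<noteq> 0}"
    then have "coeff (f ^ n) w \<noteq> 0" by auto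
    then have "coeff (prod_list (map (\<lambda>_. f) (replicate n ()))) w \<noteq> 0"
      by (simp add: prod_list_replicate)
    then have "length (replicate n ()) \<le> length w"
      using assms by (intro coeff_prod_list_nonzero)
    then show "n \<in> {..length w}" by simp
  qed
qed simp


section \<open>Coproducts and group-like series\<close>

text \<open>
  The completed tensor square of the algebra of series over \<open>R\<close> in the letters \<open>'x\<close> is the algebra
  of series in the letters \<open>'x\<close> (left factor) with coefficients in the algebra of series (right
  factor): the coefficient of \<open>u \<otimes> v\<close> in \<open>F\<close> is \<open>coeff (coeff F u) v\<close>, and the product of the
  type is \<open>(u \<otimes> v)(u' \<otimes> v') = uu' \<otimes> vv'\<close>.
\<close>

type_synonym ('x, 'r) ncps2 = "('x, ('x, 'r) ncps) ncps"

definition tens :: "('x, 'r::comm_ring_1) ncps \<Rightarrow> ('x, 'r) ncps \<Rightarrow> ('x, 'r) ncps2" where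
  "tens f g = Abs_ncps (\<lambda>u. nc_const (coeff f u) * g)"

text \<open>The continuous algebra homomorphism into the completed tensor square with \<open>x \<mapsto> h x\<close>.\<close>

definition nc_coprod :: "('x \<Rightarrow> ('x, 'r::comm_ring_1) ncps2) \<Rightarrow> ('x, 'r) ncps \<Rightarrow> ('x, 'r) ncps2" where
  "nc_coprod h f =
     Abs_ncps (\<lambda>u. nc_Sum (\<lambda>w. nc_const (coeff f w) * coeff (prod_list (map h w)) u))"

lemma coeff_tens [simp]: "coeff (coeff (tens f g) u) v = coeff f u * coeff g v"
  by (simp add: tens_def)

lemma coeff_sum [simp]: "coeff (sum F A) w = (\<Sum>i\<in>A. coeff (F i) w)"
  by (induction A rule: infinite_finite_induct) auto

lemma tens_mult:
  fixes f g f' g' :: "('x, 'r::comm_ring_1) ncps"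
  shows "tens f g * tens f' g' = tens (f * f') (g * g')"
proof (intro ncps_eqI)
  fix u v
  show "coeff (coeff (tens f g * tens f' g') u) v = coeff (coeff (tens (f * f') (g * g')) u) v"
    by (simp add: coeff_mult case_prod_unfold sum_product mult_ac)
qed

lemma coprod_word_homogeneous:
  fixes h :: "'x \<Rightarrow> ('x, 'r::comm_ring_1) ncps2" and wt :: "'x \<Rightarrow> nat"
  assumes hom: "\<And>x u v. coeff (coeff (h x) u) v \<noteq> 0 \<Longrightarrow> sum_list (map wt u) + sum_list (map wt v) = wt x"
    and "coeff (coeff (prod_list (map h w)) u) v \<noteq> 0"
  shows "sum_list (map wt u) + sum_list (map wt v) = sum_list (map wt w)"
  using assms(2)
proof (induction w arbitrary: u v)
  case Nil
  then show ?case by (auto split: if_splits)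
next
  case (Cons x w)
  have "(\<Sum>p\<in>splits u. \<Sum>q\<in>splits v. coeff (coeff (h x) (fst p)) (fst q)
      * coeff (coeff (prod_list (map h w)) (snd p)) (snd q)) \<noteq> 0"
    using Cons.prems by (simp add: coeff_mult case_prod_unfold)
  then obtain p where p: "p \<in> splits u"
    and "(\<Sum>q\<in>splits v. coeff (coeff (h x) (fst p)) (fst q)
      * coeff (coeff (prod_list (map h w)) (snd p)) (snd q)) \<noteq> 0"
    by (rule sum.not_neutral_contains_not_neutral)
  then obtain q where q: "q \<in> splits v"
    and nz: "coeff (coeff (h x) (fst p)) (fst q)
      * coeff (coeff (prod_list (map h w)) (snd p)) (snd q) \<noteq> 0"
    by (elim sum.not_neutral_contains_not_neutral)
  have "coeff (coeff (h x) (fst p)) (fst q) \<noteq> 0"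
    and "coeff (coeff (prod_list (map h w)) (snd p)) (snd q) \<noteq> 0"
    using nz by auto
  from hom [OF this(1)] Cons.IH [OF this(2)] p q show ?case
    by (auto simp: splits_def)
qed

lemma finite_support_nc_coprod:
  fixes h :: "'x \<Rightarrow> ('x, 'r::comm_ring_1) ncps2" and wt :: "'x \<Rightarrow> nat"
  assumes hom: "\<And>x u v. coeff (coeff (h x) u) v \<noteq> 0 \<Longrightarrow> sum_list (map wt u) + sum_list (map wt v) = wt x"
    and pos: "\<And>x. wt x > 0" and fin: "\<And>n. finite {x. wt x \<le> n}"
  shows "finite {w. coeff (nc_const (coeff f w) * coeff (prod_list (map h w)) u) v \<noteq> 0}"
proof (rule finite_subset)
  let ?n = "sum_list (map wt u) + sum_list (map wt v)"
  have len: "length w \<le> sum_list (map wt w)" for w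
    by (induction w) (use pos in \<open>auto simp: Suc_le_eq add_strict_increasing intro: le_less_trans\<close>)
  show "{w. coeff (nc_const (coeff f w) * coeff (prod_list (map h w)) u) v \<noteq> 0}
      \<subseteq> {w. set w \<subseteq> {x. wt x \<le> ?n} \<and> length w \<le> ?n}"
  proof
    fix w assume "w \<in> {w. coeff (nc_const (coeff f w) * coeff (prod_list (map h w)) u) v \<noteq> 0}"
    then have "coeff (coeff (prod_list (map h w)) u) v \<noteq> 0" by auto
    with hom have eq: "?n = sum_list (map wt w)" by (rule coprod_word_homogeneous)
    then show "w \<in> {w. set w \<subseteq> {x. wt x \<le> ?n} \<and> length w \<le> ?n}"
      using len [of w] by (auto simp: member_le_sum_list)
  qed
  show "finite {w. set w \<subseteq> {x. wt x \<le> ?n} \<and> length w \<le> ?n}"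
    by (rule finite_lists_length_le) (rule fin)
qed


datatype letter = X0 | X1

instance letter :: finite
proof
  have "(UNIV :: letter set) = {X0, X1}" using letter.exhaust by auto
  then show "finite (UNIV :: letter set)" by (metis finite.emptyI finite_insert)
qed

type_synonym 'r xseries = "(letter, 'r) ncps"

definition \<Delta> :: "'r::comm_ring_1 xseries \<Rightarrow> (letter, 'r) ncps2" where
  "\<Delta> = nc_coprod (\<lambda>x. tens (nc_var x) 1 + tens 1 (nc_var x))"

lemma finite_support_\<Delta>:
  fixes f :: "'r::comm_ring_1 xseries"
  shows "finite {w. coeff (nc_const (coeff f w) *
    coeff (prod_list (map (\<lambda>x. tens (nc_var x) 1 + tens 1 (nc_var x)) w)) u) v \<noteq> 0}"
  by (rule finite_support_nc_coprod [where wt = "\<lambda>_. 1"])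
    (auto simp: nc_var_def split: if_splits)

definition group_like :: "'r::comm_ring_1 xseries \<Rightarrow> bool" where
  "group_like \<phi> \<longleftrightarrow> coeff \<phi> [] = 1 \<and> \<Delta> \<phi> = tens \<phi> \<phi>"

text \<open>\<open>ev \<phi> a b\<close> is \<open>\<phi>(a, b)\<close>.\<close>

definition ev :: "'r::comm_ring_1 xseries \<Rightarrow> ('y, 'r) ncps \<Rightarrow> ('y, 'r) ncps \<Rightarrow> ('y, 'r) ncps" where
  "ev \<phi> a b = nc_subst (\<lambda>x. case x of X0 \<Rightarrow> a | X1 \<Rightarrow> b) \<phi>"

definition circ :: "'r::comm_ring_1 xseries \<Rightarrow> 'r xseries \<Rightarrow> 'r xseries"  (infixl \<open>\<odot>\<close> 70) where
  "\<phi>\<^sub>1 \<odot> \<phi>\<^sub>2 = ev \<phi>\<^sub>1 (\<phi>\<^sub>2 * nc_var X0 * nc_inv \<phi>\<^sub>2) (nc_var X1) * \<phi>\<^sub>2"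


definition X0pow_X1 :: "nat \<Rightarrow> letter list" where
  "X0pow_X1 n = replicate n X0 @ [X1]"


section \<open>The completed enveloping algebra of \<open>\<aa>\<^sub>4\<close> and the GT-relations\<close>

datatype idx = I1 | I2 | I3 | I4

type_synonym 'r tseries = "(idx \<times> idx, 'r) ncps"

definition tgen :: "idx \<Rightarrow> idx \<Rightarrow> 'r::comm_ring_1 tseries" where
  "tgen i j = nc_var (i, j)"

definition commutator :: "'a::ring_1 \<Rightarrow> 'a \<Rightarrow> 'a" where
  "commutator a b = a * b - b * a"

definition a4_relators :: "'r::comm_ring_1 tseries set" where
  "a4_relators =
     {tgen i i | i. True} \<union>
     {tgen i j - tgen j i | i j. True} \<union>
     {commutator (tgen i j) (tgen i k + tgen j k) | i j k. distinct [i, j, k]} \<union>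
     {commutator (tgen i j) (tgen k l) | i j k l. distinct [i, j, k, l]}"

inductive_set two_sided_ideal :: "'a::ring_1 set \<Rightarrow> 'a set" for S where
  zero: "0 \<in> two_sided_ideal S"
| step: "x \<in> two_sided_ideal S \<Longrightarrow> s \<in> S \<Longrightarrow> x + a * s * b \<in> two_sided_ideal S"

text \<open>Closure in the topology defined by the degree (word length) filtration.\<close>

definition nc_closure :: "('x, 'r::ring_1) ncps set \<Rightarrow> ('x, 'r) ncps set" where
  "nc_closure A = {f. \<forall>n. \<exists>g\<in>A. \<forall>w. length w \<le> n \<longrightarrow> coeff f w = coeff g w}"

text \<open>
  The enveloping algebra of a Lie algebra presented by generators and relations is the associative
  algebra with the same presentation, brackets being read as commutators. Hence the completed
  enveloping algebra of \<open>\<aa>\<^sub>4\<close> (over \<open>R\<close>) is the algebra of series in the \<open>t\<^sub>i\<^sub>j\<close> modulo the closed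
  two-sided ideal generated by the relators; \<open>eq_Ua4 f g\<close> says that \<open>f\<close> and \<open>g\<close> represent the same
  element of it.
\<close>

definition eq_Ua4 :: "'r::comm_ring_1 tseries \<Rightarrow> 'r tseries \<Rightarrow> bool" where
  "eq_Ua4 f g \<longleftrightarrow> f - g \<in> nc_closure (two_sided_ideal a4_relators)"

definition GT_relations ::
  "('k::field_char_0 \<Rightarrow> 'r::comm_ring_1) \<Rightarrow> 'k \<Rightarrow> 'r xseries \<Rightarrow> bool" where
  "GT_relations \<iota> \<mu> \<phi> \<longleftrightarrow>
    (let t12 = tgen I1 I2; t13 = tgen I1 I3; t23 = tgen I2 I3; t24 = tgen I2 I4; t34 = tgen I3 I4;
         E = (\<lambda>a. nc_exp \<iota> (nc_const (\<iota> (\<mu> / 2)) * a))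
     in eq_Ua4 (ev \<phi> t12 (t23 + t24) * ev \<phi> (t13 + t23) t34)
               (ev \<phi> t23 t34 * ev \<phi> (t12 + t13) (t24 + t34) * ev \<phi> t12 t23) \<and>
        eq_Ua4 (E (t13 + t23))
               (ev \<phi> t13 t12 * E t13 * nc_inv (ev \<phi> t13 t23) * E t23 * ev \<phi> t12 t23) \<and>
        eq_Ua4 (E (t12 + t13))
               (nc_inv (ev \<phi> t23 t13) * E t13 * ev \<phi> t12 t13 * E t12 * nc_inv (ev \<phi> t12 t23)))"

definition M_pts :: "('k::field_char_0 \<Rightarrow> 'r::comm_ring_1) \<Rightarrow> 'k \<Rightarrow> 'r xseries set" where
  "M_pts \<iota> \<mu> = {\<phi>. group_like \<phi> \<and> GT_relations \<iota> \<mu> \<phi>}"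

definition GRT1 :: "('k::field_char_0 \<Rightarrow> 'r::comm_ring_1) \<Rightarrow> 'r xseries monoid" where
  "GRT1 \<iota> = \<lparr>carrier = {\<phi>. group_like \<phi> \<and> GT_relations \<iota> 0 \<phi>}, mult = (\<odot>), one = 1\<rparr>"


section \<open>The generalized double shuffle relation\<close>

text \<open>The letters are \<open>Y\<^sub>1, Y\<^sub>2, \<dots>\<close>; \<open>YSuc n\<close> is \<open>Y\<^bsub>n+1\<^esub>\<close>.\<close>

datatype yletter = YSuc nat

type_synonym 'r yseries = "(yletter, 'r) ncps"

fun Yser :: "nat \<Rightarrow> 'r::comm_ring_1 yseries" where
  "Yser 0 = 1"
| "Yser (Suc n) = nc_var (YSuc n)"

fun x_block :: "yletter \<Rightarrow> letter list" where
  "x_block (YSuc n) = X0pow_X1 n"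

text \<open>
  Every word in \<open>X\<^sub>0, X\<^sub>1\<close> that does not end in \<open>X\<^sub>0\<close> is \<open>concat (map x_block w)\<close> for a unique word
  \<open>w\<close> in the \<open>Y\<^sub>n\<close>, and \<open>\<pi>\<^sub>Y\<close> sends it to \<open>(-1)\<^sup>m w\<close> with \<open>m\<close> the length of \<open>w\<close>. This is the induced
  formula for coefficients.
\<close>

definition \<pi>\<^sub>Y :: "'r::comm_ring_1 xseries \<Rightarrow> 'r yseries" where
  "\<pi>\<^sub>Y \<phi> = Abs_ncps (\<lambda>w. (- 1) ^ length w * coeff \<phi> (concat (map x_block w)))"

fun shuffle_letter :: "yletter \<Rightarrow> (yletter, 'r::comm_ring_1) ncps2" where
  "shuffle_letter (YSuc n) = (\<Sum>i\<le>Suc n. tens (Yser i) (Yser (Suc n - i)))"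

definition \<Delta>_star :: "'r::comm_ring_1 yseries \<Rightarrow> (yletter, 'r) ncps2" where
  "\<Delta>_star = nc_coprod shuffle_letter"

fun y_weight :: "yletter \<Rightarrow> nat" where
  "y_weight (YSuc n) = Suc n"

lemma coeff_Yser_nonzero: "coeff (Yser n) w \<noteq> 0 \<Longrightarrow> sum_list (map y_weight w) = n"
  by (cases n) (auto simp: nc_var_def split: if_splits)

lemma finite_support_\<Delta>_star:
  fixes f :: "'r::comm_ring_1 yseries"
  shows "finite {w. coeff (nc_const (coeff f w) *
    coeff (prod_list (map shuffle_letter w)) u) v \<noteq> 0}"
proof (rule finite_support_nc_coprod [where wt = y_weight])
  fix x u v
  assume nz: "coeff (coeff (shuffle_letter x :: (yletter, 'r) ncps2) u) v \<noteq> 0"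
  obtain n where x: "x = YSuc n" by (cases x)
  have "(\<Sum>i\<le>Suc n. coeff (Yser i) u * coeff (Yser (Suc n - i)) v) \<noteq> (0 :: 'r)"
    using nz by (simp add: x del: sum.atMost_Suc)
  then obtain i where "i \<in> {..Suc n}"
    and i': "coeff (Yser i) u * coeff (Yser (Suc n - i)) v \<noteq> (0 :: 'r)"
    by (rule sum.not_neutral_contains_not_neutral)
  then have i: "i \<le> Suc n" by simp
  from i' have "coeff (Yser i) u \<noteq> (0 :: 'r)" "coeff (Yser (Suc n - i)) v \<noteq> (0 :: 'r)" by auto
  then have "sum_list (map y_weight u) = i" "sum_list (map y_weight v) = Suc n - i"
    by (auto dest: coeff_Yser_nonzero)
  with i x show "sum_list (map y_weight u) + sum_list (map y_weight v) = y_weight x" by simp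
next
  fix x show "0 < y_weight x" by (cases x) simp
next
  fix n
  have "{x. y_weight x \<le> n} \<subseteq> YSuc ` {..n}"
  proof
    fix x assume "x \<in> {x. y_weight x \<le> n}"
    then show "x \<in> YSuc ` {..n}" by (cases x) auto
  qed
  then show "finite {x. y_weight x \<le> n}" by (rule finite_subset) simp
qed

definition \<phi>_corr ::
  "('k::field_char_0 \<Rightarrow> 'r::comm_ring_1) \<Rightarrow> 'r xseries \<Rightarrow> 'r yseries" where
  "\<phi>_corr \<iota> \<phi> = nc_exp \<iota> (nc_Sum (\<lambda>n. if n = 0 then 0
     else nc_const (\<iota> ((- 1) ^ n / of_nat n) * coeff \<phi> (X0pow_X1 (n - 1))) * Yser 1 ^ n))"

definition \<phi>_star ::
  "('k::field_char_0 \<Rightarrow> 'r::comm_ring_1) \<Rightarrow> 'r xseries \<Rightarrow> 'r yseries" where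
  "\<phi>_star \<iota> \<phi> = \<phi>_corr \<iota> \<phi> * \<pi>\<^sub>Y \<phi>"

definition double_shuffle ::
  "('k::field_char_0 \<Rightarrow> 'r::comm_ring_1) \<Rightarrow> 'r xseries \<Rightarrow> bool" where
  "double_shuffle \<iota> \<phi> \<longleftrightarrow> \<Delta>_star (\<phi>_star \<iota> \<phi>) = tens (\<phi>_star \<iota> \<phi>) (\<phi>_star \<iota> \<phi>)"

definition DMR_pts :: "('k::field_char_0 \<Rightarrow> 'r::comm_ring_1) \<Rightarrow> 'k \<Rightarrow> 'r xseries set" where
  "DMR_pts \<iota> \<mu> = {\<phi>. group_like \<phi> \<and> double_shuffle \<iota> \<phi> \<and>
     coeff \<phi> [X0] = 0 \<and> coeff \<phi> [X1] = 0 \<and> coeff \<phi> [X0, X1] = \<iota> (\<mu>\<^sup>2 / 24)}"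

definition DMR0 :: "('k::field_char_0 \<Rightarrow> 'r::comm_ring_1) \<Rightarrow> 'r xseries monoid" where
  "DMR0 \<iota> = \<lparr>carrier = DMR_pts \<iota> 0, mult = (\<odot>), one = 1\<rparr>"


section \<open>Embeddings of sets with a right action\<close>

text \<open>
  \<open>f : X \<rightarrow> X'\<close> is an embedding, compatible with the right actions of \<open>G\<close> on \<open>X\<close> and of \<open>G'\<close> on
  \<open>X'\<close> via the embedding of groups \<open>h : G \<rightarrow> G'\<close>. That \<open>G\<close>, \<open>G'\<close> are groups acting simply
  transitively on \<open>X\<close>, \<open>X'\<close> is not part of the notion.
\<close>

definition equivariant_embedding ::
  "'p set \<Rightarrow> ('g, 'a) monoid_scheme \<Rightarrow> ('p \<Rightarrow> 'g \<Rightarrow> 'p) \<Rightarrow>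
   'q set \<Rightarrow> ('h, 'b) monoid_scheme \<Rightarrow> ('q \<Rightarrow> 'h \<Rightarrow> 'q) \<Rightarrow>
   ('p \<Rightarrow> 'q) \<Rightarrow> ('g \<Rightarrow> 'h) \<Rightarrow> bool" where
  "equivariant_embedding X G act X' G' act' f h \<longleftrightarrow>
     f \<in> X \<rightarrow> X' \<and> inj_on f X \<and>
     h \<in> hom G G' \<and> inj_on h (carrier G) \<and>
     (\<forall>x\<in>X. \<forall>g\<in>carrier G. f (act x g) = act' (f x) (h g))"

end

theory Submission
  imports Defs "HOL-Computational_Algebra.Formal_Power_Series"
begin

text \<open>
  All maps in the statement are inclusions, and all products and actions are the same operation. So the
  point is that a group-like series \<open>\<phi>\<close> satisfying the GT-relations for \<open>(\<mu>, \<phi>)\<close> lies in \<open>DMR\<^sub>\<mu>\<close>, for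
  every \<open>\<mu>\<close> including \<open>0\<close>. The linear part of the pentagon gives \<open>c\<^bsub>X0\<^esub> = c\<^bsub>X1\<^esub> = 0\<close>, and the quadratic part of a
  hexagon gives \<open>c\<^bsub>X0 X1\<^esub>\<close>. The double shuffle relation follows from the pentagon alone.

  For this the pentagon is evaluated in a representation of \<open>\<aa>\<^sub>4\<close> by \<open>3 \<times> 3\<close> matrices over the tensor square of
  the free algebra in \<open>X0\<close>, \<open>X1\<close>; the letters of the two factors are \<open>a0\<close>, \<open>a1\<close> and \<open>t\<close>, \<open>b\<close>. The representation is built
  such that one of the five factors of the pentagon becomes the harmonic coproduct of \<open>\<phi>\<close>, one becomes \<open>\<phi>(a0, a1)\<close>,
  one becomes \<open>\<phi>(t, b)\<close>, one acts trivially, and the last one involves only the commuting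
  elements \<open>a1\<close> and \<open>b\<close>. The middle entry of the pentagon (\<open>entry_identity\<close>, \<open>harmonic_identity\<close>) becomes
  \<open>B(x, y) \<Delta>\<^sub>*(\<pi>\<^sub>Y \<phi>) = \<pi>\<^sub>Y \<phi> \<otimes> \<pi>\<^sub>Y \<phi>\<close>,
  where \<open>x = - Y\<^sub>1 \<otimes> 1\<close>, \<open>y = - 1 \<otimes> Y\<^sub>1\<close>, and \<open>B(x, y)\<close> is the part of \<open>\<phi>\<close> that consists of the words not ending in
  \<open>X0\<close>, evaluated at \<open>x\<close> and \<open>y\<close> (\<open>harmonic_coproduct_of_associator\<close>).

  It remains to see that \<open>B\<close> is accounted for by the correction factor. The same middle entry, for commuting
  variables and \<open>a0 = 0\<close>, has a hidden symmetry, from which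
  \<open>B(x, y) B(x + y, z) = B(x, z) B(x + z, y)\<close> follows (\<open>B_cocycle\<close>). So \<open>B\<close> is a symmetric two-cocycle. Its
  logarithmic Euler derivative is \<open>K(x + y) - K(x) - K(y)\<close> with \<open>K(s) = \<Sum> c\<^sub>n s^n\<close> and \<open>c\<^sub>n\<close> the coefficient of
  \<open>X0^(n-1) X1\<close> in \<open>\<phi>\<close> (\<open>B_euler\<close>). Therefore \<open>C(x + y) = C(x) C(y) B(x, y)\<close> for \<open>C(s) = exp (\<Sum> c\<^sub>n s^n / n)\<close>
  (\<open>B_coboundary\<close>). Now \<open>C(- Y\<^sub>1)\<close> is the correction factor \<open>\<phi>\<^sub>c\<^sub>o\<^sub>r\<^sub>r\<close>, and \<open>Y\<^sub>1\<close> is primitive for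
  \<open>\<Delta>\<^sub>*\<close>, so multiplying by it turns the displayed identity into \<open>\<Delta>\<^sub>*(\<phi>\<^sub>*) = \<phi>\<^sub>* \<otimes> \<phi>\<^sub>*\<close>.
\<close>

unbundle fps_syntax

section \<open>Graded evaluation of non-commutative series\<close>

text \<open>
  A ring with a central ring homomorphism from the coefficient ring, that is, an algebra over the
  coefficient ring without a type of its own.
\<close>

locale scalars =
  fixes j :: "'r::comm_ring_1 \<Rightarrow> 'a::ring_1"
  assumes j_one [simp]: "j 1 = 1"
    and j_add: "j (r + s) = j r + j s"
    and j_mult: "j (r * s) = j r * j s"
    and j_central: "j r * x = x * j r"
begin

lemma j_zero [simp]: "j 0 = 0"
  using j_add [of 0 0] by simp

lemma j_uminus: "j (- r) = - j r"
  using j_add [of r "- r"] by (simp add: minus_unique)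

lemma j_diff: "j (r - s) = j r - j s"
  using j_add [of r "- s"] by (simp add: j_uminus)

lemma j_sum: "j (sum f A) = (\<Sum>i\<in>A. j (f i))"
  by (induction A rule: infinite_finite_induct) (auto simp: j_add)

end

text \<open>
  Evaluation of a series at elements of an arbitrary algebra. No topology is available there, so the
  homogeneous component of degree \<open>n\<close> is recorded as the \<open>n\<close>-th coefficient of a power series in an
  auxiliary central variable.
\<close>

definition gev :: "('r::comm_ring_1 \<Rightarrow> 'a::ring_1) \<Rightarrow> ('x::finite \<Rightarrow> 'a) \<Rightarrow> ('x, 'r) ncps \<Rightarrow> 'a fps" where
  "gev j h f = Abs_fps (\<lambda>n. \<Sum>w | length w = n. j (coeff f w) * prod_list (map h w))"

lemma finite_words [simp]: "finite {w :: 'x::finite list. length w = n}"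
  using finite_lists_length_eq [of "UNIV :: 'x set" n] by simp

lemma words_0 [simp]: "{w. length w = 0} = {[]}"
  by auto

lemma sum_words_Suc:
  fixes F :: "'x::finite list \<Rightarrow> 'b::comm_monoid_add"
  shows "(\<Sum>w | length w = Suc n. F w) = (\<Sum>x\<in>UNIV. \<Sum>w | length w = n. F (x # w))"
proof -
  have "(\<Sum>w | length w = Suc n. F w) = (\<Sum>(x, w)\<in>UNIV \<times> {w. length w = n}. F (x # w))"
    by (rule sum.reindex_bij_witness [where i = "\<lambda>(x, w). x # w" and j = "\<lambda>w. (hd w, tl w)"])
      (auto simp: length_Suc_conv)
  then show ?thesis by (simp add: sum.cartesian_product)
qed

lemma sum_words_Suc_snoc:
  fixes F :: "'x::finite list \<Rightarrow> 'b::comm_monoid_add"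
  shows "(\<Sum>w | length w = Suc n. F w) = (\<Sum>x\<in>UNIV. \<Sum>w | length w = n. F (w @ [x]))"
proof -
  have "(\<Sum>w | length w = Suc n. F w) = (\<Sum>(x, w)\<in>UNIV \<times> {w. length w = n}. F (w @ [x]))"
    by (rule sum.reindex_bij_witness [where i = "\<lambda>(x, w). w @ [x]" and j = "\<lambda>w. (last w, butlast w)"])
      (auto simp: length_Suc_conv_rev)
  then show ?thesis by (simp add: sum.cartesian_product)
qed

lemma UNIV_letter: "(UNIV :: letter set) = {X0, X1}"
  using letter.exhaust by auto

lemma gev_nth: "gev j h f $ n = (\<Sum>w | length w = n. j (coeff f w) * prod_list (map h w))"
  by (simp add: gev_def)

lemma gev_nth_0: "gev j h f $ 0 = j (coeff f [])"
  by (simp add: gev_nth)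

context scalars begin

lemma gev_one:
  fixes h :: "'x::finite \<Rightarrow> 'a"
  shows "gev j h 1 = 1"
proof (rule fps_ext)
  fix n
  have "gev j h 1 $ n = (\<Sum>w | length w = n. if w = ([] :: 'x list) then 1 else 0)"
    unfolding gev_nth by (rule sum.cong) auto
  then show "gev j h 1 $ n = 1 $ n" by (cases n) auto
qed

lemma gev_zero: "gev j h 0 = 0"
  by (rule fps_ext) (simp add: gev_nth)

lemma gev_add: "gev j h (f + g) = gev j h f + gev j h g"
  by (rule fps_ext) (simp add: gev_nth j_add distrib_right sum.distrib)

lemma gev_diff: "gev j h (f - g) = gev j h f - gev j h g"
  by (rule fps_ext) (simp add: gev_nth j_diff left_diff_distrib sum_subtractf)

lemma gev_mult: "gev j h (f * g) = gev j h f * gev j h g"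
proof (rule fps_ext)
  fix n
  define T where "T u v = j (coeff f u) * prod_list (map h u) * (j (coeff g v) * prod_list (map h v))" for u v
  have T: "T u v = j (coeff f u * coeff g v) * prod_list (map h (u @ v))" for u v
  proof -
    have "T u v = j (coeff f u) * (prod_list (map h u) * j (coeff g v)) * prod_list (map h v)"
      by (simp add: T_def mult.assoc)
    also have "prod_list (map h u) * j (coeff g v) = j (coeff g v) * prod_list (map h u)"
      by (simp add: j_central)
    finally show ?thesis by (simp add: j_mult mult.assoc)
  qed
  have "gev j h (f * g) $ n = (\<Sum>w | length w = n. \<Sum>p\<in>splits w. T (fst p) (snd p))"
    unfolding gev_nth
    by (intro sum.cong refl)
      (simp add: coeff_mult j_sum sum_distrib_right case_prod_unfold, intro sum.cong refl,
        auto simp: T splits_def)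
  also have "\<dots> = (\<Sum>(w, p)\<in>(SIGMA w:{w. length w = n}. splits w). T (fst p) (snd p))"
    by (rule sum.Sigma) auto
  also have "\<dots> = (\<Sum>(i, p)\<in>(SIGMA i:{0..n}. {u. length u = i} \<times> {v. length v = n - i}). T (fst p) (snd p))"
    by (rule sum.reindex_bij_witness [where i = "\<lambda>(i, p). (fst p @ snd p, p)"
          and j = "\<lambda>(w, p). (length (fst p), p)"]) (auto simp: splits_def)
  also have "\<dots> = (\<Sum>i=0..n. \<Sum>p\<in>{u. length u = i} \<times> {v. length v = n - i}. T (fst p) (snd p))"
    by (rule sum.Sigma [symmetric]) auto
  also have "\<dots> = (\<Sum>i=0..n. gev j h f $ i * gev j h g $ (n - i))"
    unfolding gev_nth sum_product sum.cartesian_product T_def by (simp add: case_prod_unfold)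
  also have "\<dots> = (gev j h f * gev j h g) $ n" by (simp add: fps_mult_nth)
  finally show "gev j h (f * g) $ n = (gev j h f * gev j h g) $ n" .
qed

lemma gev_var:
  fixes h :: "'x::finite \<Rightarrow> 'a"
  shows "gev j h (nc_var x) = fps_const (h x) * fps_X"
proof (rule fps_ext)
  fix n
  have "gev j h (nc_var x) $ n = (\<Sum>w | length w = n. if w = [x] then h x else 0)"
    unfolding gev_nth nc_var_def by (rule sum.cong) auto
  also have "\<dots> = (if n = 1 then h x else 0)"
    by auto
  finally show "gev j h (nc_var x) $ n = (fps_const (h x) * fps_X) $ n"
    by simp
qed

lemma gev_two_sided_ideal:
  assumes "f \<in> two_sided_ideal S" "\<And>s. s \<in> S \<Longrightarrow> gev j h s = 0"
  shows "gev j h f = 0"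
  using assms(1) by induction (auto simp: gev_zero gev_add gev_mult assms(2))

text \<open>
  A homogeneous component only sees finitely many words, so evaluation does not notice the passage
  to the closure.
\<close>

lemma gev_nc_closure:
  assumes "f \<in> nc_closure A" "\<And>g. g \<in> A \<Longrightarrow> gev j h g = 0"
  shows "gev j h f = 0"
proof (rule fps_ext)
  fix n
  obtain g where g: "g \<in> A" "\<And>w. length w \<le> n \<Longrightarrow> coeff f w = coeff g w"
    using assms(1) unfolding nc_closure_def by blast
  have "gev j h f $ n = gev j h g $ n"
    unfolding gev_nth by (rule sum.cong) (auto simp: g(2))
  then show "gev j h f $ n = 0 $ n" by (simp add: assms(2) [OF g(1)])
qed

text \<open>
  Only words of the same length contribute to a homogeneous component, so substituting linear forms is
  compatible with graded evaluation.
\<close>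

lemma gev_nc_subst:
  fixes k :: "'x::finite \<Rightarrow> ('y::finite, 'r) ncps" and h :: "'y \<Rightarrow> 'a"
  assumes lin: "\<And>x w. coeff (k x) w \<noteq> 0 \<Longrightarrow> length w = 1"
  shows "gev j h (nc_subst k f) = gev j (\<lambda>x. gev j h (k x) $ 1) f"
proof (rule fps_ext)
  fix n
  let ?h = "\<lambda>x. gev j h (k x) $ 1"
  have len: "length u = length w" if "coeff (prod_list (map k u)) w \<noteq> 0" for u w
    using that
  proof (induction u arbitrary: w)
    case (Cons x u)
    then have "(\<Sum>p\<in>splits w. coeff (k x) (fst p) * coeff (prod_list (map k u)) (snd p)) \<noteq> 0"
      by (simp add: coeff_mult case_prod_unfold)
    then obtain p where p: "p \<in> splits w"
        "coeff (k x) (fst p) * coeff (prod_list (map k u)) (snd p) \<noteq> 0"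
      by (rule sum.not_neutral_contains_not_neutral)
    have "coeff (k x) (fst p) \<noteq> 0" "coeff (prod_list (map k u)) (snd p) \<noteq> 0"
      using p(2) by auto
    from lin [OF this(1)] Cons.IH [OF this(2)] p(1) show ?case by (auto simp: splits_def)
  qed (auto split: if_splits)
  have c: "coeff (nc_subst k f) w = (\<Sum>u | length u = n. coeff f u * coeff (prod_list (map k u)) w)"
    if "length w = n" for w
    unfolding nc_subst_def nc_Sum_def coeff_Abs_ncps coeff_const_mult
    by (rule Sum_any.expand_superset) (use that in \<open>auto dest!: mult_not_zero intro: len\<close>)
  have lin': "gev j h (k x) = fps_const (?h x) * fps_X" for x
  proof (rule fps_ext)
    fix m
    have z: "m \<noteq> 1 \<Longrightarrow> gev j h (k x) $ m = 0"
      unfolding gev_nth by (rule sum.neutral) (use lin [of x] in force)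
    show "gev j h (k x) $ m = (fps_const (?h x) * fps_X) $ m"
    proof (cases "m = 1")
      case False
      with z show ?thesis by (simp add: fps_X_def)
    qed simp
  qed
  have prod: "gev j h (prod_list (map k u)) = fps_const (prod_list (map ?h u)) * fps_X ^ length u" for u
  proof (induction u)
    case (Cons x u)
    have "gev j h (prod_list (map k (x # u)))
        = fps_const (?h x) * fps_X * (fps_const (prod_list (map ?h u)) * fps_X ^ length u)"
      unfolding list.map prod_list.Cons gev_mult Cons.IH by (subst lin') (rule refl)
    also have "\<dots> = fps_const (?h x) * (fps_X * fps_const (prod_list (map ?h u))) * fps_X ^ length u"
      by (simp add: mult.assoc)
    also have "fps_X * fps_const (prod_list (map ?h u)) = fps_const (prod_list (map ?h u)) * fps_X"
      by (rule fps_ext) simp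
    finally show ?case by (simp only: mult.assoc list.map prod_list.Cons fps_const_mult [symmetric] length_Cons power_Suc)
  qed (simp add: gev_one)
  have "gev j h (nc_subst k f) $ n
     = (\<Sum>w | length w = n. \<Sum>u | length u = n. j (coeff f u) * (j (coeff (prod_list (map k u)) w) * prod_list (map h w)))"
    unfolding gev_nth
    by (intro sum.cong refl) (simp add: c j_sum j_mult sum_distrib_right mult.assoc)
  also have "\<dots> = (\<Sum>u | length u = n. j (coeff f u) * gev j h (prod_list (map k u)) $ n)"
    unfolding gev_nth sum_distrib_left by (rule sum.swap)
  also have "\<dots> = gev j ?h f $ n"
    unfolding gev_nth [of j ?h] by (rule sum.cong) (auto simp: prod)
  finally show "gev j h (nc_subst k f) $ n = gev j ?h f $ n" .
qed

end

section \<open>Group-like series\<close>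

definition linear_form :: "('x, 'r::ring_1) ncps \<Rightarrow> bool" where
  "linear_form f \<longleftrightarrow> (\<forall>w. coeff f w \<noteq> 0 \<longrightarrow> length w = 1)"

lemma linear_form_var: "linear_form (nc_var x)"
  by (simp add: linear_form_def nc_var_def)

lemma linear_form_add: "linear_form f \<Longrightarrow> linear_form g \<Longrightarrow> linear_form (f + g)"
  unfolding linear_form_def by (metis add.right_neutral coeff_simps(3))

abbreviation at_pair :: "('r::comm_ring_1 \<Rightarrow> 'a::ring_1) \<Rightarrow> 'a \<Rightarrow> 'a \<Rightarrow> 'r xseries \<Rightarrow> 'a fps" where
  "at_pair j a b \<equiv> gev j (case_letter a b)"

lemma (in scalars) gev_ev:
  fixes h :: "'y::finite \<Rightarrow> 'a"
  assumes "linear_form a" "linear_form b"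
  shows "gev j h (ev \<phi> a b) = at_pair j (gev j h a $ 1) (gev j h b $ 1) \<phi>"
proof -
  have "gev j h (ev \<phi> a b) = gev j (\<lambda>x. gev j h (case x of X0 \<Rightarrow> a | X1 \<Rightarrow> b) $ 1) \<phi>"
    unfolding ev_def
  proof (rule gev_nc_subst)
    fix x :: letter and w
    show "coeff (case x of X0 \<Rightarrow> a | X1 \<Rightarrow> b) w \<noteq> 0 \<Longrightarrow> length w = 1"
      using assms by (cases x) (auto simp: linear_form_def)
  qed
  moreover have "(\<lambda>x. gev j h (case x of X0 \<Rightarrow> a | X1 \<Rightarrow> b) $ 1)
      = case_letter (gev j h a $ 1) (gev j h b $ 1)"
    by (rule ext) (simp split: letter.split)
  ultimately show ?thesis by simp
qed

lemma coeff_var_mult: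
  "coeff (nc_var x * f) w = (case w of [] \<Rightarrow> 0 | y # v \<Rightarrow> if y = x then coeff f v else 0)"
proof (cases w)
  case (Cons y v)
  have "coeff (nc_var x * f) w = (\<Sum>p\<in>splits w. if p = ([y], v) then (if y = x then coeff f v else 0) else 0)"
    unfolding coeff_mult nc_var_def coeff_Abs_ncps case_prod_unfold
    by (rule sum.cong) (auto simp: splits_def Cons)
  also have "\<dots> = (if y = x then coeff f v else 0)"
  proof -
    have "([y], v) \<in> splits w" by (simp add: splits_def Cons)
    then show ?thesis by simp
  qed
  finally show ?thesis by (simp add: Cons)
qed (simp add: coeff_mult nc_var_def)

lemma tens_var_one: "tens (nc_var x) 1 = nc_var x"
  by (intro ncps_eqI) (auto simp: nc_var_def)

lemma tens_one_left: "tens 1 g = nc_const g"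
  by (intro ncps_eqI) (auto simp: nc_const_def)

abbreviation prim :: "'x \<Rightarrow> ('x, 'r::comm_ring_1) ncps2" where
  "prim x \<equiv> tens (nc_var x) 1 + tens 1 (nc_var x)"

lemma coeff_prim_mult:
  "coeff (coeff (prim x * F) u) v =
    (case u of [] \<Rightarrow> 0 | y # u' \<Rightarrow> if y = x then coeff (coeff F u') v else 0) +
    (case v of [] \<Rightarrow> 0 | y # v' \<Rightarrow> if y = x then coeff (coeff F u) v' else 0)"
  unfolding tens_var_one tens_one_left distrib_right coeff_simps coeff_const_mult coeff_var_mult
  by (simp split: list.split)

abbreviation deshuffle :: "'x list \<Rightarrow> 'x list \<Rightarrow> 'x list \<Rightarrow> 'r::comm_ring_1" where
  "deshuffle w u v \<equiv> coeff (coeff (prod_list (map prim w)) u) v"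

lemma deshuffle_length:
  assumes "deshuffle w u v \<noteq> (0 :: 'r::comm_ring_1)"
  shows "length u + length v = length w"
proof -
  have "sum_list (map (\<lambda>_. 1) u) + sum_list (map (\<lambda>_. 1) v) = sum_list (map (\<lambda>_. 1 :: nat) w)"
    using _ assms
  proof (rule coprod_word_homogeneous)
    fix x u v
    assume "coeff (coeff (prim x :: (_, 'r) ncps2) u) v \<noteq> 0"
    then have "u = [x] \<and> v = [] \<or> u = [] \<and> v = [x]"
      by (simp add: nc_var_def split: if_split_asm)
    then show "sum_list (map (\<lambda>_. 1) u) + sum_list (map (\<lambda>_. 1) v) = (1 :: nat)"
      by auto
  qed
  then show ?thesis by (simp add: sum_list_triv)
qed

definition word_pairs :: "nat \<Rightarrow> ('x list \<times> 'x list) set" where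
  "word_pairs n = {(u, v). length u + length v = n}"

lemma word_pairs_Sigma:
  "word_pairs n = (\<lambda>(i, p). p) ` (SIGMA i:{0..n}. {u. length u = i} \<times> {v. length v = n - i})"
proof (rule Set.set_eqI)
  fix p :: "'a list \<times> 'a list"
  obtain u v where p: "p = (u, v)" by (cases p)
  have "(u, v) = (\<lambda>(i, p). p) (length u, (u, v))" by simp
  then show "p \<in> word_pairs n \<longleftrightarrow> p \<in> (\<lambda>(i, p). p) ` (SIGMA i:{0..n}. {u. length u = i} \<times> {v. length v = n - i})"
    unfolding p word_pairs_def by (auto simp: image_iff Bex_def)
qed

lemma finite_word_pairs [simp]: "finite (word_pairs n :: ('x::finite list \<times> 'x list) set)"
  unfolding word_pairs_Sigma by (intro finite_imageI finite_SigmaI) auto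

lemma word_pairs_0: "word_pairs 0 = {([], [])}"
  by (auto simp: word_pairs_def)

lemma sum_word_pairs_left:
  fixes G :: "'x::finite list \<Rightarrow> 'x list \<Rightarrow> 'b::comm_monoid_add"
  shows "(\<Sum>p\<in>word_pairs (Suc n). case fst p of [] \<Rightarrow> 0 | y # u \<Rightarrow> if y = x then G u (snd p) else 0)
    = (\<Sum>p\<in>word_pairs n. G (fst p) (snd p))"
    (is "(\<Sum>p\<in>_. ?F p) = _")
proof -
  let ?i = "\<lambda>p. (x # fst p, snd p)"
  have "(\<Sum>p\<in>word_pairs (Suc n). ?F p) = (\<Sum>p\<in>?i ` word_pairs n. ?F p)"
  proof (rule sum.mono_neutral_right)
    show "?i ` word_pairs n \<subseteq> word_pairs (Suc n)" by (auto simp: word_pairs_def)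
    show "\<forall>p\<in>word_pairs (Suc n) - ?i ` word_pairs n. ?F p = 0"
    proof
      fix p assume p: "p \<in> word_pairs (Suc n) - ?i ` word_pairs n"
      have False if "fst p = x # u" for u
      proof -
        have "p = ?i (u, snd p)" "(u, snd p) \<in> word_pairs n"
          using that p by (auto simp: word_pairs_def prod_eq_iff)
        with p show False by blast
      qed
      then show "?F p = 0" by (auto split: list.split)
    qed
  qed simp
  also have "\<dots> = (\<Sum>p\<in>word_pairs n. G (fst p) (snd p))"
    by (subst sum.reindex) (auto simp: inj_on_def)
  finally show ?thesis .
qed

lemma sum_word_pairs_right:
  fixes G :: "'x::finite list \<Rightarrow> 'x list \<Rightarrow> 'b::comm_monoid_add"
  shows "(\<Sum>p\<in>word_pairs (Suc n). case snd p of [] \<Rightarrow> 0 | y # v \<Rightarrow> if y = x then G (fst p) v else 0)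
    = (\<Sum>p\<in>word_pairs n. G (fst p) (snd p))"
    (is "(\<Sum>p\<in>_. ?F p) = _")
proof -
  let ?i = "\<lambda>p. (fst p, x # snd p)"
  have "(\<Sum>p\<in>word_pairs (Suc n). ?F p) = (\<Sum>p\<in>?i ` word_pairs n. ?F p)"
  proof (rule sum.mono_neutral_right)
    show "?i ` word_pairs n \<subseteq> word_pairs (Suc n)" by (auto simp: word_pairs_def)
    show "\<forall>p\<in>word_pairs (Suc n) - ?i ` word_pairs n. ?F p = 0"
    proof
      fix p assume p: "p \<in> word_pairs (Suc n) - ?i ` word_pairs n"
      have False if "snd p = x # u" for u
      proof -
        have "p = ?i (fst p, u)" "(fst p, u) \<in> word_pairs n"
          using that p by (auto simp: word_pairs_def prod_eq_iff)
        with p show False by blast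
      qed
      then show "?F p = 0" by (auto split: list.split)
    qed
  qed simp
  also have "\<dots> = (\<Sum>p\<in>word_pairs n. G (fst p) (snd p))"
    by (subst sum.reindex) (auto simp: inj_on_def)
  finally show ?thesis .
qed

lemma coeff_\<Delta>:
  fixes \<phi> :: "'r::comm_ring_1 xseries"
  shows "coeff (coeff (\<Delta> \<phi>) u) v
    = (\<Sum>w | length w = length u + length v. coeff \<phi> w * deshuffle w u v)"
  unfolding \<Delta>_def nc_coprod_def nc_Sum_def coeff_Abs_ncps coeff_const_mult
  by (rule Sum_any.expand_superset)
    (auto dest!: mult_not_zero intro: deshuffle_length [symmetric])

context scalars begin

lemma j_left_commute: "x * (j r * y) = j r * (x * y)"
  by (metis j_central mult.assoc)

text \<open>
  The multiplicities in the expansion of a product of sums \<open>h x + k x\<close>, where the \<open>h\<close>s can be moved to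
  the left of the \<open>k\<close>s, are the coefficients of the coproduct of the word.
\<close>

lemma prod_list_sum_commuting:
  fixes h k :: "'x::finite \<Rightarrow> 'a"
  assumes comm: "\<And>x y. h x * k y = k y * h x"
  shows "prod_list (map (\<lambda>x. h x + k x) w)
    = (\<Sum>p\<in>word_pairs (length w). j (deshuffle w (fst p) (snd p))
         * (prod_list (map h (fst p)) * prod_list (map k (snd p))))"
proof (induction w)
  case Nil
  then show ?case by (simp add: word_pairs_0)
next
  case (Cons x w)
  let ?H = "\<lambda>u. prod_list (map h u)" and ?K = "\<lambda>v. prod_list (map k v)"
  let ?D = "\<lambda>u v. j (deshuffle w u v)"
  have kH: "k x * ?H u = ?H u * k x" for u
  proof (induction u)
    case (Cons y u)
    have "k x * (h y * ?H u) = (h y * k x) * ?H u" by (simp only: comm mult.assoc [symmetric])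
    also have "\<dots> = h y * ?H u * k x" by (simp only: mult.assoc Cons.IH)
    finally show ?case by simp
  qed simp
  have "prod_list (map (\<lambda>x. h x + k x) (x # w))
      = (\<Sum>p\<in>word_pairs (length w). h x * (?D (fst p) (snd p) * (?H (fst p) * ?K (snd p))))
      + (\<Sum>p\<in>word_pairs (length w). k x * (?D (fst p) (snd p) * (?H (fst p) * ?K (snd p))))"
    by (simp only: list.map prod_list.Cons Cons.IH distrib_right sum_distrib_left sum.distrib)
  also have "(\<Sum>p\<in>word_pairs (length w). h x * (?D (fst p) (snd p) * (?H (fst p) * ?K (snd p))))
      = (\<Sum>p\<in>word_pairs (length w). ?D (fst p) (snd p) * (?H (x # fst p) * ?K (snd p)))"
    by (intro sum.cong refl) (simp add: j_left_commute mult.assoc)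
  also have "\<dots> = (\<Sum>p\<in>word_pairs (Suc (length w)). case fst p of [] \<Rightarrow> 0 | y # u \<Rightarrow>
      if y = x then ?D u (snd p) * (?H (x # u) * ?K (snd p)) else 0)"
    by (rule sum_word_pairs_left [symmetric])
  also have "(\<Sum>p\<in>word_pairs (length w). k x * (?D (fst p) (snd p) * (?H (fst p) * ?K (snd p))))
      = (\<Sum>p\<in>word_pairs (length w). ?D (fst p) (snd p) * (?H (fst p) * ?K (x # snd p)))"
  proof (intro sum.cong refl)
    fix p
    have "k x * (?H (fst p) * ?K (snd p)) = ?H (fst p) * (k x * ?K (snd p))"
      by (simp only: kH mult.assoc [symmetric])
    then show "k x * (?D (fst p) (snd p) * (?H (fst p) * ?K (snd p)))
        = ?D (fst p) (snd p) * (?H (fst p) * ?K (x # snd p))"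
      by (simp add: j_left_commute)
  qed
  also have "\<dots> = (\<Sum>p\<in>word_pairs (Suc (length w)). case snd p of [] \<Rightarrow> 0 | y # v \<Rightarrow>
      if y = x then ?D (fst p) v * (?H (fst p) * ?K (x # v)) else 0)"
    by (rule sum_word_pairs_right [symmetric])
  finally show ?case
    unfolding sum.distrib [symmetric] length_Cons list.map prod_list.Cons coeff_prim_mult
    by (rule trans) (intro sum.cong refl, auto simp: j_add distrib_right split: list.split)
qed

text \<open>
  Evaluating \<open>\<Delta> \<phi> = \<phi> \<otimes> \<phi>\<close> at two commuting families of elements turns group-likeness into an
  exponential law.
\<close>

lemma group_like_exponential:
  fixes h k :: "letter \<Rightarrow> 'a"
  assumes "group_like \<phi>" and comm: "\<And>x y. h x * k y = k y * h x"
  shows "gev j (\<lambda>x. h x + k x) \<phi> = gev j h \<phi> * gev j k \<phi>"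
proof (rule fps_ext)
  fix n
  let ?H = "\<lambda>u. prod_list (map h u)" and ?K = "\<lambda>v. prod_list (map k v)"
  have "gev j (\<lambda>x. h x + k x) \<phi> $ n = (\<Sum>w | length w = n. \<Sum>p\<in>word_pairs n.
      j (coeff \<phi> w * deshuffle w (fst p) (snd p)) * (?H (fst p) * ?K (snd p)))"
    unfolding gev_nth
    by (intro sum.cong refl) (auto simp: prod_list_sum_commuting [OF comm] sum_distrib_left j_mult mult.assoc)
  also have "\<dots> = (\<Sum>p\<in>word_pairs n. j (coeff (coeff (\<Delta> \<phi>) (fst p)) (snd p)) * (?H (fst p) * ?K (snd p)))"
    by (subst sum.swap, intro sum.cong refl)
      (auto simp: coeff_\<Delta> word_pairs_def sum_distrib_right j_sum)
  also have "\<dots> = (\<Sum>p\<in>word_pairs n. j (coeff \<phi> (fst p)) * ?H (fst p) * (j (coeff \<phi> (snd p)) * ?K (snd p)))"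
    using assms(1) unfolding group_like_def
  proof (intro sum.cong refl)
    fix p
    have "j (coeff \<phi> (fst p)) * ?H (fst p) * (j (coeff \<phi> (snd p)) * ?K (snd p))
        = j (coeff \<phi> (fst p)) * (j (coeff \<phi> (snd p)) * (?H (fst p) * ?K (snd p)))"
      by (simp only: mult.assoc j_left_commute [of "?H (fst p)"])
    then show "j (coeff (coeff (\<Delta> \<phi>) (fst p)) (snd p)) * (?H (fst p) * ?K (snd p))
        = j (coeff \<phi> (fst p)) * ?H (fst p) * (j (coeff \<phi> (snd p)) * ?K (snd p))"
      using assms(1) by (simp add: group_like_def j_mult mult.assoc)
  qed
  also have "\<dots> = (\<Sum>(i, p)\<in>(SIGMA i:{0..n}. {u. length u = i} \<times> {v. length v = n - i}).
      j (coeff \<phi> (fst p)) * ?H (fst p) * (j (coeff \<phi> (snd p)) * ?K (snd p)))"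
    unfolding word_pairs_Sigma by (subst sum.reindex) (auto simp: inj_on_def case_prod_unfold intro!: sum.cong)
  also have "\<dots> = (\<Sum>i=0..n. \<Sum>p\<in>{u. length u = i} \<times> {v. length v = n - i}.
      j (coeff \<phi> (fst p)) * ?H (fst p) * (j (coeff \<phi> (snd p)) * ?K (snd p)))"
    by (rule sum.Sigma [symmetric]) auto
  also have "\<dots> = (gev j h \<phi> * gev j k \<phi>) $ n"
    unfolding fps_mult_nth gev_nth sum_product sum.cartesian_product by (simp add: case_prod_unfold)
  finally show "gev j (\<lambda>x. h x + k x) \<phi> $ n = (gev j h \<phi> * gev j k \<phi>) $ n" .
qed

lemma at_pair_single_X0: "at_pair j a 0 \<phi> $ n = j (coeff \<phi> (replicate n X0)) * a ^ n"
proof -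
  have *: "prod_list (map (case_letter a 0) w) = (if w = replicate (length w) X0 then a ^ length w else 0)" for w
    by (induction w) (auto split: letter.split)
  have "at_pair j a 0 \<phi> $ n = (\<Sum>w | length w = n. if w = replicate n X0 then j (coeff \<phi> w) * a ^ n else 0)"
    unfolding gev_nth by (rule sum.cong) (auto simp: *)
  then show ?thesis by (simp)
qed

lemma at_pair_single_X1: "at_pair j 0 b \<phi> $ n = j (coeff \<phi> (replicate n X1)) * b ^ n"
proof -
  have *: "prod_list (map (case_letter 0 b) w) = (if w = replicate (length w) X1 then b ^ length w else 0)" for w
    by (induction w) (auto split: letter.split)
  have "at_pair j 0 b \<phi> $ n = (\<Sum>w | length w = n. if w = replicate n X1 then j (coeff \<phi> w) * b ^ n else 0)"
    unfolding gev_nth by (rule sum.cong) (auto simp: *)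
  then show ?thesis by (simp)
qed

lemma group_like_at_pair:
  assumes "group_like \<phi>" "a * x = x * a" "a * y = y * a" "b * x = x * b" "b * y = y * b"
  shows "at_pair j (a + x) (b + y) \<phi> = at_pair j a b \<phi> * at_pair j x y \<phi>"
proof -
  have "(case_letter (a + x) (b + y)) = (\<lambda>l. case_letter a b l + case_letter x y l)"
    by (rule ext) (simp split: letter.split)
  with group_like_exponential [OF assms(1), of "case_letter a b" "case_letter x y"] assms(2-)
  show ?thesis by (simp split: letter.splits)
qed

end

lemma scalars_self: "scalars (\<lambda>r :: 'r::comm_ring_1. r)"
  by standard (auto simp: mult.commute)

text \<open>
  The coefficient ring may have zero divisors, so characteristic \<open>0\<close> enters as the cancellation of
  positive integers.
\<close>

definition torsion_free :: "'r::comm_ring_1 itself \<Rightarrow> bool" where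
  "torsion_free _ \<longleftrightarrow> (\<forall>m (x::'r). m > 0 \<longrightarrow> of_nat m * x = 0 \<longrightarrow> x = 0)"

lemma torsion_freeD: "torsion_free TYPE('r::comm_ring_1) \<Longrightarrow> m > 0 \<Longrightarrow> of_nat m * x = 0 \<Longrightarrow> x = (0::'r)"
  unfolding torsion_free_def by blast

text \<open>
  Put \<open>c n\<close> for the coefficient of the \<open>n\<close>-th power of a letter. The exponential law at \<open>1 + 1\<close> reads
  \<open>2^n c n = \<Sum> c i c (n - i)\<close>, and once the intermediate \<open>c i\<close> vanish it says \<open>(2^n - 2) c n = 0\<close>.
\<close>

lemma group_like_power_coeff:
  fixes \<phi> :: "'r::comm_ring_1 xseries"
  assumes tf: "torsion_free TYPE('r)" and gl: "group_like \<phi>"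
  shows "coeff \<phi> [X0] = 0 \<Longrightarrow> n > 0 \<Longrightarrow> coeff \<phi> (replicate n X0) = 0"
    and "coeff \<phi> [X1] = 0 \<Longrightarrow> n > 0 \<Longrightarrow> coeff \<phi> (replicate n X1) = 0"
proof -
  have main: "\<forall>n>0. c n = 0"
    if c: "c 0 = 1" "c 1 = 0" "\<And>n. c n * 2 ^ n = (\<Sum>i=0..n. c i * c (n - i))" for c :: "nat \<Rightarrow> 'r"
  proof (intro allI impI)
    fix n :: nat
    show "n > 0 \<Longrightarrow> c n = 0"
    proof (induction n rule: less_induct)
      case (less n)
      show ?case
      proof (cases "n = 1")
        case False
        with less.prems obtain m where n: "n = Suc (Suc m)"
          by (metis One_nat_def gr0_implies_Suc not0_implies_Suc)
        have "c n * 2 ^ n = (\<Sum>i=0..n. c i * c (n - i))" by (rule c(3))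
        also have "\<dots> = (\<Sum>i\<in>{0, n}. c i * c (n - i))"
        proof (rule sum.mono_neutral_right)
          show "\<forall>i\<in>{0..n} - {0, n}. c i * c (n - i) = 0"
          proof
            fix i assume "i \<in> {0..n} - {0, n}"
            then have "i < n" "i > 0" by simp_all
            from less.IH [OF this] show "c i * c (n - i) = 0" by simp
          qed
        qed auto
        also have "\<dots> = c n + c n" using less.prems c(1) by simp
        finally have "c n * 2 ^ n = c n + c n" .
        moreover have "of_nat (2 ^ n - 2) = (2 ^ n - 2 :: 'r)"
          by (subst of_nat_diff) (auto simp: n)
        ultimately have "of_nat (2 ^ n - 2) * c n = 0"
          by (simp add: left_diff_distrib mult.commute [of _ "c n"] right_diff_distrib)
        moreover have "(2 :: nat) ^ 1 < 2 ^ n"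
          by (rule power_strict_increasing) (simp_all add: n)
        then have "(2 ^ n - 2 :: nat) > 0" by simp
        ultimately show ?thesis using torsion_freeD [OF tf] by blast
      qed (use c in simp)
    qed
  qed
  have e: "coeff \<phi> [] = 1" using gl by (simp add: group_like_def)
  have "at_pair (\<lambda>r. r) (1 + 1) (0 + 0) \<phi> = at_pair (\<lambda>r. r) 1 0 \<phi> * at_pair (\<lambda>r. r) 1 (0::'r) \<phi>"
    by (rule scalars.group_like_at_pair [OF scalars_self gl]) auto
  then have eq: "at_pair (\<lambda>r. r) 2 0 \<phi> $ n = (at_pair (\<lambda>r. r) 1 0 \<phi> * at_pair (\<lambda>r. r) 1 0 \<phi>) $ n" for n
    by simp
  have "coeff \<phi> (replicate n X0) * 2 ^ n
      = (\<Sum>i=0..n. coeff \<phi> (replicate i X0) * coeff \<phi> (replicate (n - i) X0))" for n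
    using eq [of n] unfolding fps_mult_nth scalars.at_pair_single_X0 [OF scalars_self] by simp
  from main [of "\<lambda>n. coeff \<phi> (replicate n X0)", OF _ _ this]
  show "coeff \<phi> [X0] = 0 \<Longrightarrow> n > 0 \<Longrightarrow> coeff \<phi> (replicate n X0) = 0"
    by (simp add: e)
  have "at_pair (\<lambda>r. r) (0 + 0) (1 + 1) \<phi> = at_pair (\<lambda>r. r) 0 1 \<phi> * at_pair (\<lambda>r. r) 0 (1::'r) \<phi>"
    by (rule scalars.group_like_at_pair [OF scalars_self gl]) auto
  then have eq: "at_pair (\<lambda>r. r) 0 2 \<phi> $ n = (at_pair (\<lambda>r. r) 0 1 \<phi> * at_pair (\<lambda>r. r) 0 1 \<phi>) $ n" for n
    by simp
  have "coeff \<phi> (replicate n X1) * 2 ^ n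
      = (\<Sum>i=0..n. coeff \<phi> (replicate i X1) * coeff \<phi> (replicate (n - i) X1))" for n
    using eq [of n] unfolding fps_mult_nth scalars.at_pair_single_X1 [OF scalars_self] by simp
  from main [of "\<lambda>n. coeff \<phi> (replicate n X1)", OF _ _ this]
  show "coeff \<phi> [X1] = 0 \<Longrightarrow> n > 0 \<Longrightarrow> coeff \<phi> (replicate n X1) = 0"
    by (simp add: e)
qed

text \<open>
  The group-like series in the commutator subgroup: these do not see commuting arguments.
\<close>

definition commutator_like :: "'r::comm_ring_1 xseries \<Rightarrow> bool" where
  "commutator_like \<phi> \<longleftrightarrow> group_like \<phi> \<and>
     (\<forall>n>0. coeff \<phi> (replicate n X0) = 0 \<and> coeff \<phi> (replicate n X1) = 0)"

context scalars begin

lemma at_pair_single: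
  assumes "commutator_like \<phi>"
  shows "at_pair j a 0 \<phi> = 1" "at_pair j 0 b \<phi> = 1"
proof -
  have e: "coeff \<phi> [] = 1" and c: "\<And>n. n > 0 \<Longrightarrow> coeff \<phi> (replicate n X0) = 0"
    "\<And>n. n > 0 \<Longrightarrow> coeff \<phi> (replicate n X1) = 0"
    using assms by (auto simp: commutator_like_def group_like_def)
  have "at_pair j a 0 \<phi> $ n = 1 $ n" for n
    using e c(1) [of n] by (cases "n = 0") (simp_all add: at_pair_single_X0)
  moreover have "at_pair j 0 b \<phi> $ n = 1 $ n" for n
    using e c(2) [of n] by (cases "n = 0") (simp_all add: at_pair_single_X1)
  ultimately show "at_pair j a 0 \<phi> = 1" "at_pair j 0 b \<phi> = 1"
    by (simp_all add: fps_eq_iff)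
qed

lemma at_pair_commuting:
  assumes "commutator_like \<phi>" "x * y = y * x"
  shows "at_pair j x y \<phi> = 1"
  using group_like_at_pair [where a = x and x = 0 and b = 0 and y = y and \<phi> = \<phi>] assms at_pair_single [OF assms(1)]
  by (simp add: commutator_like_def)

text \<open>
  This makes it possible to replace the arguments of the pentagon by the generators \<open>t\<^sub>i\<^sub>5\<close> of the
  spherical braid Lie algebra.
\<close>

lemma at_pair_shift:
  assumes "commutator_like \<phi>" "a * x = x * a" "a * y = y * a" "b * x = x * b" "b * y = y * b" "x * y = y * x"
  shows "at_pair j (a + x) (b + y) \<phi> = at_pair j a b \<phi>"
  using group_like_at_pair [where a = a and x = x and b = b and y = y and \<phi> = \<phi>] assms at_pair_commuting [of \<phi> x y]
  by (simp add: commutator_like_def)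

end

section \<open>Three by three matrices\<close>

datatype 'a mat3 = Mat3 (m11: 'a) (m12: 'a) (m13: 'a) (m21: 'a) (m22: 'a) (m23: 'a) (m31: 'a) (m32: 'a) (m33: 'a)

instantiation mat3 :: (ring_1) ring_1
begin

definition "0 = Mat3 0 0 0 0 0 0 0 0 0"
definition "1 = Mat3 1 0 0 0 1 0 0 0 1"
definition "a + b = Mat3 (m11 a + m11 b) (m12 a + m12 b) (m13 a + m13 b) (m21 a + m21 b) (m22 a + m22 b) (m23 a + m23 b) (m31 a + m31 b) (m32 a + m32 b) (m33 a + m33 b)"
definition "a - b = Mat3 (m11 a - m11 b) (m12 a - m12 b) (m13 a - m13 b) (m21 a - m21 b) (m22 a - m22 b) (m23 a - m23 b) (m31 a - m31 b) (m32 a - m32 b) (m33 a - m33 b)"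
definition "- a = Mat3 (- m11 a) (- m12 a) (- m13 a) (- m21 a) (- m22 a) (- m23 a) (- m31 a) (- m32 a) (- m33 a)"
definition "a * b = Mat3
    (m11 a * m11 b + m12 a * m21 b + m13 a * m31 b)
    (m11 a * m12 b + m12 a * m22 b + m13 a * m32 b)
    (m11 a * m13 b + m12 a * m23 b + m13 a * m33 b)
    (m21 a * m11 b + m22 a * m21 b + m23 a * m31 b)
    (m21 a * m12 b + m22 a * m22 b + m23 a * m32 b)
    (m21 a * m13 b + m22 a * m23 b + m23 a * m33 b)
    (m31 a * m11 b + m32 a * m21 b + m33 a * m31 b)
    (m31 a * m12 b + m32 a * m22 b + m33 a * m32 b)
    (m31 a * m13 b + m32 a * m23 b + m33 a * m33 b)"

instance
  by standard
    (simp_all add: zero_mat3_def one_mat3_def plus_mat3_def minus_mat3_def uminus_mat3_def times_mat3_def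
      algebra_simps)

end

lemmas mat3_defs = zero_mat3_def one_mat3_def plus_mat3_def minus_mat3_def uminus_mat3_def times_mat3_def

lemma mat3_sum_entry:
  "m11 (sum F A) = (\<Sum>i\<in>A. m11 (F i))"
  "m12 (sum F A) = (\<Sum>i\<in>A. m12 (F i))"
  "m13 (sum F A) = (\<Sum>i\<in>A. m13 (F i))"
  "m21 (sum F A) = (\<Sum>i\<in>A. m21 (F i))"
  "m22 (sum F A) = (\<Sum>i\<in>A. m22 (F i))"
  "m23 (sum F A) = (\<Sum>i\<in>A. m23 (F i))"
  "m31 (sum F A) = (\<Sum>i\<in>A. m31 (F i))"
  "m32 (sum F A) = (\<Sum>i\<in>A. m32 (F i))"
  "m33 (sum F A) = (\<Sum>i\<in>A. m33 (F i))"
  by (induction A rule: infinite_finite_induct; simp add: mat3_defs)+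

definition scal :: "'a::ring_1 \<Rightarrow> 'a mat3" where
  "scal r = Mat3 r 0 0 0 r 0 0 0 r"

lemma scalars_mat3:
  assumes "scalars j"
  shows "scalars (\<lambda>r. scal (j r))"
proof -
  interpret scalars j by fact
  show ?thesis
  proof
    fix r x
    show "scal (j r) * x = x * scal (j r)"
      by (simp add: scal_def mat3_defs, intro conjI, (rule j_central)+)
  qed (simp_all add: scal_def mat3_defs j_add j_mult)
qed

section \<open>Representations of the infinitesimal braid relations\<close>

instance idx :: finite
proof
  have "(UNIV :: idx set) = {I1, I2, I3, I4}" using idx.exhaust by auto
  then show "finite (UNIV :: idx set)" by (metis finite.emptyI finite_insert)
qed

text \<open>
  The relations of the enveloping algebra of \<open>\<aa>\<^sub>4\<close>, imposed on a family of elements of a ring.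
\<close>

definition a4_rep :: "(idx \<times> idx \<Rightarrow> 'a::ring_1) \<Rightarrow> bool" where
  "a4_rep h \<longleftrightarrow> (\<forall>i. h (i, i) = 0) \<and> (\<forall>i j. h (i, j) = h (j, i)) \<and>
    (\<forall>i j k. distinct [i, j, k] \<longrightarrow> commutator (h (i, j)) (h (i, k) + h (j, k)) = 0) \<and>
    (\<forall>i j k l. distinct [i, j, k, l] \<longrightarrow> commutator (h (i, j)) (h (k, l)) = 0)"

fun sym_family :: "'a::ring_1 \<Rightarrow> 'a \<Rightarrow> 'a \<Rightarrow> 'a \<Rightarrow> 'a \<Rightarrow> 'a \<Rightarrow> idx \<times> idx \<Rightarrow> 'a" where
  "sym_family t12 t13 t14 t23 t24 t34 (I1, I2) = t12" | "sym_family t12 t13 t14 t23 t24 t34 (I2, I1) = t12"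
| "sym_family t12 t13 t14 t23 t24 t34 (I1, I3) = t13" | "sym_family t12 t13 t14 t23 t24 t34 (I3, I1) = t13"
| "sym_family t12 t13 t14 t23 t24 t34 (I1, I4) = t14" | "sym_family t12 t13 t14 t23 t24 t34 (I4, I1) = t14"
| "sym_family t12 t13 t14 t23 t24 t34 (I2, I3) = t23" | "sym_family t12 t13 t14 t23 t24 t34 (I3, I2) = t23"
| "sym_family t12 t13 t14 t23 t24 t34 (I2, I4) = t24" | "sym_family t12 t13 t14 t23 t24 t34 (I4, I2) = t24"
| "sym_family t12 t13 t14 t23 t24 t34 (I3, I4) = t34" | "sym_family t12 t13 t14 t23 t24 t34 (I4, I3) = t34"
| "sym_family t12 t13 t14 t23 t24 t34 _ = 0"

lemma a4_rep_sym_family: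
  fixes t12 t13 t14 t23 t24 t34 :: "'a::ring_1"
  assumes triples:
      "commutator t12 (t13 + t23) = 0" "commutator t13 (t12 + t23) = 0" "commutator t23 (t12 + t13) = 0"
      "commutator t12 (t14 + t24) = 0" "commutator t14 (t12 + t24) = 0" "commutator t24 (t12 + t14) = 0"
      "commutator t13 (t14 + t34) = 0" "commutator t14 (t13 + t34) = 0" "commutator t34 (t13 + t14) = 0"
      "commutator t23 (t24 + t34) = 0" "commutator t24 (t23 + t34) = 0" "commutator t34 (t23 + t24) = 0"
    and pairs: "commutator t12 t34 = 0" "commutator t13 t24 = 0" "commutator t14 t23 = 0"
  shows "a4_rep (sym_family t12 t13 t14 t23 t24 t34)" (is "a4_rep ?T")
proof -
  have sym: "?T (i, k) = ?T (k, i)" for i k by (cases i; cases k) auto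
  have flip: "commutator y x = 0" if "commutator x y = 0" for x y :: 'a
    using that by (simp add: commutator_def)
  have swap: "commutator x (z + y) = 0" if "commutator x (y + z) = 0" for x y z :: 'a
    using that by (simp add: add.commute)
  have "commutator (?T (i, k)) (?T (i, l) + ?T (k, l)) = 0" if "distinct [i, k, l]" for i k l
    using that by (cases i; cases k; cases l) (simp_all add: triples triples [THEN swap])
  moreover have "commutator (?T (i, k)) (?T (l, m)) = 0" if "distinct [i, k, l, m]" for i k l m
    using that by (cases i; cases k; cases l; cases m) (simp_all add: pairs pairs [THEN flip])
  moreover have "?T (i, i) = 0" for i by (cases i) auto
  ultimately show ?thesis by (auto simp: a4_rep_def intro: sym)
qed

lemma fps_const_X_mult:
  "fps_const a * fps_X * (fps_const b * fps_X) = fps_const (a * b) * fps_X ^ 2"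
  for a b :: "'a::ring_1"
proof -
  have X: "fps_X * fps_const b = fps_const b * fps_X" by (rule fps_ext) simp
  have "fps_const a * fps_X * (fps_const b * fps_X) = fps_const a * (fps_X * fps_const b) * fps_X"
    by (simp add: mult.assoc)
  also have "\<dots> = fps_const a * fps_const b * (fps_X * fps_X)"
    unfolding X by (simp only: mult.assoc)
  finally show ?thesis by (simp add: power2_eq_square)
qed

context scalars begin

lemma gev_tgen: "gev j h (tgen i k) = fps_const (h (i, k)) * fps_X"
  by (simp add: tgen_def gev_var)

text \<open>
  Every family satisfying the relations defines a homomorphism from the completed enveloping algebra.
\<close>

lemma gev_eq_Ua4:
  assumes h: "a4_rep h" and eq: "eq_Ua4 f g"
  shows "gev j h f = gev j h g"
proof -
  have comm: "gev j h (commutator f g) = fps_const (commutator a b) * fps_X ^ 2"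
    if "gev j h f = fps_const a * fps_X" "gev j h g = fps_const b * fps_X" for f g a b
    unfolding commutator_def gev_diff gev_mult that fps_const_X_mult
    by (simp only: fps_const_sub [symmetric] left_diff_distrib)
  have add: "gev j h (tgen i k + tgen l m) = fps_const (h (i, k) + h (l, m)) * fps_X" for i k l m
    by (simp only: gev_add gev_tgen fps_const_add [symmetric] distrib_right)
  have h0: "h (i, i) = 0" "h (i, k) = h (k, i)"
      "distinct [i, k, l] \<Longrightarrow> commutator (h (i, k)) (h (i, l) + h (k, l)) = 0"
      "distinct [i, k, l, m] \<Longrightarrow> commutator (h (i, k)) (h (l, m)) = 0" for i k l m
    using h unfolding a4_rep_def by blast+
  have rel: "gev j h s = 0" if "s \<in> a4_relators" for s
    using that unfolding a4_relators_def
  proof (elim UnE CollectE exE conjE)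
    fix i assume "s = tgen i i"
    then show ?thesis by (simp add: gev_tgen h0(1))
  next
    fix i k assume "s = tgen i k - tgen k i"
    then show ?thesis by (simp add: gev_tgen gev_diff h0(2) [of i k])
  next
    fix i k l assume "s = commutator (tgen i k) (tgen i l + tgen k l)" "distinct [i, k, l]"
    then show ?thesis by (simp only: comm [OF gev_tgen add] h0(3)) simp
  next
    fix i k l m assume "s = commutator (tgen i k) (tgen l m)" "distinct [i, k, l, m]"
    then show ?thesis by (simp only: comm [OF gev_tgen gev_tgen] h0(4)) simp
  qed
  have "gev j h (f - g) = 0"
    using eq unfolding eq_Ua4_def
    by (rule gev_nc_closure) (rule gev_two_sided_ideal [OF _ rel])
  then show ?thesis by (simp add: gev_diff)
qed

end

definition pentagon :: "'r::comm_ring_1 xseries \<Rightarrow> bool" where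
  "pentagon \<phi> \<longleftrightarrow>
    eq_Ua4 (ev \<phi> (tgen I1 I2) (tgen I2 I3 + tgen I2 I4) * ev \<phi> (tgen I1 I3 + tgen I2 I3) (tgen I3 I4))
      (ev \<phi> (tgen I2 I3) (tgen I3 I4) * ev \<phi> (tgen I1 I2 + tgen I1 I3) (tgen I2 I4 + tgen I3 I4) *
       ev \<phi> (tgen I1 I2) (tgen I2 I3))"

lemma linear_form_tgen: "linear_form (tgen i k)"
  by (simp add: tgen_def linear_form_var)

lemma (in scalars) pentagon_rep:
  assumes "pentagon \<phi>" "a4_rep h"
  shows "at_pair j (h (I1, I2)) (h (I2, I3) + h (I2, I4)) \<phi> * at_pair j (h (I1, I3) + h (I2, I3)) (h (I3, I4)) \<phi>
    = at_pair j (h (I2, I3)) (h (I3, I4)) \<phi> * at_pair j (h (I1, I2) + h (I1, I3)) (h (I2, I4) + h (I3, I4)) \<phi> *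
      at_pair j (h (I1, I2)) (h (I2, I3)) \<phi>"
  using gev_eq_Ua4 [OF assms(2) assms(1) [unfolded pentagon_def]]
  by (simp add: gev_mult gev_ev linear_form_tgen linear_form_add gev_tgen gev_add)

lemma (in scalars) at_pair_nth:
  "at_pair j a b \<phi> $ 0 = j (coeff \<phi> [])"
  "at_pair j a b \<phi> $ Suc 0 = j (coeff \<phi> [X0]) * a + j (coeff \<phi> [X1]) * b"
  "at_pair j a b \<phi> $ Suc (Suc 0) = j (coeff \<phi> [X0, X0]) * (a * a) + j (coeff \<phi> [X0, X1]) * (a * b)
     + j (coeff \<phi> [X1, X0]) * (b * a) + j (coeff \<phi> [X1, X1]) * (b * b)"
  by (simp add: gev_nth_0)
    (simp_all add: gev_nth sum_words_Suc UNIV_letter add.assoc)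

text \<open>
  In degree one the pentagon says \<open>c t\<^sub>1\<^sub>2 + d t\<^sub>3\<^sub>4 = 0\<close> with \<open>c\<close>, \<open>d\<close> the linear coefficients. In a
  commutative ring the relations only ask for symmetry, so any single generator can be sent to \<open>1\<close> and
  the others to \<open>0\<close>.
\<close>

lemma pentagon_linear_part:
  fixes \<phi> :: "'r::comm_ring_1 xseries"
  assumes "group_like \<phi>" "pentagon \<phi>"
  shows "coeff \<phi> [X0] = 0" "coeff \<phi> [X1] = 0"
proof -
  note pentagon_rep = scalars.pentagon_rep [OF scalars_self assms(2)]
    and at_pair_nth = scalars.at_pair_nth [OF scalars_self]
  define h :: "idx \<Rightarrow> idx \<Rightarrow> idx \<times> idx \<Rightarrow> 'r" where
    "h i k = (\<lambda>p. if p = (i, k) \<or> p = (k, i) then 1 else 0)" for i k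
  have rep: "a4_rep (h i k)" if "i \<noteq> k" for i k
  proof -
    have "commutator a b = 0" for a b :: 'r
      by (simp add: commutator_def mult.commute)
    then show ?thesis unfolding a4_rep_def using that by (auto simp: h_def)
  qed
  have e: "coeff \<phi> [] = 1" using assms(1) by (simp add: group_like_def)
  note lin = arg_cong [OF pentagon_rep [OF rep], of I1 I2 "\<lambda>F. F $ Suc 0"]
    arg_cong [OF pentagon_rep [OF rep], of I3 I4 "\<lambda>F. F $ Suc 0"]
  show "coeff \<phi> [X0] = 0"
    using lin(1) by (simp add: fps_mult_nth at_pair_nth e h_def)
  show "coeff \<phi> [X1] = 0"
    using lin(2) by (simp add: fps_mult_nth at_pair_nth e h_def)
qed

section \<open>The quadratic part of the hexagon\<close>

lemma coeff_power_eq_0: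
  fixes g :: "('x, 'r::ring_1) ncps"
  assumes "coeff g [] = 0" "length w < n"
  shows "coeff (g ^ n) w = 0"
proof (rule ccontr)
  assume "coeff (g ^ n) w \<noteq> 0"
  then have "coeff (prod_list (map (\<lambda>_. g) (replicate n ()))) w \<noteq> 0"
    by (simp add: prod_list_replicate)
  then have "length (replicate n ()) \<le> length w"
    using assms(1) by (intro coeff_prod_list_nonzero)
  with assms(2) show False by simp
qed

text \<open>
  The inverse is the geometric series in \<open>1 - f\<close>, truncated in each coefficient.
\<close>

lemma nc_inv_mult:
  fixes f :: "('x, 'r::ring_1) ncps"
  assumes "coeff f [] = 1"
  shows "f * nc_inv f = 1" "nc_inv f * f = 1"
proof -
  define g where "g = 1 - f"
  have g0: "coeff g [] = 0" by (simp add: g_def assms)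
  \<comment> \<open>Powers of \<open>g\<close> beyond the length of a word do not contribute to its coefficient.\<close>
  define i where "i = Abs_ncps (\<lambda>w. \<Sum>n\<le>length w. coeff (g ^ n) w)"
  have i: "coeff i w = (\<Sum>n\<le>N. coeff (g ^ n) w)" if "length w \<le> N" for w N
    unfolding i_def coeff_Abs_ncps
    by (rule sum.mono_neutral_left) (use that g0 in \<open>auto intro: coeff_power_eq_0\<close>)
  have len: "p \<in> splits w \<Longrightarrow> length (fst p) \<le> length w \<and> length (snd p) \<le> length w" for p and w :: "'x list"
    by (auto simp: splits_def)
  have tel: "coeff i w - (\<Sum>n\<le>length w. coeff (g ^ Suc n) w) = coeff 1 w" for w
  proof -
    have "coeff (g ^ Suc (length w)) w = 0" using g0 by (intro coeff_power_eq_0) auto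
    then have "(\<Sum>n\<le>length w. coeff (g ^ n) w) = (\<Sum>n\<le>Suc (length w). coeff (g ^ n) w)"
      by (simp del: power_Suc)
    also have "\<dots> = coeff (g ^ 0) w + (\<Sum>n\<le>length w. coeff (g ^ Suc n) w)"
      by (rule sum.atMost_Suc_shift)
    finally show ?thesis by (simp add: i_def del: power_Suc)
  qed
  have "coeff (g * i) w = (\<Sum>n\<le>length w. coeff (g ^ Suc n) w)" for w
    unfolding coeff_mult power_Suc case_prod_unfold
    by (subst sum.swap) (intro sum.cong refl, simp add: i [of _ "length w"] len sum_distrib_left)
  then have "i - g * i = 1" by (intro ncps_eqI) (simp only: coeff_simps tel)
  then have right: "f * i = 1" by (simp add: g_def algebra_simps)
  have "coeff (i * g) w = (\<Sum>n\<le>length w. coeff (g ^ Suc n) w)" for w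
    unfolding coeff_mult power_Suc2 case_prod_unfold
    by (subst sum.swap) (intro sum.cong refl, simp add: i [of _ "length w"] len sum_distrib_right)
  then have "i - i * g = 1" by (intro ncps_eqI) (simp only: coeff_simps tel)
  then have left: "i * f = 1" by (simp add: g_def algebra_simps)
  have "f * nc_inv f = 1 \<and> nc_inv f * f = 1"
    unfolding nc_inv_def
  proof (rule theI)
    show "f * i = 1 \<and> i * f = 1" using left right by simp
    show "k = i" if "f * k = 1 \<and> k * f = 1" for k
      by (metis that left mult.assoc mult_1_left mult_1_right)
  qed
  then show "f * nc_inv f = 1" "nc_inv f * f = 1" by auto
qed

context scalars begin

lemma gev_const_mult: "gev j h (nc_const r * f) = fps_const (j r) * gev j h f"
  by (rule fps_ext) (simp add: gev_nth j_mult sum_distrib_left mult.assoc)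

lemma gev_linear_form:
  assumes "linear_form f"
  shows "gev j h f = fps_const (gev j h f $ 1) * fps_X"
proof (rule fps_ext)
  fix m
  have z: "m \<noteq> 1 \<Longrightarrow> gev j h f $ m = 0"
    unfolding gev_nth by (rule sum.neutral) (use assms in \<open>auto simp: linear_form_def, metis j_zero mult_zero_left\<close>)
  show "gev j h f $ m = (fps_const (gev j h f $ 1) * fps_X) $ m"
  proof (cases "m = 1")
    case False
    with z show ?thesis by (simp add: fps_X_def)
  qed simp
qed

lemma gev_power: "gev j h (f ^ n) = gev j h f ^ n"
  by (induction n) (simp_all add: gev_one gev_mult)

lemma gev_nc_exp:
  assumes "linear_form f"
  shows "gev j h (nc_exp \<iota> f) $ n = j (\<iota> (1 / fact n)) * (gev j h f $ 1) ^ n"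
proof -
  have len: "length w = n" if "coeff (f ^ n) w \<noteq> 0" for n w
    using that
  proof (induction n arbitrary: w)
    case (Suc n)
    then have "(\<Sum>p\<in>splits w. coeff f (fst p) * coeff (f ^ n) (snd p)) \<noteq> 0"
      by (simp add: coeff_mult case_prod_unfold)
    then obtain q where q: "q \<in> splits w" "coeff f (fst q) * coeff (f ^ n) (snd q) \<noteq> 0"
      by (rule sum.not_neutral_contains_not_neutral)
    have "coeff f (fst q) \<noteq> 0" "coeff (f ^ n) (snd q) \<noteq> 0" using q(2) by auto
    with Suc.IH [OF this(2)] assms q(1) show ?case by (auto simp: splits_def linear_form_def)
  qed (auto split: if_splits)
  have c: "coeff (nc_exp \<iota> f) w = \<iota> (1 / fact (length w)) * coeff (f ^ length w) w" for w
  proof -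
    have "coeff (nc_exp \<iota> f) w = (\<Sum>n\<in>{length w}. \<iota> (1 / fact n) * coeff (f ^ n) w)"
      unfolding nc_exp_def nc_Sum_def coeff_Abs_ncps coeff_const_mult
      by (rule Sum_any.expand_superset) (use len [of _ w] in \<open>auto dest!: mult_not_zero\<close>)
    then show ?thesis by simp
  qed
  have pow: "(fps_const x * fps_X) ^ n = fps_const (x ^ n) * fps_X ^ n" for x :: 'a
  proof (induction n)
    case (Suc n)
    have X: "fps_X * fps_const y = fps_const y * fps_X" for y :: 'a by (rule fps_ext) simp
    have "(fps_const x * fps_X) ^ Suc n = fps_const x * (fps_X * fps_const (x ^ n)) * fps_X ^ n"
      by (simp add: Suc.IH mult.assoc)
    also have "\<dots> = fps_const x * fps_const (x ^ n) * (fps_X * fps_X ^ n)"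
      unfolding X by (simp only: mult.assoc)
    finally show ?case by simp
  qed simp
  have "gev j h (nc_exp \<iota> f) $ n = (\<Sum>w | length w = n. j (\<iota> (1 / fact n)) * (j (coeff (f ^ n) w) * prod_list (map h w)))"
    unfolding gev_nth by (rule sum.cong) (auto simp: c j_mult mult.assoc)
  also have "\<dots> = j (\<iota> (1 / fact n)) * gev j h (f ^ n) $ n"
    by (simp only: gev_nth sum_distrib_left)
  also have "gev j h (f ^ n) $ n = (gev j h f $ 1) ^ n"
    unfolding gev_power by (subst gev_linear_form [OF assms], subst pow) simp
  finally show ?thesis .
qed

end

lemma fps_mult_nth_unit:
  fixes F G :: "'a::ring_1 fps"
  assumes "F $ 0 = 1" "G $ 0 = 1"
  shows "(F * G) $ 0 = 1" "(F * G) $ Suc 0 = F $ Suc 0 + G $ Suc 0"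
    "(F * G) $ Suc (Suc 0) = F $ Suc (Suc 0) + F $ Suc 0 * G $ Suc 0 + G $ Suc (Suc 0)"
  by (simp_all add: fps_mult_nth assms algebra_simps)

lemma group_like_quadratic_part:
  fixes \<phi> :: "'r::comm_ring_1 xseries"
  assumes "commutator_like \<phi>"
  shows "coeff \<phi> [X0] = 0" "coeff \<phi> [X1] = 0" "coeff \<phi> [X0, X0] = 0" "coeff \<phi> [X1, X1] = 0" "coeff \<phi> [X1, X0] = - coeff \<phi> [X0, X1]"
proof -
  show "coeff \<phi> [X0] = 0" "coeff \<phi> [X1] = 0"
    using assms unfolding commutator_like_def by (auto dest: spec [of _ "Suc 0"])
  have r: "replicate 2 l = [l, l]" for l :: letter by (simp add: numeral_2_eq_2)
  show 00: "coeff \<phi> [X0, X0] = 0" and 11: "coeff \<phi> [X1, X1] = 0"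
    using assms unfolding commutator_like_def r [symmetric] by auto
  have "at_pair (\<lambda>r. r) 1 1 \<phi> $ Suc (Suc 0) = (1 :: 'r fps) $ Suc (Suc 0)"
    by (simp only: scalars.at_pair_commuting [OF scalars_self assms])
  then show "coeff \<phi> [X1, X0] = - coeff \<phi> [X0, X1]"
    by (simp add: scalars.at_pair_nth [OF scalars_self] 00 11 eq_neg_iff_add_eq_0 add.commute)
qed

lemma (in k_algebra) map_zero: "\<iota> 0 = 0"
  using map_add [of 0 0] by simp

lemma (in k_algebra) map_of_nat: "\<iota> (of_nat n) = of_nat n"
  by (induction n) (simp_all add: map_zero map_one map_add)

lemma (in k_algebra) torsion_free: "torsion_free TYPE('r)"
  unfolding torsion_free_def
proof (intro allI impI)
  fix m and x :: 'r
  assume "m > 0" "of_nat m * x = 0"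
  have "x = \<iota> (1 / of_nat m * of_nat m) * x" using \<open>m > 0\<close> by (simp add: map_one)
  also have "\<dots> = \<iota> (1 / of_nat m) * (of_nat m * x)" by (simp only: map_mult map_of_nat mult.assoc)
  finally show "x = 0" using \<open>of_nat m * x = 0\<close> by simp
qed

text \<open>
  In degree two the first hexagon says \<open>3 c [t\<^sub>1\<^sub>3, t\<^sub>2\<^sub>3] = \<mu>\<^sup>2/8 [t\<^sub>1\<^sub>3, t\<^sub>2\<^sub>3]\<close>, where \<open>c\<close> is the coefficient
  of \<open>X0 X1\<close>. The Heisenberg representation on strictly upper triangular matrices detects the
  commutator.
\<close>

theorem hexagon_quadratic_part:
  fixes \<phi> :: "'r::comm_ring_1 xseries" and \<iota> :: "'k::field_char_0 \<Rightarrow> 'r"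
  assumes k: "k_algebra \<iota>" and gt: "GT_relations \<iota> \<mu> \<phi>" and cl: "commutator_like \<phi>"
  shows "coeff \<phi> [X0, X1] = \<iota> (\<mu>\<^sup>2 / 24)"
proof -
  interpret k_algebra \<iota> by fact
  interpret J: scalars "scal :: 'r \<Rightarrow> _" by (rule scalars_mat3) (rule scalars_self)
  \<comment> \<open>The entry \<open>(1, 3)\<close> of the degree two component is compared at the end.\<close>
  define e12 e23 :: "'r mat3" where "e12 = Mat3 0 1 0 0 0 0 0 0 0" and "e23 = Mat3 0 0 0 0 0 1 0 0 0"
  define h where "h = sym_family e12 (- e12 - e23) 0 e23 0 0"
  have rep: "a4_rep h"
    unfolding h_def by (rule a4_rep_sym_family) (simp_all add: commutator_def algebra_simps)
  let ?t12 = "tgen I1 I2 :: 'r tseries" and ?t13 = "tgen I1 I3 :: 'r tseries" and ?t23 = "tgen I2 I3 :: 'r tseries"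
  let ?m = "\<iota> (\<mu> / 2)" and ?c = "coeff \<phi> [X0, X1]"
  let ?E = "\<lambda>a. gev scal h (nc_exp \<iota> (nc_const ?m * a))"
  let ?P = "\<lambda>a b. gev scal h (ev \<phi> a b)"
  define I where "I = gev scal h (nc_inv (ev \<phi> ?t13 ?t23))"
  have e: "coeff \<phi> [] = 1" using cl by (simp add: commutator_like_def group_like_def)
  have "eq_Ua4 (nc_exp \<iota> (nc_const ?m * (?t13 + ?t23)))
     (ev \<phi> ?t13 ?t12 * nc_exp \<iota> (nc_const ?m * ?t13) * nc_inv (ev \<phi> ?t13 ?t23) *
      nc_exp \<iota> (nc_const ?m * ?t23) * ev \<phi> ?t12 ?t23)"
    using gt unfolding GT_relations_def Let_def by blast
  from J.gev_eq_Ua4 [OF rep this]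
  have main: "?E (?t13 + ?t23) = ?P ?t13 ?t12 * ?E ?t13 * I * ?E ?t23 * ?P ?t12 ?t23"
    by (simp only: J.gev_mult I_def)
  have lin: "linear_form (nc_const ?m * a)" if "linear_form a" for a :: "'r tseries"
    using that by (auto simp: linear_form_def dest!: mult_not_zero)
  have E: "?E a $ 0 = 1" "?E a $ Suc 0 = scal ?m * x" "?E a $ Suc (Suc 0) = scal (\<iota> (1 / 2) * (?m * ?m)) * (x * x)"
    if "linear_form a" "gev scal h a $ Suc 0 = x" for a x
    using that
    by (simp_all add: J.gev_nc_exp lin J.gev_const_mult map_one J.j_mult mult.assoc)
      (simp only: J.j_left_commute [of x])
  have P: "?P a b $ 0 = 1" "?P a b $ Suc 0 = 0" "?P a b $ Suc (Suc 0) = scal ?c * commutator x y"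
    if "linear_form a" "gev scal h a $ Suc 0 = x" "linear_form b" "gev scal h b $ Suc 0 = y" for a b x y
    using that
    by (simp_all add: J.gev_ev J.at_pair_nth e group_like_quadratic_part [OF cl] J.j_uminus commutator_def algebra_simps)
  have lt: "linear_form (tgen i k :: 'r tseries)" for i k by (rule linear_form_tgen)
  have g: "gev scal h (tgen i k) $ Suc 0 = h (i, k)" for i k by (simp add: J.gev_tgen)
  have g2: "gev scal h (tgen i k + tgen l m) $ Suc 0 = h (i, k) + h (l, m)" for i k l m
    by (simp add: J.gev_tgen J.gev_add)
  have I: "I $ 0 = 1" "I $ Suc 0 = 0" "I $ Suc (Suc 0) = - (scal ?c * commutator (h (I1, I3)) (h (I2, I3)))"
  proof -
    have "coeff (ev \<phi> ?t13 ?t23) [] = 1"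
      using scalars.gev_ev [OF scalars_self lt lt, where h = "\<lambda>_. 0" and \<phi> = \<phi>]
      by (simp add: fps_eq_iff scalars.at_pair_nth [OF scalars_self] gev_nth_0 e)
        (metis e gev_nth_0)
    then have "I * ?P ?t13 ?t23 = 1"
      by (simp only: I_def J.gev_mult [symmetric] nc_inv_mult J.gev_one)
    then have *: "(I * ?P ?t13 ?t23) $ n = 1 $ n" for n by simp
    show "I $ 0 = 1" using * [of 0] by (simp add: P [OF lt g lt g])
    with * [of "Suc 0"] * [of "Suc (Suc 0)"] show "I $ Suc 0 = 0"
      "I $ Suc (Suc 0) = - (scal ?c * commutator (h (I1, I3)) (h (I2, I3)))"
      by (simp_all add: fps_mult_nth_unit P [OF lt g lt g] eq_neg_iff_add_eq_0)
  qed
  have "?E (?t13 + ?t23) $ Suc (Suc 0) = (?P ?t13 ?t12 * ?E ?t13 * I * ?E ?t23 * ?P ?t12 ?t23) $ Suc (Suc 0)"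
    by (simp only: main)
  also have "\<dots> = scal ?c * commutator (h (I1, I3)) (h (I1, I2)) + scal (\<iota> (1 / 2) * (?m * ?m)) * (h (I1, I3) * h (I1, I3))
     - scal ?c * commutator (h (I1, I3)) (h (I2, I3)) + scal ?m * h (I1, I3) * (scal ?m * h (I2, I3))
     + scal (\<iota> (1 / 2) * (?m * ?m)) * (h (I2, I3) * h (I2, I3)) + scal ?c * commutator (h (I1, I2)) (h (I2, I3))"
    by (simp add: fps_mult_nth_unit E [OF lt g] P [OF lt g lt g] I)
  also have "?E (?t13 + ?t23) $ Suc (Suc 0) = scal (\<iota> (1 / 2) * (?m * ?m)) * ((h (I1, I3) + h (I2, I3)) * (h (I1, I3) + h (I2, I3)))"
    by (rule E(3) [OF linear_form_add [OF lt lt] g2])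
  finally have "0 = ?c + \<iota> (1 / 2) * (?m * ?m) + ?c - ?m * ?m + ?c"
    by (simp add: h_def e12_def e23_def commutator_def scal_def mat3_defs algebra_simps)
  also have "\<iota> (1 / 2) * (?m * ?m) = \<iota> (\<mu>\<^sup>2 / 8)"
    by (simp add: map_mult [symmetric] power2_eq_square)
  also have "?m * ?m = \<iota> (\<mu>\<^sup>2 / 4)"
    by (simp add: map_mult [symmetric] power2_eq_square)
  also have "\<iota> (\<mu>\<^sup>2 / 4) = \<iota> (\<mu>\<^sup>2 / 8) + (\<iota> (\<mu>\<^sup>2 / 24) + \<iota> (\<mu>\<^sup>2 / 24) + \<iota> (\<mu>\<^sup>2 / 24))"
    by (simp add: map_add [symmetric])
  finally have "of_nat 3 * (?c - \<iota> (\<mu>\<^sup>2 / 24)) = 0"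
    by (simp add: algebra_simps)
  then have "?c - \<iota> (\<mu>\<^sup>2 / 24) = 0"
    by (rule torsion_freeD [OF torsion_free, rotated]) simp
  then show ?thesis by simp
qed

section \<open>The pentagon in a representation of rank three\<close>

abbreviation word_at :: "'a::ring_1 \<Rightarrow> 'a \<Rightarrow> letter list \<Rightarrow> 'a" where
  "word_at x y w \<equiv> prod_list (map (case_letter x y) w)"

text \<open>
  Only words not ending in \<open>X0\<close> matter for \<open>\<pi>\<^sub>Y\<close>.
\<close>

definition trim :: "'r::comm_ring_1 xseries \<Rightarrow> 'r xseries" where
  "trim f = Abs_ncps (\<lambda>w. if w \<noteq> [] \<and> last w = X0 then 0 else coeff f w)"

lemma coeff_trim [simp]: "coeff (trim f) w = (if w \<noteq> [] \<and> last w = X0 then 0 else coeff f w)"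
  by (simp add: trim_def)

text \<open>
  The ring in which the matrix entries lie: \<open>(a0, a1)\<close> and \<open>(t, b)\<close> play the letters \<open>(X0, X1)\<close> of the
  first and of the second tensor factor.
\<close>

locale two_commuting_pairs = scalars j
  for j :: "'r::comm_ring_1 \<Rightarrow> 'a::ring_1" +
  fixes a0 a1 t b :: 'a
  assumes comm: "a0 * t = t * a0" "a0 * b = b * a0" "a1 * t = t * a1" "a1 * b = b * a1"
begin

lemma comm_left: "a0 * (t * x) = t * (a0 * x)" "a0 * (b * x) = b * (a0 * x)"
  "a1 * (t * x) = t * (a1 * x)" "a1 * (b * x) = b * (a1 * x)"
  by (simp_all add: mult.assoc [symmetric] comm)

text \<open>
  The matrices below arise as follows. Modulo its centre, \<open>\<aa>\<^sub>4\<close> is the infinitesimal spherical braid Lie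
  algebra on five points. The ideal of its enveloping algebra generated by the \<open>t\<^sub>1\<^sub>i\<close>, the kernel of
  forgetting the point \<open>1\<close>, is a free left module with basis \<open>t\<^sub>1\<^sub>2\<close>, \<open>t\<^sub>1\<^sub>5\<close>, \<open>t\<^sub>1\<^sub>3\<close>. Right multiplication
  on it gives \<open>3 \<times> 3\<close> matrices over the enveloping algebra, and their entries are then mapped to the
  tensor square of the free algebra by forgetting the point \<open>5\<close> in the first and the point \<open>2\<close> in the second
  factor: \<open>a0\<close>, \<open>a1\<close> are the images of \<open>t\<^sub>2\<^sub>3\<close>, \<open>t\<^sub>1\<^sub>2\<close>, and \<open>t\<close>, \<open>b\<close> those of \<open>t\<^sub>4\<^sub>5\<close>, \<open>t\<^sub>1\<^sub>5\<close>.
\<close>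

definition p where "p = t - a0 - a1"
definition s where "s = a1 + b"

definition "T12 = Mat3 a1 0 0 b 0 0 p 0 0"
definition "T13 = Mat3 0 0 a1 0 0 b 0 0 p"
definition "T14 = - Mat3 a1 a1 a1 b b b p p p"
definition "T23 = Mat3 (a0 + p) 0 (- a1) 0 a0 0 (- p) 0 (a0 + a1)"
definition "T24 = - Mat3 (t + b) (- a1) (- a1) 0 (a0 + a1) 0 0 0 (a0 + a1)"
definition "T34 = Mat3 s 0 0 0 s 0 p p 0"

definition "T15 = Mat3 0 a1 0 0 b 0 0 p 0"
definition "T45 = Mat3 t 0 0 b a0 b 0 0 t"

lemmas T_defs = T12_def T13_def T14_def T23_def T24_def T34_def T15_def T45_def

lemma T45_eq: "T12 + T13 + T23 = T45"
  by (simp add: T_defs mat3_defs p_def)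

lemma T15_eq: "T23 + T24 + T34 = T15"
  by (simp add: T_defs mat3_defs p_def s_def)

lemmas T_calc = commutator_def T_defs mat3_defs p_def s_def algebra_simps comm comm_left

lemma T_relations_123:
  "commutator T12 (T13 + T23) = 0" "commutator T13 (T12 + T23) = 0" "commutator T23 (T12 + T13) = 0"
  by (simp_all add: T_calc)

lemma T_relations_124:
  "commutator T12 (T14 + T24) = 0" "commutator T14 (T12 + T24) = 0" "commutator T24 (T12 + T14) = 0"
  by (simp_all add: T_calc)

lemma T_relations_134:
  "commutator T13 (T14 + T34) = 0" "commutator T14 (T13 + T34) = 0" "commutator T34 (T13 + T14) = 0"
  by (simp_all add: T_calc)

lemma T_relations_234:
  "commutator T23 (T24 + T34) = 0" "commutator T24 (T23 + T34) = 0" "commutator T34 (T23 + T24) = 0"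
  by (simp_all add: T_calc)

lemma T_relations_disjoint:
  "commutator T12 T34 = 0" "commutator T13 T24 = 0" "commutator T14 T23 = 0"
  by (simp_all add: T_calc)

lemma T_commute:
  "T12 * T34 = T34 * T12" "T15 * T34 = T34 * T15" "T45 * T12 = T12 * T45"
  "T45 * T23 = T23 * T45" "T15 * T23 = T23 * T15"
  by (simp_all add: T_calc)

lemma T_rep: "a4_rep (sym_family T12 T13 T14 T23 T24 T34)"
  by (rule a4_rep_sym_family)
    (fact T_relations_123 T_relations_124 T_relations_134 T_relations_234 T_relations_disjoint)+

abbreviation J :: "'r \<Rightarrow> 'a mat3" where "J \<equiv> \<lambda>r. scal (j r)"

text \<open>
  Each argument of the pentagon differs from one of the \<open>T\<close>s by a matrix that commutes with both
  arguments of the factor in question.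
\<close>

lemma pentagon_matrices:
  assumes "pentagon \<phi>" "commutator_like \<phi>"
  shows "at_pair J T12 T15 \<phi> * at_pair J T45 T34 \<phi>
    = at_pair J T23 T34 \<phi> * at_pair J T45 T15 \<phi> * at_pair J T12 T23 \<phi>"
proof -
  interpret J: scalars J by (rule scalars_mat3) (rule scalars_axioms)
  have "at_pair J T12 (T23 + T24) \<phi> = at_pair J (T12 + 0) (T15 + - T34) \<phi>"
    by (simp add: T15_eq [symmetric])
  also have "\<dots> = at_pair J T12 T15 \<phi>"
    by (rule J.at_pair_shift [OF assms(2)]) (simp_all add: T_commute)
  finally have 1: "at_pair J T12 (T23 + T24) \<phi> = at_pair J T12 T15 \<phi>" .
  have "at_pair J (T13 + T23) T34 \<phi> = at_pair J (T45 + - T12) (T34 + 0) \<phi>"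
    by (simp add: T45_eq [symmetric])
  also have "\<dots> = at_pair J T45 T34 \<phi>"
    by (rule J.at_pair_shift [OF assms(2)]) (simp_all add: T_commute)
  finally have 2: "at_pair J (T13 + T23) T34 \<phi> = at_pair J T45 T34 \<phi>" .
  have "at_pair J (T12 + T13) (T24 + T34) \<phi> = at_pair J (T45 + - T23) (T15 + - T23) \<phi>"
    by (simp add: T45_eq [symmetric] T15_eq [symmetric])
  also have "\<dots> = at_pair J T45 T15 \<phi>"
    by (rule J.at_pair_shift [OF assms(2)]) (simp_all add: T_commute)
  finally have 3: "at_pair J (T12 + T13) (T24 + T34) \<phi> = at_pair J T45 T15 \<phi>" .
  show ?thesis
    using J.pentagon_rep [OF assms(1) T_rep] by (simp add: 1 2 3)
qed

lemma gev_entry: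
  fixes h :: "'x::finite \<Rightarrow> 'a mat3"
  assumes "entry = m11 \<or> entry = m12 \<or> entry = m13 \<or> entry = m21 \<or> entry = m22 \<or> entry = m23
    \<or> entry = m31 \<or> entry = m32 \<or> entry = m33"
  shows "entry (gev J h f $ n) = (\<Sum>w | length w = n. j (coeff f w) * entry (prod_list (map h w)))"
  using assms by (auto simp: gev_nth mat3_sum_entry scal_def times_mat3_def)

subsection \<open>The entries of words\<close>

lemma word_12_15: "m23 (word_at T12 T15 w) = 0"
  by (cases w rule: rev_cases) (auto simp: mat3_defs T_defs split: letter.split)

lemma word_45_34: "m12 (word_at T45 T34 w) = 0"
  by (induction w) (auto simp: mat3_defs T_defs split: letter.split)

lemma word_23_34:
  "m21 (word_at T23 T34 w) = 0" "m23 (word_at T23 T34 w) = 0" "m22 (word_at T23 T34 w) = word_at a0 s w"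
  by (induction w) (auto simp: mat3_defs T_defs split: letter.split)

lemma word_12_23:
  "m12 (word_at T12 T23 w) = 0 \<and> m32 (word_at T12 T23 w) = 0 \<and> m22 (word_at T12 T23 w) = word_at 0 a0 w"
  by (induction w rule: rev_induct) (auto simp: mat3_defs T_defs split: letter.split)

text \<open>
  The column \<open>(a1, b, p)\<close> consists of the images of the basis itself, so it spans a
  subrepresentation, on which the matrices act through scalars.
\<close>

lemma T15_intertwines:
  "T12 * T15 = T15 * scal a1" "T15 * T15 = T15 * scal b" "T45 * T15 = T15 * scal t"
  by (simp_all add: T_calc scal_def)

lemma word_times_T15:
  assumes "x * T15 = T15 * scal u" "y * T15 = T15 * scal v"
  shows "word_at x y w * T15 = T15 * scal (word_at u v w)"
proof (induction w)
  case Nil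
  show ?case by (simp add: scal_def mat3_defs)
next
  case (Cons l w)
  have sc: "scal c * scal d = scal (c * d)" for c d :: 'a by (simp add: scal_def mat3_defs)
  show ?case
    by (cases l) (simp_all add: mult.assoc Cons.IH, simp_all add: mult.assoc [symmetric] assms,
      simp_all add: mult.assoc sc)
qed

lemma m22_T15_scal: "m22 (T15 * scal c) = b * c"
  by (simp add: T15_def scal_def mat3_defs)

text \<open>
  These entries belong to the three factors of the pentagon that do not act on the middle row or
  column by scalars. Their sums, weighted with the coefficients of \<open>\<phi>\<close>, are the cocycle \<open>B\<close>, the
  harmonic coproduct of \<open>\<phi>\<close>, and \<open>\<phi>(t, b)\<close>, the last two up to conjugation by \<open>b\<close> and modulo the
  left ideal generated by \<open>a0\<close>, as far as words not ending in \<open>X0\<close> are concerned.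
\<close>

definition B_word :: "letter list \<Rightarrow> 'a" where "B_word w = m22 (word_at T12 T15 w)"
definition E_word :: "letter list \<Rightarrow> 'a" where "E_word w = m22 (word_at T45 T34 w)"
definition F_word :: "letter list \<Rightarrow> 'a" where "F_word w = m22 (word_at T45 T15 w)"

lemma word_b_commute: "word_at a1 b w * b = b * word_at a1 b w"
  by (induction w) (simp_all add: mult.assoc comm_left split: letter.split)

lemma B_word_simps:
  "B_word [] = 1" "B_word (w @ [X0]) = 0" "B_word (w @ [X1]) = word_at a1 b (w @ [X1])"
proof -
  show "B_word [] = 1" by (simp add: B_word_def mat3_defs)
  show "B_word (w @ [X0]) = 0" by (simp add: B_word_def mat3_defs T12_def)
  show "B_word (w @ [X1]) = word_at a1 b (w @ [X1])"
    by (simp add: B_word_def word_times_T15 [OF T15_intertwines(1,2)] m22_T15_scal word_b_commute)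
qed

lemma F_word_simps:
  "F_word [] = 1" "F_word (w @ [X0]) = F_word w * a0" "F_word (w @ [X1]) = b * word_at t b w"
proof -
  show "F_word [] = 1" by (simp add: F_word_def mat3_defs)
  show "F_word (w @ [X0]) = F_word w * a0" by (simp add: F_word_def mat3_defs T45_def)
  show "F_word (w @ [X1]) = b * word_at t b w"
    by (simp add: F_word_def word_times_T15 [OF T15_intertwines(3,2)] m22_T15_scal)
qed

text \<open>
  The sum of the \<open>a0^i t^k\<close> over \<open>i + k = n - 1\<close>.
\<close>

fun cross :: "nat \<Rightarrow> 'a" where
  "cross 0 = 0"
| "cross (Suc n) = a0 * cross n + t ^ n"

definition G where "G n = a0 ^ n * s + b * cross n * p"

lemma powers_commute: "t ^ n * a0 = a0 * t ^ n" "t ^ n * a1 = a1 * t ^ n"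
  "a0 ^ n * b = b * a0 ^ n" "a0 ^ n * t = t * a0 ^ n"
  by (induction n) (simp_all add: mult.assoc comm_left comm)

lemma cross_telescope: "cross n * (t - a0) = t ^ n - a0 ^ n"
proof (induction n)
  case (Suc n)
  have "cross (Suc n) * (t - a0) = a0 * (cross n * (t - a0)) + t ^ n * (t - a0)"
    by (simp add: distrib_right mult.assoc)
  also have "\<dots> = a0 * (t ^ n - a0 ^ n) + t ^ n * (t - a0)" by (simp only: Suc.IH)
  finally show ?case by (simp add: algebra_simps powers_commute power_commutes)
qed simp

lemma T45_power:
  "m11 (T45 ^ n) = t ^ n" "m12 (T45 ^ n) = 0" "m13 (T45 ^ n) = 0"
  "m21 (T45 ^ n) = b * cross n" "m22 (T45 ^ n) = a0 ^ n" "m23 (T45 ^ n) = b * cross n"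
  "m31 (T45 ^ n) = 0" "m32 (T45 ^ n) = 0" "m33 (T45 ^ n) = t ^ n"
  by (induction n) (simp_all add: mat3_defs T45_def distrib_left comm_left)

lemma word_at_replicate: "word_at x y (replicate n X0) = x ^ n"
  by (induction n) auto

lemma E_word_Nil: "E_word [] = 1"
  by (simp add: E_word_def mat3_defs)

lemma E_word_snoc: "E_word (w @ [X0]) = E_word w * a0"
  by (simp add: E_word_def mat3_defs T45_def)

text \<open>
  The middle entry is multiplicative over blocks \<open>X0^n X1\<close>, because the third column of \<open>T34\<close> vanishes
  and words in \<open>T45\<close>, \<open>T34\<close> have no entry in the first row outside the diagonal.
\<close>

lemma E_word_block: "E_word (X0pow_X1 n @ w) = G n * E_word w"
proof -
  let ?A = "T45 ^ n * T34"
  have "m23 ?A = 0" "m22 ?A = G n"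
    by (simp_all add: times_mat3_def T34_def T45_power G_def mult.assoc)
  then have "m22 (?A * word_at T45 T34 w) = G n * m22 (word_at T45 T34 w)"
    by (simp only: times_mat3_def [of ?A "word_at T45 T34 w"] mat3.sel word_45_34) simp
  then show ?thesis
    by (simp add: E_word_def X0pow_X1_def word_at_replicate mult.assoc)
qed

text \<open>
  After conjugation by \<open>b\<close> the factor of a block is \<open>- \<Delta>\<^sub>*(Y\<^bsub>n+1\<^esub>)\<close>, written in the letters \<open>X\<close>. The mixed
  terms come out right by telescoping.
\<close>

lemma G_times_b: "G n * b = b * (a0 ^ n * a1 + t ^ n * b - cross n * a1 * b)"
proof -
  have "cross n * p = t ^ n - a0 ^ n - cross n * a1"
    by (simp add: p_def cross_telescope [symmetric] algebra_simps)
  then have "G n * b = (a0 ^ n * s + b * (t ^ n - a0 ^ n - cross n * a1)) * b"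
    by (simp only: G_def mult.assoc)
  also have "\<dots> = b * (a0 ^ n * a1 + t ^ n * b - cross n * a1 * b)"
    by (simp add: s_def algebra_simps comm) (simp add: mult.assoc [symmetric] powers_commute comm, simp add: mult.assoc powers_commute)
  finally show ?thesis .
qed

subsection \<open>The scalar identity\<close>

definition E_series :: "'r xseries \<Rightarrow> 'a fps" where
  "E_series \<phi> = Abs_fps (\<lambda>n. \<Sum>w | length w = n. j (coeff \<phi> w) * E_word w)"

definition F_series :: "'r xseries \<Rightarrow> 'a fps" where
  "F_series \<phi> = Abs_fps (\<lambda>n. \<Sum>w | length w = n. j (coeff \<phi> w) * F_word w)"

lemma at_pair_trim:
  "at_pair j a1 b (trim \<phi>) $ n = (\<Sum>w | length w = n. j (coeff \<phi> w) * B_word w)"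
  unfolding gev_nth
proof (rule sum.cong)
  fix w :: "letter list"
  show "j (coeff (trim \<phi>) w) * word_at a1 b w = j (coeff \<phi> w) * B_word w"
  proof (cases w rule: rev_cases)
    case (snoc u l)
    then show ?thesis by (cases l) (simp_all add: B_word_simps)
  qed (simp add: B_word_simps)
qed simp

text \<open>
  The pentagon in the middle entry. The factor \<open>\<phi>(T23, T34)\<close> acts on the middle row by the scalar
  \<open>\<phi>(a0, a1 + b) = \<phi>(a0, a1)\<close>, the factor \<open>\<phi>(T12, T23)\<close> fixes the middle column, and the off-diagonal
  contributions to the left-hand side vanish.
\<close>

theorem entry_identity:
  assumes "pentagon \<phi>" "commutator_like \<phi>"
  shows "at_pair j a1 b (trim \<phi>) * E_series \<phi> = at_pair j a0 a1 \<phi> * F_series \<phi>"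
proof (rule fps_ext)
  fix n
  let ?P = "at_pair J T12 T15 \<phi>" and ?Q = "at_pair J T45 T34 \<phi>"
  let ?R = "at_pair J T23 T34 \<phi>" and ?S = "at_pair J T45 T15 \<phi>" and ?U = "at_pair J T12 T23 \<phi>"
  have P: "m22 (?P $ i) = at_pair j a1 b (trim \<phi>) $ i" "m23 (?P $ i) = 0" for i
    by (simp_all add: gev_entry at_pair_trim B_word_def word_12_15)
  have Q: "m22 (?Q $ i) = E_series \<phi> $ i" "m12 (?Q $ i) = 0" for i
    by (simp_all add: gev_entry E_series_def E_word_def word_45_34)
  \<comment> \<open>On the middle row \<open>T34\<close> is \<open>a1 + b\<close>, and \<open>b\<close> commutes with \<open>a0\<close> and \<open>a1\<close>.\<close>
  have "at_pair j (a0 + 0) (a1 + b) \<phi> = at_pair j a0 a1 \<phi>"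
    by (rule at_pair_shift [OF assms(2)]) (simp_all add: comm)
  then have R: "m22 (?R $ i) = at_pair j a0 a1 \<phi> $ i" "m21 (?R $ i) = 0" "m23 (?R $ i) = 0" for i
    by (simp_all add: gev_entry word_23_34 gev_nth [symmetric] s_def)
  have S: "m22 (?S $ i) = F_series \<phi> $ i" for i
    by (simp add: gev_entry F_series_def F_word_def)
  have U: "m12 (?U $ i) = 0" "m32 (?U $ i) = 0" "m22 (?U $ i) = (1 :: 'a fps) $ i" for i
    by (simp_all add: gev_entry word_12_23 gev_nth [symmetric] at_pair_single [OF assms(2)] del: fps_one_nth)
  have SU: "m22 ((?S * ?U) $ i) = F_series \<phi> $ i" for i
  proof -
    have "m22 ((?S * ?U) $ i) = (\<Sum>k=0..i. F_series \<phi> $ k * (1 :: 'a fps) $ (i - k))"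
      by (simp add: fps_mult_nth mat3_sum_entry times_mat3_def S U del: fps_one_nth)
    also have "\<dots> = (F_series \<phi> * 1) $ i" by (simp only: fps_mult_nth)
    finally show ?thesis by simp
  qed
  have "(at_pair j a1 b (trim \<phi>) * E_series \<phi>) $ n = m22 ((?P * ?Q) $ n)"
    by (simp add: fps_mult_nth mat3_sum_entry times_mat3_def P Q)
  also have "\<dots> = m22 ((?R * (?S * ?U)) $ n)"
    by (simp only: pentagon_matrices [OF assms] mult.assoc)
  also have "\<dots> = (at_pair j a0 a1 \<phi> * F_series \<phi>) $ n"
    by (simp only: fps_mult_nth [of ?R] fps_mult_nth [of "at_pair j a0 a1 \<phi>"] mat3_sum_entry)
      (simp add: times_mat3_def [of "?R $ _"] R SU)
  finally show "(at_pair j a1 b (trim \<phi>) * E_series \<phi>) $ n = (at_pair j a0 a1 \<phi> * F_series \<phi>) $ n" .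
qed

end

section \<open>The cocycle equation\<close>

lemma word_blocks_cases:
  obtains n where "w = replicate n X0" | n v where "w = X0pow_X1 n @ v"
proof (induction w arbitrary: thesis)
  case Nil
  from Nil(1) [of 0] show ?case by simp
next
  case (Cons l w)
  show ?case
  proof (cases l)
    case X0
    show ?thesis
    proof (rule Cons.IH)
      show "w = replicate n X0 \<Longrightarrow> thesis" for n
        using Cons.prems(1) [of "Suc n"] X0 by simp
      show "w = X0pow_X1 n @ v \<Longrightarrow> thesis" for n v
        using Cons.prems(2) [of "Suc n" v] X0 by (simp add: X0pow_X1_def)
    qed
  next
    case X1
    then show ?thesis using Cons.prems(2) [of 0 w] by (simp add: X0pow_X1_def)
  qed
qed

text \<open>
  Splitting off blocks one by one leads to a power of \<open>X0\<close>, on which both functions agree.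
\<close>

lemma block_multiplicative_eq:
  fixes e e' :: "letter list \<Rightarrow> 'a::ring_1"
  assumes "e [] = e' []" "\<And>w. e (w @ [X0]) = 0" "\<And>w. e' (w @ [X0]) = 0"
    and "\<And>n w. e (X0pow_X1 n @ w) = g n * e w" "\<And>n w. e' (X0pow_X1 n @ w) = g n * e' w"
  shows "e w = e' w"
proof (induction w rule: length_induct)
  case (1 w)
  show ?case
  proof (cases w rule: word_blocks_cases)
    case (1 n)
    then show ?thesis
      using assms(1-3) by (cases n) (simp_all add: replicate_append_same [symmetric])
  next
    case (2 n v)
    with 1 have "e v = e' v" by (simp add: X0pow_X1_def)
    with 2 show ?thesis by (simp add: assms)
  qed
qed

context
  fixes j :: "'r::comm_ring_1 \<Rightarrow> 'a::comm_ring_1" and \<phi> :: "'r xseries"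
  assumes j: "scalars j" and pent: "pentagon \<phi>" and cl: "commutator_like \<phi>"
begin

interpretation scalars j by (rule j)

abbreviation B :: "'a \<Rightarrow> 'a \<Rightarrow> 'a fps" where
  "B x y \<equiv> at_pair j x y (trim \<phi>)"

text \<open>
  For commuting variables and \<open>a0 = 0\<close> the middle entry identity is \<open>B(a1, b) E = B(t, b)\<close>, and \<open>E\<close> depends
  only on the block factors \<open>a1 + b\<close> and \<open>b t^n (t - a1)\<close>. These are unchanged when \<open>(a1, b, t)\<close> is replaced
  by \<open>(t + b, a1 - t, t)\<close>. Comparing both identities and putting \<open>x = t\<close>, \<open>y = b\<close>, \<open>z = a1 - t\<close> gives the
  equation.
\<close>

lemma B_cocycle: "B x y * B (x + y) z = B x z * B (x + z) y"
proof -
  \<comment> \<open>The two systems of parameters with the same block factors.\<close>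
  interpret P: two_commuting_pairs j 0 "x + z" x y
    by standard (simp_all add: mult.commute)
  interpret Q: two_commuting_pairs j 0 "x + y" x z
    by standard (simp_all add: mult.commute)
  have cross0: "P.cross (Suc n) = x ^ n" "Q.cross (Suc n) = x ^ n" for n
    by simp_all
  have G: "P.G n = Q.G n" for n
    by (cases n) (simp_all add: P.G_def Q.G_def P.s_def Q.s_def P.p_def Q.p_def cross0 algebra_simps)
  have "P.E_word w = Q.E_word w" for w
    by (rule block_multiplicative_eq [where g = P.G])
      (simp_all add: P.E_word_Nil Q.E_word_Nil P.E_word_snoc Q.E_word_snoc P.E_word_block Q.E_word_block G)
  then have E: "P.E_series \<phi> = Q.E_series \<phi>"
    by (simp add: P.E_series_def Q.E_series_def)
  have F: "(\<Sum>w | length w = n. j (coeff \<phi> w) * f w) = at_pair j x' y' (trim \<phi>) $ n"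
    if "f [] = 1" "\<And>w. f (w @ [X0]) = 0" "\<And>w. f (w @ [X1]) = y' * word_at x' y' w" for f x' y' n
    unfolding gev_nth
  proof (rule sum.cong)
    fix w :: "letter list"
    show "j (coeff \<phi> w) * f w = j (coeff (trim \<phi>) w) * word_at x' y' w"
    proof (cases w rule: rev_cases)
      case (snoc u l)
      then show ?thesis by (cases l) (simp_all add: that mult.commute)
    qed (simp add: that)
  qed simp
  have "P.F_series \<phi> = B x y"
    by (rule fps_ext) (simp add: P.F_series_def F P.F_word_simps)
  then have P: "B (x + z) y * P.E_series \<phi> = B x y"
    using P.entry_identity [OF pent cl] at_pair_single [OF cl] by simp
  have "Q.F_series \<phi> = B x z"
    by (rule fps_ext) (simp add: Q.F_series_def F Q.F_word_simps)
  then have Q: "B (x + y) z * Q.E_series \<phi> = B x z"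
    using Q.entry_identity [OF pent cl] at_pair_single [OF cl] by simp
  show ?thesis unfolding P [symmetric] Q [symmetric] E by (simp only: mult_ac)
qed

lemma trim_single:
  "at_pair j x 0 (trim \<phi>) = 1" "at_pair j 0 y (trim \<phi>) = 1"
proof -
  have "coeff (trim \<phi>) (replicate n X0) = (if n = 0 then 1 else 0)" for n
    using cl by (auto simp: commutator_like_def group_like_def)
  moreover have "coeff (trim \<phi>) (replicate n X1) = (if n = 0 then 1 else 0)" for n
    using cl by (auto simp: commutator_like_def group_like_def)
  ultimately show "at_pair j x 0 (trim \<phi>) = 1" "at_pair j 0 y (trim \<phi>) = 1"
    by (simp_all add: fps_eq_iff at_pair_single_X0 at_pair_single_X1)
qed

lemma B_symmetric: "B x y = B y x"
  using B_cocycle [of 0 x y] by (simp add: trim_single)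

end

section \<open>Solving the cocycle equation\<close>

text \<open>
  The cocycle equation is differentiated by evaluating it at series in a further variable, of which
  only the coefficients of degree \<open>0\<close> and \<open>1\<close> are kept.
\<close>

definition eps0 :: "'a::comm_ring_1 fps fps \<Rightarrow> 'a fps" where
  "eps0 F = Abs_fps (\<lambda>n. F $ n $ 0)"

definition eps1 :: "'a::comm_ring_1 fps fps \<Rightarrow> 'a fps" where
  "eps1 F = Abs_fps (\<lambda>n. F $ n $ 1)"

lemma eps_mult:
  "eps0 (F * G) = eps0 F * eps0 G"
  "eps1 (F * G) = eps0 F * eps1 G + eps1 F * eps0 G"
  by (simp_all add: fps_eq_iff eps0_def eps1_def fps_mult_nth fps_sum_nth sum.distrib)

definition euler :: "'a::comm_ring_1 fps \<Rightarrow> 'a fps" where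
  "euler F = fps_X * fps_deriv F"

lemma euler_nth: "euler F $ n = of_nat n * F $ n"
  by (cases n) (simp_all add: euler_def)

lemma euler_mult: "euler (F * G) = euler F * G + F * euler G"
  by (simp add: euler_def algebra_simps)

lemma euler_unique:
  fixes F G K :: "'a::comm_ring_1 fps"
  assumes tf: "torsion_free TYPE('a)" and "K $ 0 = 0" "F $ 0 = G $ 0"
    and "euler F = K * F" "euler G = K * G"
  shows "F = G"
proof (rule fps_ext)
  fix n
  show "F $ n = G $ n"
  proof (induction n rule: less_induct)
    case (less n)
    show ?case
    proof (cases "n = 0")
      case False
      have "of_nat n * F $ n = (\<Sum>i=0..n. K $ i * F $ (n - i))"
        using assms(4) by (simp add: euler_nth [symmetric] fps_mult_nth)
      also have "\<dots> = (\<Sum>i=0..n. K $ i * G $ (n - i))"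
      proof (rule sum.cong)
        fix i assume "i \<in> {0..n}"
        show "K $ i * F $ (n - i) = K $ i * G $ (n - i)"
          using less [of "n - i"] False assms(2) by (cases "i = 0") simp_all
      qed simp
      also have "\<dots> = of_nat n * G $ n"
        using assms(5) by (simp add: euler_nth [symmetric] fps_mult_nth)
      finally have "of_nat n * (F $ n - G $ n) = 0" by (simp add: algebra_simps)
      then have "F $ n - G $ n = 0"
        by (rule torsion_freeD [OF tf, rotated]) (use False in simp)
      then show ?thesis by simp
    qed (use assms(3) in simp)
  qed
qed

context
  fixes j :: "'r::comm_ring_1 \<Rightarrow> 'a::comm_ring_1" and \<phi> :: "'r xseries"
  assumes j: "scalars j" and pent: "pentagon \<phi>" and cl: "commutator_like \<phi>"
begin

interpretation scalars j by (rule j)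

abbreviation J :: "'r \<Rightarrow> 'a fps" where "J r \<equiv> fps_const (j r)"

interpretation J: scalars J
  by standard (simp_all add: j_add j_mult mult.commute)

lemma word_at_nth_0: "word_at X Y w $ 0 = word_at (X $ 0) (Y $ 0) w"
  for X Y :: "'a fps"
  by (induction w) (auto split: letter.split)

lemma word_at_const: "word_at (fps_const x) (fps_const y) w = fps_const (word_at x y w)"
  for x y :: 'a
  by (induction w) (auto split: letter.split)

lemma word_at_scale: "word_at (e * x) (e * y) w = e ^ length w * word_at x y w"
  for e x y :: "'b::comm_ring_1"
  by (induction w) (auto split: letter.split simp: mult_ac)

lemma eps0_B: "eps0 (B J \<phi> X Y) = B j \<phi> (X $ 0) (Y $ 0)"
  by (rule fps_ext) (simp add: eps0_def gev_nth fps_sum_nth word_at_nth_0)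

lemma eps1_B_const: "eps1 (B J \<phi> (fps_const x) (fps_const y)) = 0"
  by (rule fps_ext) (simp add: eps1_def gev_nth fps_sum_nth word_at_const)

text \<open>
  Up to the factor \<open>s\<close>, the series \<open>K s\<close> is the derivative of \<open>B(s, y)\<close> at \<open>y = 0\<close>: a word that is linear in
  \<open>X1\<close> and ends in \<open>X1\<close> is of the form \<open>X0^(n-1) X1\<close>.
\<close>

definition K :: "'a \<Rightarrow> 'a fps" where
  "K s = Abs_fps (\<lambda>n. if n = 0 then 0 else j (coeff \<phi> (X0pow_X1 (n - 1))) * s ^ n)"

definition H :: "'a \<Rightarrow> 'a fps" where
  "H s = Abs_fps (\<lambda>n. if n = 0 then 0 else j (coeff \<phi> (X0pow_X1 (n - 1))) * s ^ (n - 1))"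

lemma K_eq: "K s = fps_const s * H s"
  unfolding fps_eq_iff by (auto simp: K_def H_def power_eq_if)

lemma eps1_B_linear: "eps1 (B J \<phi> X (fps_X * fps_const u)) = fps_const u * H (X $ 0)"
proof (rule fps_ext)
  fix n
  show "eps1 (B J \<phi> X (fps_X * fps_const u)) $ n = (fps_const u * H (X $ 0)) $ n"
  proof (cases n)
    case 0
    then show ?thesis by (simp add: eps1_def H_def gev_nth)
  next
    case (Suc m)
    have z: "word_at x 0 w = (if w = replicate (length w) X0 then x ^ length w else 0)" for x :: 'a and w
      by (induction w) (auto split: letter.split)
    have "B J \<phi> X (fps_X * fps_const u) $ Suc m
      = (\<Sum>w | length w = m. J (coeff \<phi> (w @ [X1])) * (word_at X (fps_X * fps_const u) w * (fps_X * fps_const u)))"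
      unfolding gev_nth sum_words_Suc_snoc UNIV_letter by simp
    also have "\<dots> $ 1 = (\<Sum>w | length w = m. j (coeff \<phi> (w @ [X1])) * (word_at (X $ 0) 0 w * u))"
      by (simp add: fps_sum_nth fps_mult_nth_1 word_at_nth_0)
    also have "\<dots> = (\<Sum>w | length w = m. if w = replicate m X0 then j (coeff \<phi> (w @ [X1])) * ((X $ 0) ^ m * u) else 0)"
      by (rule sum.cong) (auto simp: z)
    also have "\<dots> = j (coeff \<phi> (X0pow_X1 m)) * ((X $ 0) ^ m * u)"
      by (simp add: X0pow_X1_def)
    finally show ?thesis by (simp add: eps1_def Suc H_def mult_ac)
  qed
qed

lemma eps1_B_scaled:
  "eps1 (B J \<phi> ((1 + fps_X) * fps_const x) ((1 + fps_X) * fps_const y)) = euler (B j \<phi> x y)"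
proof (rule fps_ext)
  fix n
  have e: "((1 + fps_X) ^ n :: 'a fps) $ 0 = 1 \<and> ((1 + fps_X) ^ n :: 'a fps) $ 1 = of_nat n" for n
    by (induction n) (simp_all add: distrib_right)
  have "B J \<phi> ((1 + fps_X) * fps_const x) ((1 + fps_X) * fps_const y) $ n
    = (\<Sum>w | length w = n. J (coeff (trim \<phi>) w) * ((1 + fps_X) ^ n * fps_const (word_at x y w)))"
    unfolding gev_nth by (rule sum.cong) (auto simp: word_at_scale word_at_const)
  also have "\<dots> $ 1 = (\<Sum>w | length w = n. j (coeff (trim \<phi>) w) * (of_nat n * word_at x y w))"
    using e [of n] by (simp add: fps_sum_nth)
  also have "\<dots> = of_nat n * B j \<phi> x y $ n"
    by (simp add: gev_nth sum_distrib_left mult_ac)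
  finally show "eps1 (B J \<phi> ((1 + fps_X) * fps_const x) ((1 + fps_X) * fps_const y)) $ n = euler (B j \<phi> x y) $ n"
    by (simp add: eps1_def euler_nth)
qed

text \<open>
  The Euler derivative is the sum of two partial derivatives, and each of these is determined by the
  linear term of the cocycle equation at an infinitesimal multiple of a variable: first at
  \<open>(x, y, \<epsilon>x)\<close>, then at \<open>(y, x + \<epsilon>x, \<epsilon>y)\<close>, where symmetry is used to match the terms.
\<close>

lemma B_euler: "euler (B j \<phi> x y) = B j \<phi> x y * (K (x + y) - K x - K y)"
proof -
  note cocycle = B_cocycle [OF J.scalars_axioms pent cl]
    and sym = B_symmetric [OF J.scalars_axioms pent cl]
    and trivial = trim_single [OF j pent cl]
  let ?x = "fps_const x" and ?y = "fps_const y" and ?e = "1 + fps_X :: 'a fps"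
  have e: "?e * ?x = ?x + fps_X * ?x" "?e * ?y = ?y + fps_X * ?y" by (simp_all add: algebra_simps)
  \<comment> \<open>The partial Euler derivative in the first variable; it is eliminated between the two equations.\<close>
  let ?D = "eps1 (B J \<phi> (?e * ?x) ?y)"
  have "eps1 (B J \<phi> ?x ?y * B J \<phi> (?x + ?y) (fps_X * ?x)) = eps1 (B J \<phi> ?x (fps_X * ?x) * B J \<phi> (?e * ?x) ?y)"
    unfolding e by (simp only: cocycle)
  then have 1: "B j \<phi> x y * (?x * H (x + y)) = ?D + ?x * H x * B j \<phi> x y"
    by (simp add: eps_mult eps0_B eps1_B_linear eps1_B_const trivial)
  have "eps1 (B J \<phi> ?y (?e * ?x) * B J \<phi> (?y + ?e * ?x) (fps_X * ?y))
      = eps1 (B J \<phi> ?y (fps_X * ?y) * B J \<phi> (?e * ?y) (?e * ?x))"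
    unfolding e(2) by (simp only: cocycle)
  also have "B J \<phi> ?y (?e * ?x) = B J \<phi> (?e * ?x) ?y" by (rule sym)
  also have "B J \<phi> (?e * ?y) (?e * ?x) = B J \<phi> (?e * ?x) (?e * ?y)" by (rule sym)
  finally have 2: "B j \<phi> x y * (?y * H (y + x)) + ?D = euler (B j \<phi> x y) + ?y * H y * B j \<phi> x y"
    by (simp add: eps_mult eps0_B eps1_B_linear eps1_B_scaled trivial)
  have "euler (B j \<phi> x y) = B j \<phi> x y * (?x * H (x + y)) + B j \<phi> x y * (?y * H (x + y))
      - ?x * H x * B j \<phi> x y - ?y * H y * B j \<phi> x y"
    using 1 2 by (simp add: add.commute [of y x] algebra_simps)
  then show ?thesis by (simp add: K_eq algebra_simps fps_const_add [symmetric] del: fps_const_add)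
qed

text \<open>
  The hypotheses on \<open>c\<close> say that \<open>C\<close> solves \<open>euler C = K C\<close>, so that both sides solve
  \<open>euler F = K (x + y) F\<close> with constant term \<open>1\<close>, and such a solution is unique.
\<close>

theorem B_coboundary:
  assumes tf: "torsion_free TYPE('a)" and c0: "c 0 = 1"
    and rec: "\<And>n. of_nat n * c n = (\<Sum>i=1..n. coeff \<phi> (X0pow_X1 (i - 1)) * c (n - i))"
  defines "C \<equiv> \<lambda>s. Abs_fps (\<lambda>n. j (c n) * s ^ n)"
  shows "C (x + y) = C x * C y * B j \<phi> x y"
proof (rule euler_unique [OF tf])
  have j_of_nat: "j (of_nat n) = of_nat n" for n
    by (induction n) (simp_all add: j_add)
  have C: "euler (C s) = K s * C s" for s
  proof (rule fps_ext)
    fix n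
    have "euler (C s) $ n = j (of_nat n * c n) * s ^ n"
      by (simp add: euler_nth C_def j_mult j_of_nat mult_ac)
    also have "\<dots> = (\<Sum>i=1..n. j (coeff \<phi> (X0pow_X1 (i - 1))) * s ^ i * (j (c (n - i)) * s ^ (n - i)))"
      unfolding rec j_sum sum_distrib_right
    proof (rule sum.cong)
      fix i assume "i \<in> {1..n}"
      then have "s ^ n = s ^ i * s ^ (n - i)" by (simp add: power_add [symmetric])
      then show "j (coeff \<phi> (X0pow_X1 (i - 1)) * c (n - i)) * s ^ n
          = j (coeff \<phi> (X0pow_X1 (i - 1))) * s ^ i * (j (c (n - i)) * s ^ (n - i))"
        by (simp add: j_mult mult_ac)
    qed simp
    also have "\<dots> = (\<Sum>i=0..n. K s $ i * C s $ (n - i))"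
      by (subst sum.atLeast_Suc_atMost) (auto simp: K_def C_def intro!: sum.cong)
    finally show "euler (C s) $ n = (K s * C s) $ n" by (simp add: fps_mult_nth)
  qed
  show "K (x + y) $ 0 = 0" by (simp add: K_def)
  show "C (x + y) $ 0 = (C x * C y * B j \<phi> x y) $ 0"
    using cl by (simp add: C_def c0 gev_nth_0 commutator_like_def group_like_def)
  show "euler (C (x + y)) = K (x + y) * C (x + y)" by (rule C)
  show "euler (C x * C y * B j \<phi> x y) = K (x + y) * (C x * C y * B j \<phi> x y)"
    by (simp add: euler_mult C B_euler algebra_simps)
qed

end

section \<open>Words in the letters Y\<close>

abbreviation x_word :: "yletter list \<Rightarrow> letter list" where
  "x_word P \<equiv> concat (map x_block P)"

lemma X0pow_X1_append_eq_iff: "X0pow_X1 n @ v = X0pow_X1 m @ w \<longleftrightarrow> n = m \<and> v = w"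
proof (induction n arbitrary: m)
  case 0
  show ?case by (cases m) (auto simp: X0pow_X1_def)
next
  case (Suc n)
  then show ?case by (cases m) (auto simp: X0pow_X1_def)
qed

lemma x_word_inj: "x_word P = x_word Q \<longleftrightarrow> P = Q"
proof (induction P arbitrary: Q)
  case Nil
  show ?case
  proof (cases Q)
    case (Cons y Q')
    then show ?thesis by (cases y) (simp add: X0pow_X1_def)
  qed simp
next
  case (Cons y P)
  show ?case
  proof (cases Q)
    case Nil
    then show ?thesis by (cases y) (simp add: X0pow_X1_def)
  next
    case (Cons z Q')
    then show ?thesis
      by (cases y; cases z) (simp add: X0pow_X1_append_eq_iff Cons.IH)
  qed
qed

text \<open>
  These are the words read off by \<open>\<pi>\<^sub>Y\<close>.
\<close>

definition admissible :: "letter list \<Rightarrow> bool" where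
  "admissible w \<longleftrightarrow> w = [] \<or> last w = X1"

lemma admissible_x_word: "admissible (x_word P)"
proof (cases P rule: rev_cases)
  case (snoc Q y)
  then show ?thesis by (cases y) (simp add: admissible_def X0pow_X1_def)
qed (simp add: admissible_def)

lemma admissible_suffix: "admissible (u @ v) \<Longrightarrow> admissible v"
  by (cases "v = []") (auto simp: admissible_def)

lemma admissible_iff: "admissible w \<longleftrightarrow> w \<in> range x_word"
proof
  show "admissible w \<Longrightarrow> w \<in> range x_word"
  proof (induction "length w" arbitrary: w rule: less_induct)
    case less
    show ?case
    proof (cases w rule: word_blocks_cases)
      case (1 n)
      with \<open>admissible w\<close> have "w = x_word []" by (cases "n = 0") (auto simp: admissible_def)
      then show ?thesis by blast
    next
      case (2 n v)
      with \<open>admissible w\<close> have "admissible v" by (auto intro: admissible_suffix)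
      moreover have "length v < length w" using 2 by (simp add: X0pow_X1_def)
      ultimately obtain P where "v = x_word P" using less.hyps by blast
      with 2 have "w = x_word (YSuc n # P)" by simp
      then show ?thesis by blast
    qed
  qed
qed (auto simp: admissible_x_word)

lemma coeff_trim_admissible: "coeff (trim f) w = (if admissible w then coeff f w else 0)"
proof -
  have "last w = X0 \<longleftrightarrow> last w \<noteq> X1" by (metis letter.distinct(1) letter.exhaust)
  then show ?thesis by (auto simp: admissible_def)
qed

lemma length_x_word: "length (x_word P) = sum_list (map y_weight P)"
proof (induction P)
  case (Cons y P)
  then show ?case by (cases y) (simp add: X0pow_X1_def)
qed simp

lemma sum_admissible:
  fixes F :: "letter list \<Rightarrow> 'b::comm_monoid_add"
  assumes "\<And>w. length w = n \<Longrightarrow> \<not> admissible w \<Longrightarrow> F w = 0"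
  shows "(\<Sum>w | length w = n. F w) = (\<Sum>P | length (x_word P) = n. F (x_word P))"
proof -
  have "(\<Sum>w | length w = n. F w) = (\<Sum>w\<in>x_word ` {P. length (x_word P) = n}. F w)"
    by (rule sum.mono_neutral_right) (use assms in \<open>auto simp: admissible_iff\<close>)
  also have "\<dots> = (\<Sum>P | length (x_word P) = n. F (x_word P))"
    by (subst sum.reindex) (auto simp: inj_on_def x_word_inj)
  finally show ?thesis .
qed

lemma finite_x_word: "finite {P. length (x_word P) = n}"
proof (rule finite_imageD)
  show "finite (x_word ` {P. length (x_word P) = n})"
    by (rule finite_subset [of _ "{w. length w = n}"]) auto
qed (auto simp: inj_on_def x_word_inj)

section \<open>The pentagon in the tensor square\<close>

abbreviation jT :: "'r::comm_ring_1 \<Rightarrow> ('x, 'r) ncps2" where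
  "jT r \<equiv> nc_const (nc_const r)"

lemma coeff_mult_const: "coeff (f * nc_const c) w = coeff f w * c"
proof -
  have "coeff (f * nc_const c) w = (\<Sum>p\<in>splits w. if p = (w, []) then coeff f w * c else 0)"
    unfolding coeff_mult nc_const_def coeff_Abs_ncps case_prod_unfold
    by (rule sum.cong) (auto simp: splits_def)
  then show ?thesis by (simp add: split_Nil)
qed

lemma scalars_jT: "scalars (jT :: 'r::comm_ring_1 \<Rightarrow> ('x, 'r) ncps2)"
proof
  show "jT 1 = (1 :: ('x, 'r) ncps2)"
    by (intro ncps_eqI) (simp add: nc_const_def)
  fix r s :: 'r and F :: "('x, 'r) ncps2"
  show "jT (r + s) = (jT r + jT s :: ('x, 'r) ncps2)"
    by (intro ncps_eqI) (simp add: nc_const_def)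
  show "jT (r * s) = (jT r * jT s :: ('x, 'r) ncps2)"
    by (intro ncps_eqI, simp only: coeff_const_mult) (simp add: nc_const_def)
  show "jT r * F = F * jT r"
    by (intro ncps_eqI, simp only: coeff_const_mult coeff_mult_const mult.commute)
qed

lemma coeff_jT_mult: "coeff (coeff (jT r * F) u) v = r * coeff (coeff F u) v"
  by simp

lemma coeff2_mult:
  "coeff (coeff (F * G) u) v = (\<Sum>p\<in>splits u. \<Sum>q\<in>splits v.
     coeff (coeff F (fst p)) (fst q) * coeff (coeff G (snd p)) (snd q))"
  by (simp add: coeff_mult case_prod_unfold)

abbreviation a0 :: "(letter, 'r::comm_ring_1) ncps2" where "a0 \<equiv> tens (nc_var X0) 1"
abbreviation a1 :: "(letter, 'r::comm_ring_1) ncps2" where "a1 \<equiv> tens (nc_var X1) 1"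
abbreviation b0 :: "(letter, 'r::comm_ring_1) ncps2" where "b0 \<equiv> tens 1 (nc_var X0)"
abbreviation b1 :: "(letter, 'r::comm_ring_1) ncps2" where "b1 \<equiv> tens 1 (nc_var X1)"

interpretation S: two_commuting_pairs "jT :: 'r::comm_ring_1 \<Rightarrow> (letter, 'r) ncps2" a0 a1 b0 b1
  by (intro two_commuting_pairs.intro scalars_jT two_commuting_pairs_axioms.intro) (simp_all add: tens_mult)

text \<open>
  Equality after \<open>\<pi>\<^sub>Y\<close> in both factors is congruence modulo the negligible elements, which form a left
  ideal containing \<open>a0\<close>.
\<close>

definition negligible :: "(letter, 'r::comm_ring_1) ncps2 \<Rightarrow> bool" where
  "negligible F \<longleftrightarrow> (\<forall>u v. admissible u \<and> admissible v \<longrightarrow> coeff (coeff F u) v = 0)"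

lemma negligible_zero: "negligible 0"
  by (simp add: negligible_def)

lemma negligible_add: "negligible F \<Longrightarrow> negligible G \<Longrightarrow> negligible (F + G)"
  by (simp add: negligible_def)

lemma negligible_sum: "(\<And>i. i \<in> A \<Longrightarrow> negligible (F i)) \<Longrightarrow> negligible (sum F A)"
  by (induction A rule: infinite_finite_induct) (auto simp: negligible_zero negligible_add)

lemma negligible_mult: "negligible G \<Longrightarrow> negligible (F * G)"
  unfolding negligible_def coeff2_mult
  by (auto intro!: sum.neutral simp: splits_def dest!: admissible_suffix)

lemma coeff_mult_var: "coeff (f * nc_var x) w = (if w \<noteq> [] \<and> last w = x then coeff f (butlast w) else 0)"
proof (cases w rule: rev_cases)
  case (snoc v y)
  have "coeff (f * nc_var x) w = (\<Sum>p\<in>splits w. if p = (v, [y]) then (if y = x then coeff f v else 0) else 0)"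
    unfolding coeff_mult nc_var_def coeff_Abs_ncps case_prod_unfold
    by (rule sum.cong) (auto simp: splits_def snoc)
  also have "\<dots> = (if y = x then coeff f v else 0)"
  proof -
    have "(v, [y]) \<in> splits w" by (simp add: splits_def snoc)
    then show ?thesis by simp
  qed
  finally show ?thesis by (simp add: snoc)
qed (simp add: coeff_mult nc_var_def)

lemma negligible_a0: "negligible (F * a0)"
  unfolding negligible_def tens_var_one coeff_mult_var by (auto simp: admissible_def)

text \<open>
  Prefixing \<open>X1\<close> to an admissible word keeps it admissible, so the conjugating factor \<open>b1\<close> can be removed.
\<close>

lemma negligible_b1_cancel:
  assumes "negligible (b1 * F)"
  shows "negligible F"
  unfolding negligible_def
proof (intro allI impI)
  fix u v assume "admissible u \<and> admissible v"
  then have "admissible u \<and> admissible (X1 # v)" by (auto simp: admissible_def)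
  then have "coeff (coeff (b1 * F) u) (X1 # v) = 0"
    using assms unfolding negligible_def by blast
  then show "coeff (coeff F u) v = 0"
    by (simp add: tens_one_left coeff_var_mult)
qed

text \<open>
  This is \<open>- \<Delta>\<^sub>*(Y\<^bsub>n+1\<^esub>)\<close> written in the letters \<open>X\<close>; the sign is the one in \<open>\<pi>\<^sub>Y\<close>.
\<close>

definition harmonic_block :: "yletter \<Rightarrow> (letter, 'r::comm_ring_1) ncps2" where
  "harmonic_block y = (case y of YSuc n \<Rightarrow> a0 ^ n * a1 + b0 ^ n * b1 - S.cross n * a1 * b1)"

definition harmonic_series :: "'r::comm_ring_1 xseries \<Rightarrow> (letter, 'r) ncps2 fps" where
  "harmonic_series \<phi> = Abs_fps (\<lambda>n. \<Sum>P | length (x_word P) = n.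
     jT (coeff \<phi> (x_word P)) * prod_list (map harmonic_block P))"

lemma E_word_x_word:
  fixes P :: "yletter list"
  shows "S.E_word (x_word P) * b1 = (b1 * prod_list (map harmonic_block P) :: (letter, 'r::comm_ring_1) ncps2)"
proof (induction P)
  case Nil
  show ?case by (simp add: S.E_word_Nil)
next
  case (Cons y P)
  obtain n where y: "y = YSuc n" by (cases y)
  have "S.E_word (x_word (y # P)) * b1 = S.G n * (S.E_word (x_word P) * b1 :: (letter, 'r) ncps2)"
    by (simp add: y S.E_word_block mult.assoc)
  also have "\<dots> = (S.G n * b1) * prod_list (map harmonic_block P)"
    unfolding Cons.IH by (simp only: mult.assoc)
  also have "\<dots> = b1 * (harmonic_block y * prod_list (map harmonic_block P))"
    by (simp only: S.G_times_b y harmonic_block_def yletter.case mult.assoc)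
  finally show ?case by simp
qed

lemma E_series_congruence:
  fixes \<phi> :: "'r::comm_ring_1 xseries"
  shows "negligible (S.E_series \<phi> $ n * b1 - b1 * harmonic_series \<phi> $ n)"
proof -
  have "S.E_series \<phi> $ n * b1 = (\<Sum>w | length w = n. jT (coeff \<phi> w) * (S.E_word w * b1))"
    by (simp add: S.E_series_def sum_distrib_right mult.assoc)
  also have "\<dots> = (\<Sum>w | length w = n. if admissible w then jT (coeff \<phi> w) * (S.E_word w * b1) else 0)
     + (\<Sum>w | length w = n. if admissible w then 0 else jT (coeff \<phi> w) * (S.E_word w * b1))"
    unfolding sum.distrib [symmetric] by (rule sum.cong) auto
  also have "(\<Sum>w | length w = n. if admissible w then jT (coeff \<phi> w) * (S.E_word w * b1) else 0)
      = (\<Sum>P | length (x_word P) = n. jT (coeff \<phi> (x_word P)) * (S.E_word (x_word P) * b1))"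
    by (subst sum_admissible) (auto simp: admissible_x_word)
  also have "\<dots> = b1 * harmonic_series \<phi> $ n"
    unfolding E_word_x_word harmonic_series_def fps_nth_Abs_fps sum_distrib_left
    by (intro sum.cong refl) (rule S.j_left_commute [symmetric])
  finally have eq: "S.E_series \<phi> $ n * b1 - b1 * harmonic_series \<phi> $ n
      = (\<Sum>w | length w = n. if admissible w then 0 else jT (coeff \<phi> w) * (S.E_word w * b1))"
    by simp
  have "negligible (jT (coeff \<phi> w) * (S.E_word w * b1))" if na: "\<not> admissible w" for w
  proof -
    obtain u where "w = u @ [X0]"
    proof (cases w rule: rev_cases)
      case (snoc u l)
      with na have "l = X0" by (cases l) (auto simp: admissible_def)
      with snoc that show thesis by blast
    qed (use na in \<open>simp add: admissible_def\<close>)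
    then have "S.E_word w * b1 = (S.E_word u * b1 * a0 :: (letter, 'r) ncps2)"
      by (simp only: S.E_word_snoc mult.assoc S.comm)
    moreover have "negligible (jT (coeff \<phi> w) * (S.E_word u * b1 * a0))"
      by (intro negligible_mult negligible_a0)
    ultimately show ?thesis by (simp only:)
  qed
  then show ?thesis unfolding eq by (intro negligible_sum) (auto simp: negligible_zero)
qed

lemma F_series_congruence:
  fixes \<phi> :: "'r::comm_ring_1 xseries"
  shows "negligible (S.F_series \<phi> $ n * b1 - b1 * at_pair jT b0 b1 (trim \<phi>) $ n)"
proof -
  have F: "S.F_series \<phi> $ n * b1 - b1 * at_pair jT b0 b1 (trim \<phi>) $ n
     = (\<Sum>w | length w = n. jT (coeff \<phi> w) * (S.F_word w * b1) - jT (coeff (trim \<phi>) w) * (b1 * word_at b0 b1 w))"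
    unfolding S.F_series_def gev_nth fps_nth_Abs_fps sum_distrib_right sum_distrib_left sum_subtractf
    by (intro arg_cong2 [where f = minus] sum.cong refl) (simp_all only: mult.assoc S.j_left_commute [of b1])
  have "negligible (jT (coeff \<phi> w) * (S.F_word w * b1) - jT (coeff (trim \<phi>) w) * (b1 * word_at b0 b1 w))" for w
  proof (cases w rule: rev_cases)
    case Nil
    then show ?thesis by (simp add: S.F_word_simps negligible_zero)
  next
    case (snoc u l)
    show ?thesis
    proof (cases l)
      case X0
      then have "S.F_word w * b1 = (S.F_word u * b1 * a0 :: (letter, 'r) ncps2)"
        by (simp only: snoc S.F_word_simps mult.assoc S.comm)
      moreover have "coeff (trim \<phi>) w = 0" using snoc X0 by simp
      moreover have "negligible (jT (coeff \<phi> w) * (S.F_word u * b1 * a0))"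
        by (intro negligible_mult negligible_a0)
      ultimately show ?thesis by (simp only: S.j_zero mult_zero_left diff_zero)
    next
      case X1
      have "S.F_word w * b1 = (b1 * word_at b0 b1 w :: (letter, 'r) ncps2)"
        using X1 snoc by (simp add: S.F_word_simps mult.assoc)
      moreover have "coeff (trim \<phi>) w = coeff \<phi> w" using snoc X1 by simp
      ultimately show ?thesis by (simp only: diff_self negligible_zero)
    qed
  qed
  then show ?thesis unfolding F by (rule negligible_sum)
qed

text \<open>
  The middle entry identity over the tensor square, multiplied by \<open>b1\<close> on the right. Modulo negligible
  elements the factor \<open>b1\<close> can be moved to the left on both sides and then be cancelled.
\<close>

theorem harmonic_identity:
  fixes \<phi> :: "'r::comm_ring_1 xseries"
  assumes "pentagon \<phi>" "commutator_like \<phi>"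
  shows "negligible ((at_pair jT a1 b1 (trim \<phi>) * harmonic_series \<phi>) $ n
     - (at_pair jT a0 a1 \<phi> * at_pair jT b0 b1 (trim \<phi>)) $ n)"
proof (rule negligible_b1_cancel)
  let ?B = "at_pair jT a1 b1 (trim \<phi>)" and ?\<Phi> = "at_pair jT a0 a1 \<phi>" and ?\<Psi> = "at_pair jT b0 b1 (trim \<phi>)"
  have comm: "at_pair jT x y f $ i * b1 = b1 * at_pair jT x y f $ i"
    if "x * b1 = b1 * x" "y * b1 = b1 * y" for x y :: "(letter, 'r) ncps2" and f i
  proof -
    have "word_at x y w * b1 = b1 * word_at x y w" for w
    proof (induction w)
      case (Cons l w)
      have "(case_letter x y l) * b1 = b1 * (case_letter x y l)" using that by (cases l) auto
      then have "case_letter x y l * (b1 * word_at x y w) = b1 * (case_letter x y l * word_at x y w)"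
        by (simp only: mult.assoc [symmetric])
      then show ?case by (simp only: list.map prod_list.Cons mult.assoc Cons.IH)
    qed simp
    then show ?thesis
      unfolding gev_nth sum_distrib_left sum_distrib_right
      by (intro sum.cong refl) (simp only: mult.assoc S.j_left_commute [of b1])
  qed
  have B: "?B $ i * b1 = b1 * ?B $ i" and \<Phi>: "?\<Phi> $ i * b1 = b1 * ?\<Phi> $ i" for i
    by (rule comm; simp add: S.comm)+
  have "(?B * S.E_series \<phi>) $ n * b1 = (?\<Phi> * S.F_series \<phi>) $ n * b1"
    by (simp only: S.entry_identity [OF assms])
  then have eq: "(\<Sum>i=0..n. ?B $ i * (S.E_series \<phi> $ (n - i) * b1)) = (\<Sum>i=0..n. ?\<Phi> $ i * (S.F_series \<phi> $ (n - i) * b1))"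
    by (simp only: fps_mult_nth sum_distrib_right mult.assoc)
  have "b1 * ((?B * harmonic_series \<phi>) $ n - (?\<Phi> * ?\<Psi>) $ n)
     = (\<Sum>i=0..n. ?B $ i * (b1 * harmonic_series \<phi> $ (n - i))) - (\<Sum>i=0..n. ?\<Phi> $ i * (b1 * ?\<Psi> $ (n - i)))"
    unfolding fps_mult_nth right_diff_distrib sum_distrib_left
    by (intro arg_cong2 [where f = minus] sum.cong refl) (simp_all only: mult.assoc [symmetric] B \<Phi>)
  also have "\<dots> = (\<Sum>i=0..n. ?\<Phi> $ i * (S.F_series \<phi> $ (n - i) * b1 - b1 * ?\<Psi> $ (n - i)))
     - (\<Sum>i=0..n. ?B $ i * (S.E_series \<phi> $ (n - i) * b1 - b1 * harmonic_series \<phi> $ (n - i)))"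
    unfolding right_diff_distrib sum_subtractf by (simp only: eq) simp
  also have "\<dots> = (\<Sum>i=0..n. ?\<Phi> $ i * (S.F_series \<phi> $ (n - i) * b1 - b1 * ?\<Psi> $ (n - i)))
     + - 1 * (\<Sum>i=0..n. ?B $ i * (S.E_series \<phi> $ (n - i) * b1 - b1 * harmonic_series \<phi> $ (n - i)))"
    by simp
  finally show "negligible (b1 * ((?B * harmonic_series \<phi>) $ n - (?\<Phi> * ?\<Psi>) $ n))"
    by (simp only:) (intro negligible_add negligible_mult [of _ "- 1"] negligible_sum negligible_mult
      E_series_congruence F_series_congruence)
qed

section \<open>Passing to the letters Y\<close>

text \<open>
  The square of \<open>\<pi>\<^sub>Y\<close>. It is not multiplicative, but it is as soon as the left factor only involves
  admissible words, because admissible words have unique factorization into blocks.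
\<close>

definition to_Y2 :: "(letter, 'r::comm_ring_1) ncps2 \<Rightarrow> (yletter, 'r) ncps2" where
  "to_Y2 F = Abs_ncps (\<lambda>p. Abs_ncps (\<lambda>q.
     (- 1) ^ (length p + length q) * coeff (coeff F (x_word p)) (x_word q)))"

lemma coeff_to_Y2: "coeff (coeff (to_Y2 F) p) q
    = (- 1) ^ (length p + length q) * coeff (coeff F (x_word p)) (x_word q)"
  by (simp add: to_Y2_def)

definition admissible2 :: "(letter, 'r::comm_ring_1) ncps2 \<Rightarrow> bool" where
  "admissible2 F \<longleftrightarrow> (\<forall>u v. coeff (coeff F u) v \<noteq> 0 \<longrightarrow> admissible u \<and> admissible v)"

lemma sum_splits_x_word:
  fixes G :: "letter list \<Rightarrow> letter list \<Rightarrow> 'b::comm_monoid_add"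
  assumes "\<And>u v. \<not> admissible u \<Longrightarrow> G u v = 0"
  shows "(\<Sum>s\<in>splits (x_word p). G (fst s) (snd s)) = (\<Sum>s\<in>splits p. G (x_word (fst s)) (x_word (snd s)))"
proof -
  let ?i = "\<lambda>s. (x_word (fst s), x_word (snd s))"
  have "(\<Sum>s\<in>splits (x_word p). G (fst s) (snd s)) = (\<Sum>s\<in>?i ` splits p. G (fst s) (snd s))"
  proof (rule sum.mono_neutral_right)
    show "?i ` splits p \<subseteq> splits (x_word p)" by (auto simp: splits_def)
    show "\<forall>s\<in>splits (x_word p) - ?i ` splits p. G (fst s) (snd s) = 0"
    proof
      fix s assume s: "s \<in> splits (x_word p) - ?i ` splits p"
      have "\<not> admissible (fst s)"
      proof
        assume "admissible (fst s)"
        moreover have st: "fst s @ snd s = x_word p" using s by (auto simp: splits_def)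
        then have "admissible (snd s)" using admissible_x_word [of p] admissible_suffix by metis
        ultimately obtain P Q where PQ: "fst s = x_word P" "snd s = x_word Q"
          by (auto simp: admissible_iff)
        with st have "x_word (P @ Q) = x_word p" by simp
        then have "(P, Q) \<in> splits p" by (simp only: x_word_inj) (simp add: splits_def)
        moreover have "s = ?i (P, Q)" using PQ by (simp add: prod_eq_iff)
        ultimately show False using s by blast
      qed
      then show "G (fst s) (snd s) = 0" by (rule assms)
    qed
  qed simp
  also have "\<dots> = (\<Sum>s\<in>splits p. G (x_word (fst s)) (x_word (snd s)))"
    by (subst sum.reindex) (auto simp: inj_on_def x_word_inj prod_eq_iff)
  finally show ?thesis .
qed

lemma to_Y2_mult:
  assumes "admissible2 F"
  shows "to_Y2 (F * G) = to_Y2 F * to_Y2 G"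
proof (intro ncps_eqI)
  fix p q
  have z: "coeff (coeff F u) v = 0" if "\<not> admissible u \<or> \<not> admissible v" for u v
    using assms that by (auto simp: admissible2_def)
  have "coeff (coeff (F * G) (x_word p)) (x_word q) = (\<Sum>s\<in>splits p. \<Sum>r\<in>splits (x_word q).
      coeff (coeff F (x_word (fst s))) (fst r) * coeff (coeff G (x_word (snd s))) (snd r))"
    unfolding coeff2_mult
    by (rule sum_splits_x_word [where G = "\<lambda>u v. \<Sum>r\<in>splits (x_word q). coeff (coeff F u) (fst r) * coeff (coeff G v) (snd r)"])
      (simp add: z)
  also have "\<dots> = (\<Sum>s\<in>splits p. \<Sum>r\<in>splits q.
      coeff (coeff F (x_word (fst s))) (x_word (fst r)) * coeff (coeff G (x_word (snd s))) (x_word (snd r)))"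
    by (intro sum.cong refl, rule sum_splits_x_word [where
      G = "\<lambda>u v. coeff (coeff F (x_word (fst s))) u * coeff (coeff G (x_word (snd s))) v" for s]) (simp add: z)
  finally have "coeff (coeff (to_Y2 (F * G)) p) q = (\<Sum>s\<in>splits p. \<Sum>r\<in>splits q. (- 1) ^ (length p + length q) *
      (coeff (coeff F (x_word (fst s))) (x_word (fst r)) * coeff (coeff G (x_word (snd s))) (x_word (snd r))))"
    unfolding coeff_to_Y2 by (simp add: sum_distrib_left)
  also have "\<dots> = coeff (coeff (to_Y2 F * to_Y2 G) p) q"
    unfolding coeff2_mult coeff_to_Y2
  proof (intro sum.cong refl)
    fix s r assume "s \<in> splits p" "r \<in> splits q"
    then have "length p + length q = (length (fst s) + length (fst r)) + (length (snd s) + length (snd r))"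
      by (auto simp: splits_def)
    then show "(- 1) ^ (length p + length q) * (coeff (coeff F (x_word (fst s))) (x_word (fst r)) *
        coeff (coeff G (x_word (snd s))) (x_word (snd r)))
      = (- 1) ^ (length (fst s) + length (fst r)) * coeff (coeff F (x_word (fst s))) (x_word (fst r)) *
        ((- 1) ^ (length (snd s) + length (snd r)) * coeff (coeff G (x_word (snd s))) (x_word (snd r)))"
      by (simp only: power_add mult_ac)
  qed
  finally show "coeff (coeff (to_Y2 (F * G)) p) q = coeff (coeff (to_Y2 F * to_Y2 G) p) q" .
qed

lemma to_Y2_add: "to_Y2 (F + G) = to_Y2 F + to_Y2 G"
  by (intro ncps_eqI) (simp add: coeff_to_Y2 distrib_left)

lemma to_Y2_diff: "to_Y2 (F - G) = to_Y2 F - to_Y2 G"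
  by (intro ncps_eqI) (simp add: coeff_to_Y2 right_diff_distrib)

lemma to_Y2_sum: "to_Y2 (sum F A) = (\<Sum>i\<in>A. to_Y2 (F i))"
  by (intro ncps_eqI) (simp add: coeff_to_Y2 sum_distrib_left)

lemma to_Y2_scalar: "to_Y2 (jT r * F) = jT r * to_Y2 F"
  by (intro ncps_eqI) (simp add: coeff_to_Y2 mult_ac)

lemma coeff_\<pi>\<^sub>Y: "coeff (\<pi>\<^sub>Y f) p = (- 1) ^ length p * coeff f (x_word p)"
  by (simp add: \<pi>\<^sub>Y_def)

lemma to_Y2_tens: "to_Y2 (tens f g) = tens (\<pi>\<^sub>Y f) (\<pi>\<^sub>Y g)"
  by (intro ncps_eqI) (simp add: coeff_to_Y2 coeff_\<pi>\<^sub>Y power_add mult_ac)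

text \<open>
  A graded element is reassembled into a single series by reading each coefficient off the component
  of its own degree.
\<close>

definition to_Y :: "(letter, 'r::comm_ring_1) ncps2 fps \<Rightarrow> (yletter, 'r) ncps2" where
  "to_Y F = Abs_ncps (\<lambda>p. Abs_ncps (\<lambda>q.
     coeff (coeff (to_Y2 (F $ (length (x_word p) + length (x_word q)))) p) q))"

lemma coeff_to_Y: "coeff (coeff (to_Y F) p) q
    = coeff (coeff (to_Y2 (F $ (length (x_word p) + length (x_word q)))) p) q"
  by (simp add: to_Y_def)

definition homogeneous2 :: "nat \<Rightarrow> (letter, 'r::comm_ring_1) ncps2 \<Rightarrow> bool" where
  "homogeneous2 n F \<longleftrightarrow> (\<forall>u v. coeff (coeff F u) v \<noteq> 0 \<longrightarrow> length u + length v = n)"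

lemma to_Y_mult:
  assumes adm: "\<And>n. admissible2 (F $ n)" and hom: "\<And>n. homogeneous2 n (F $ n)"
  shows "to_Y (F * G) = to_Y F * to_Y G"
proof (intro ncps_eqI)
  fix p q
  let ?l = "\<lambda>p q. length (x_word p) + length (x_word q)"
  have "coeff (coeff (to_Y (F * G)) p) q
     = (\<Sum>i=0..?l p q. \<Sum>s\<in>splits p. \<Sum>r\<in>splits q. coeff (coeff (to_Y2 (F $ i)) (fst s)) (fst r) *
         coeff (coeff (to_Y2 (G $ (?l p q - i))) (snd s)) (snd r))"
    by (simp only: coeff_to_Y fps_mult_nth to_Y2_sum to_Y2_mult [OF adm] coeff_sum coeff2_mult)
  also have "\<dots> = (\<Sum>s\<in>splits p. \<Sum>r\<in>splits q. \<Sum>i=0..?l p q. coeff (coeff (to_Y2 (F $ i)) (fst s)) (fst r) *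
         coeff (coeff (to_Y2 (G $ (?l p q - i))) (snd s)) (snd r))"
    by (subst sum.swap, intro sum.cong refl, rule sum.swap)
  also have "\<dots> = coeff (coeff (to_Y F * to_Y G) p) q"
    unfolding coeff2_mult
  proof (intro sum.cong refl)
    fix s r assume sr: "s \<in> splits p" "r \<in> splits q"
    then have l: "?l p q = ?l (fst s) (fst r) + ?l (snd s) (snd r)"
      by (auto simp: splits_def)
    have "coeff (coeff (to_Y2 (F $ i)) (fst s)) (fst r) = 0" if "i \<noteq> ?l (fst s) (fst r)" for i
    proof -
      have "coeff (coeff (F $ i) (x_word (fst s))) (x_word (fst r)) = 0"
        using hom [of i] that unfolding homogeneous2_def by blast
      then show ?thesis by (simp add: coeff_to_Y2)
    qed
    then have "(\<Sum>i=0..?l p q. coeff (coeff (to_Y2 (F $ i)) (fst s)) (fst r) *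
         coeff (coeff (to_Y2 (G $ (?l p q - i))) (snd s)) (snd r))
      = (\<Sum>i\<in>{?l (fst s) (fst r)}. coeff (coeff (to_Y2 (F $ i)) (fst s)) (fst r) *
         coeff (coeff (to_Y2 (G $ (?l p q - i))) (snd s)) (snd r))"
      by (intro sum.mono_neutral_right) (auto simp: l)
    then show "(\<Sum>i=0..?l p q. coeff (coeff (to_Y2 (F $ i)) (fst s)) (fst r) *
         coeff (coeff (to_Y2 (G $ (?l p q - i))) (snd s)) (snd r))
      = coeff (coeff (to_Y F) (fst s)) (fst r) * coeff (coeff (to_Y G) (snd s)) (snd r)"
      by (simp add: coeff_to_Y l)
  qed
  finally show "coeff (coeff (to_Y (F * G)) p) q = coeff (coeff (to_Y F * to_Y G) p) q" .
qed

lemma to_Y_cong_negligible: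
  assumes "\<And>n. negligible (F $ n - G $ n)"
  shows "to_Y F = to_Y G"
proof (intro ncps_eqI)
  fix p q
  let ?n = "length (x_word p) + length (x_word q)"
  have "coeff (coeff (F $ ?n - G $ ?n) (x_word p)) (x_word q) = 0"
    using assms [of ?n] admissible_x_word unfolding negligible_def by blast
  then show "coeff (coeff (to_Y F) p) q = coeff (coeff (to_Y G) p) q"
    by (simp add: coeff_to_Y coeff_to_Y2)
qed

subsection \<open>The right-hand side\<close>

definition homogeneous_part :: "nat \<Rightarrow> ('x, 'r::comm_ring_1) ncps \<Rightarrow> ('x, 'r) ncps" where
  "homogeneous_part n f = Abs_ncps (\<lambda>w. if length w = n then coeff f w else 0)"

abbreviation nc_word :: "'x list \<Rightarrow> ('x, 'r::comm_ring_1) ncps" where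
  "nc_word w \<equiv> prod_list (map nc_var w)"

lemma coeff_mono: "coeff (nc_word w) u = (if u = w then 1 else 0)"
proof (induction w arbitrary: u)
  case (Cons x w)
  then show ?case by (auto simp: coeff_var_mult split: list.split)
qed simp

lemma word_tens_left: "word_at a0 a1 w = tens (nc_word w) 1"
  by (induction w) (auto simp: tens_mult split: letter.split intro!: ncps_eqI)

lemma word_tens_right: "word_at b0 b1 w = tens 1 (nc_word w)"
  by (induction w) (auto simp: tens_mult split: letter.split intro!: ncps_eqI)

lemma homogeneous_part_left: "at_pair jT a0 a1 f $ n = tens (homogeneous_part n f) 1"
proof (intro ncps_eqI)
  fix u v
  have "coeff (coeff (at_pair jT a0 a1 f $ n) u) v
     = (\<Sum>w | length w = n. if w = u then coeff f u * coeff 1 v else 0)"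
    unfolding gev_nth word_tens_left coeff_sum
    by (rule sum.cong) (auto simp: coeff_mono)
  then show "coeff (coeff (at_pair jT a0 a1 f $ n) u) v = coeff (coeff (tens (homogeneous_part n f) 1) u) v"
    by (simp add: homogeneous_part_def)
qed

lemma homogeneous_part_right: "at_pair jT b0 b1 f $ n = tens 1 (homogeneous_part n f)"
proof (intro ncps_eqI)
  fix u v
  have "coeff (coeff (at_pair jT b0 b1 f $ n) u) v
     = (\<Sum>w | length w = n. if w = v then coeff f v * coeff 1 u else 0)"
    unfolding gev_nth word_tens_right coeff_sum
    by (rule sum.cong) (auto simp: coeff_mono)
  then show "coeff (coeff (at_pair jT b0 b1 f $ n) u) v = coeff (coeff (tens 1 (homogeneous_part n f)) u) v"
    by (simp add: homogeneous_part_def)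
qed

lemma to_Y_right_side:
  "to_Y (at_pair jT a0 a1 \<phi> * at_pair jT b0 b1 (trim \<phi>)) = tens (\<pi>\<^sub>Y \<phi>) (\<pi>\<^sub>Y \<phi>)"
proof (intro ncps_eqI)
  fix p q
  let ?u = "x_word p" and ?v = "x_word q"
  let ?n = "length ?u + length ?v"
  have "coeff (coeff ((at_pair jT a0 a1 \<phi> * at_pair jT b0 b1 (trim \<phi>)) $ ?n) ?u) ?v
     = (\<Sum>i=0..?n. coeff (homogeneous_part i \<phi>) ?u * coeff (homogeneous_part (?n - i) (trim \<phi>)) ?v)"
    by (simp add: fps_mult_nth homogeneous_part_left homogeneous_part_right tens_mult)
  also have "\<dots> = (\<Sum>i=0..?n. if i = length ?u then coeff \<phi> ?u * coeff (trim \<phi>) ?v else 0)"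
    by (rule sum.cong) (auto simp: homogeneous_part_def)
  also have "\<dots> = coeff \<phi> ?u * coeff \<phi> ?v"
    by (simp add: coeff_trim_admissible admissible_x_word del: coeff_trim)
  finally show "coeff (coeff (to_Y (at_pair jT a0 a1 \<phi> * at_pair jT b0 b1 (trim \<phi>))) p) q
      = coeff (coeff (tens (\<pi>\<^sub>Y \<phi>) (\<pi>\<^sub>Y \<phi>)) p) q"
    unfolding coeff_to_Y coeff_to_Y2 by (simp add: coeff_\<pi>\<^sub>Y power_add mult_ac)
qed

subsection \<open>The harmonic coproduct\<close>

lemma admissible2_tens:
  assumes "\<And>u. coeff f u \<noteq> 0 \<Longrightarrow> admissible u" "\<And>u. coeff g u \<noteq> 0 \<Longrightarrow> admissible u"
  shows "admissible2 (tens f g)"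
  unfolding admissible2_def using assms by (auto dest!: mult_not_zero)

lemma admissible2_zero: "admissible2 0"
  by (simp add: admissible2_def)

lemma admissible2_add: "admissible2 F \<Longrightarrow> admissible2 G \<Longrightarrow> admissible2 (F + G)"
proof -
  assume FG: "admissible2 F" "admissible2 G"
  have "coeff (coeff F u) v \<noteq> 0 \<or> coeff (coeff G u) v \<noteq> 0" if "coeff (coeff (F + G) u) v \<noteq> 0" for u v
    using that by auto
  with FG show ?thesis unfolding admissible2_def by blast
qed

lemma admissible2_uminus: "admissible2 F \<Longrightarrow> admissible2 (- F)"
  unfolding admissible2_def by simp

lemma admissible2_sum: "(\<And>i. i \<in> A \<Longrightarrow> admissible2 (F i)) \<Longrightarrow> admissible2 (sum F A)"
  by (induction A rule: infinite_finite_induct) (simp_all add: admissible2_zero admissible2_add)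

lemma admissible_mono_block: "coeff (nc_word (X0pow_X1 n)) u \<noteq> 0 \<Longrightarrow> admissible u"
proof -
  assume "coeff (nc_word (X0pow_X1 n)) u \<noteq> 0"
  then have "u = X0pow_X1 n" by (metis coeff_mono)
  then show "admissible u" by (simp add: admissible_def X0pow_X1_def)
qed

lemma tens_one_one: "tens 1 1 = 1"
  by (intro ncps_eqI) simp

lemma tens_power: "tens f 1 ^ n = tens (f ^ n) 1" "tens 1 f ^ n = tens 1 (f ^ n)"
  by (induction n) (simp_all add: tens_mult tens_one_one)

lemma cross_sum:
  "(S.cross n :: (letter, 'r::comm_ring_1) ncps2) = (\<Sum>i<n. tens (nc_var X0 ^ i) (nc_var X0 ^ (n - Suc i)))"
proof (induction n)
  case (Suc n)
  have "(S.cross (Suc n) :: (letter, 'r) ncps2) = (\<Sum>i<n. tens (nc_var X0 ^ Suc i) (nc_var X0 ^ (n - Suc i))) + tens 1 (nc_var X0 ^ n)"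
    by (simp add: Suc.IH sum_distrib_left tens_mult tens_power Suc_diff_le)
  then show ?case
    unfolding sum.lessThan_Suc_shift by (simp add: add.commute del: power_Suc)
qed simp

lemma mono_block: "nc_word (X0pow_X1 n) = nc_var X0 ^ n * nc_var X1"
  by (simp add: X0pow_X1_def prod_list_replicate)

lemma harmonic_block_tens:
  "harmonic_block (YSuc n) = tens (nc_word (X0pow_X1 n)) 1 + tens 1 (nc_word (X0pow_X1 n))
     + - (\<Sum>i<n. tens (nc_word (X0pow_X1 i)) (nc_word (X0pow_X1 (n - Suc i))))"
  by (simp add: harmonic_block_def cross_sum sum_distrib_right tens_mult mono_block tens_power)

lemma admissible2_harmonic_block: "admissible2 (harmonic_block y)"
proof -
  obtain n where y: "y = YSuc n" by (cases y)
  have one: "coeff (1 :: 'a xseries) u \<noteq> 0 \<Longrightarrow> admissible u" for u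
    by (auto simp: admissible_def split: if_splits)
  show ?thesis unfolding y harmonic_block_tens
    by (intro admissible2_add admissible2_uminus admissible2_sum admissible2_tens)
      (auto dest: one admissible_mono_block simp del: coeff_simps(2))
qed

lemma \<pi>\<^sub>Y_block: "\<pi>\<^sub>Y (nc_word (X0pow_X1 n)) = - nc_var (YSuc n)"
proof (rule ncps_eqI)
  fix p
  have "x_word p = X0pow_X1 n \<longleftrightarrow> p = [YSuc n]"
    using x_word_inj [of p "[YSuc n]"] by simp
  then show "coeff (\<pi>\<^sub>Y (nc_word (X0pow_X1 n))) p = coeff (- nc_var (YSuc n)) p"
    by (simp add: coeff_\<pi>\<^sub>Y coeff_mono nc_var_def)
qed

lemma \<pi>\<^sub>Y_one: "\<pi>\<^sub>Y 1 = 1"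
proof (rule ncps_eqI)
  fix p
  have "x_word p = [] \<longleftrightarrow> p = []" using x_word_inj [of p "[]"] by simp
  then show "coeff (\<pi>\<^sub>Y 1) p = coeff 1 p" by (simp add: coeff_\<pi>\<^sub>Y)
qed

lemma to_Y2_one: "to_Y2 1 = 1"
  unfolding tens_one_one [symmetric] to_Y2_tens \<pi>\<^sub>Y_one ..

lemma to_Y2_uminus: "to_Y2 (- F) = - to_Y2 F"
  by (intro ncps_eqI) (simp add: coeff_to_Y2)

lemma tens_uminus: "tens (- f) g = - tens f g" "tens f (- g) = - tens f g"
  by (intro ncps_eqI; simp)+

lemma to_Y2_harmonic_block: "to_Y2 (harmonic_block y) = - shuffle_letter y" (is "?l = - ?r")
proof -
  obtain n where y: "y = YSuc n" by (cases y)
  have "?r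
     = tens (Yser 0) (Yser (Suc n)) + (\<Sum>i\<le>n. tens (Yser (Suc i)) (Yser (n - i)))"
    unfolding y shuffle_letter.simps by (subst sum.atMost_Suc_shift) simp
  also have "(\<Sum>i\<le>n. tens (Yser (Suc i)) (Yser (n - i)))
     = (\<Sum>i<n. tens (Yser (Suc i)) (Yser (n - i))) + tens (Yser (Suc n)) (Yser 0)"
    by (simp add: lessThan_Suc_atMost [symmetric])
  also have "(\<Sum>i<n. tens (Yser (Suc i)) (Yser (n - i))) = (\<Sum>i<n. tens (Yser (Suc i)) (Yser (Suc (n - Suc i))))"
    by (rule sum.cong) (auto simp: Suc_diff_Suc)
  finally have sh: "?r = tens (Yser 0) (Yser (Suc n))
     + ((\<Sum>i<n. tens (Yser (Suc i)) (Yser (Suc (n - Suc i)))) + tens (Yser (Suc n)) (Yser 0))" .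
  show ?thesis
    unfolding sh unfolding y harmonic_block_tens
    by (simp add: to_Y2_add to_Y2_diff to_Y2_uminus to_Y2_sum to_Y2_tens \<pi>\<^sub>Y_block \<pi>\<^sub>Y_one tens_uminus)
qed

lemma to_Y2_harmonic_blocks:
  "to_Y2 (prod_list (map harmonic_block P)) = (- 1) ^ length P * prod_list (map shuffle_letter P)"
proof (induction P)
  case (Cons y P)
  have "(- shuffle_letter y) * ((- 1) ^ length P * prod_list (map shuffle_letter P))
     = (- 1) ^ Suc (length P) * (shuffle_letter y * prod_list (map shuffle_letter P :: (yletter, 'a) ncps2 list))"
    by (cases "even (length P)") (simp_all add: uminus_power_if)
  then show ?case
    by (simp add: to_Y2_mult [OF admissible2_harmonic_block] to_Y2_harmonic_block Cons.IH)
qed (simp add: to_Y2_one)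

lemma shuffle_letter_weight:
  fixes u v :: "yletter list"
  assumes nz: "coeff (coeff (shuffle_letter x :: (yletter, 'r::comm_ring_1) ncps2) u) v \<noteq> 0"
  shows "sum_list (map y_weight u) + sum_list (map y_weight v) = y_weight x"
proof -
  obtain n where x: "x = YSuc n" by (cases x)
  have "(\<Sum>i\<le>Suc n. coeff (Yser i) u * coeff (Yser (Suc n - i)) v) \<noteq> (0 :: 'r)"
    using nz by (simp add: x del: sum.atMost_Suc)
  then obtain i where i: "i \<in> {..Suc n}" "coeff (Yser i) u * coeff (Yser (Suc n - i)) v \<noteq> (0 :: 'r)"
    by (rule sum.not_neutral_contains_not_neutral)
  then have "coeff (Yser i) u \<noteq> (0 :: 'r)" "coeff (Yser (Suc n - i)) v \<noteq> (0 :: 'r)" by auto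
  then have "sum_list (map y_weight u) = i" "sum_list (map y_weight v) = Suc n - i"
    by (auto dest: coeff_Yser_nonzero)
  with i x show ?thesis by simp
qed

lemma shuffle_word_weight:
  assumes "coeff (coeff (prod_list (map shuffle_letter P) :: (yletter, 'r::comm_ring_1) ncps2) p) q \<noteq> 0"
  shows "length (x_word p) + length (x_word q) = length (x_word P)"
  unfolding length_x_word by (rule coprod_word_homogeneous [OF shuffle_letter_weight assms])

lemma coeff_\<Delta>_star:
  assumes "finite W" "\<And>P. length (x_word P) = length (x_word p) + length (x_word q) \<Longrightarrow> P \<in> W"
  shows "coeff (coeff (\<Delta>_star f) p) q
     = (\<Sum>P\<in>W. coeff f P * coeff (coeff (prod_list (map shuffle_letter P)) p) q)"
  unfolding \<Delta>_star_def nc_coprod_def nc_Sum_def coeff_Abs_ncps coeff_const_mult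
  by (rule Sum_any.expand_superset)
    (use assms in \<open>auto dest!: mult_not_zero shuffle_word_weight\<close>)

lemma to_Y_harmonic_series: "to_Y (harmonic_series \<phi>) = \<Delta>_star (\<pi>\<^sub>Y \<phi>)"
proof (intro ncps_eqI)
  fix p q
  let ?n = "length (x_word p) + length (x_word q)"
  have sign: "coeff (coeff ((- 1) ^ k * F) p) q = (- 1) ^ k * coeff (coeff F p) q" for k and F :: "(yletter, 'a) ncps2"
    by (cases "even k") (simp_all add: uminus_power_if)
  have "coeff (coeff (to_Y (harmonic_series \<phi>)) p) q
    = (\<Sum>P | length (x_word P) = ?n. coeff (\<pi>\<^sub>Y \<phi>) P * coeff (coeff (prod_list (map shuffle_letter P)) p) q)"
    unfolding coeff_to_Y harmonic_series_def fps_nth_Abs_fps to_Y2_sum coeff_sum to_Y2_scalar coeff_jT_mult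
      to_Y2_harmonic_blocks sign coeff_\<pi>\<^sub>Y
    by (simp add: mult_ac)
  also have "\<dots> = coeff (coeff (\<Delta>_star (\<pi>\<^sub>Y \<phi>)) p) q"
    by (rule coeff_\<Delta>_star [symmetric]) (auto intro: finite_x_word)
  finally show "coeff (coeff (to_Y (harmonic_series \<phi>)) p) q = coeff (coeff (\<Delta>_star (\<pi>\<^sub>Y \<phi>)) p) q" .
qed

text \<open>
  All sums can be taken over the finite set of words of bounded weight, since a word contributes only
  to coefficients of its own weight.
\<close>

theorem \<Delta>_star_mult: "\<Delta>_star (f * g) = \<Delta>_star f * \<Delta>_star g"
proof (intro ncps_eqI)
  fix p q
  let ?l = "\<lambda>P. length (x_word P)"
  let ?S = "\<lambda>P. prod_list (map shuffle_letter P) :: (yletter, 'a) ncps2"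
  define N where "N = ?l p + ?l q"
  define W where "W = {P. ?l P \<le> N}"
  have "W = (\<Union>n\<le>N. {P. ?l P = n})" by (auto simp: W_def)
  then have W: "finite W" by (simp only: finite_UN_I finite_atMost finite_x_word)
  have D: "coeff (coeff (\<Delta>_star f) p') q' = (\<Sum>P\<in>W. coeff f P * coeff (coeff (?S P) p') q')"
    if "?l p' + ?l q' \<le> N" for f p' q'
    by (rule coeff_\<Delta>_star [OF W]) (use that in \<open>auto simp: W_def\<close>)
  let ?T = "\<lambda>x. coeff f (fst x) * coeff g (snd x) * coeff (coeff (?S (fst x @ snd x)) p) q"
  have "coeff (coeff (\<Delta>_star f * \<Delta>_star g) p) q = (\<Sum>s\<in>splits p. \<Sum>r\<in>splits q. \<Sum>x\<in>W \<times> W.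
      coeff f (fst x) * coeff g (snd x) * (coeff (coeff (?S (fst x)) (fst s)) (fst r) * coeff (coeff (?S (snd x)) (snd s)) (snd r)))"
    unfolding coeff2_mult
  proof (intro sum.cong refl)
    fix s r assume "s \<in> splits p" "r \<in> splits q"
    then have "?l (fst s) + ?l (fst r) \<le> N" "?l (snd s) + ?l (snd r) \<le> N"
      by (auto simp: splits_def N_def)
    then show "coeff (coeff (\<Delta>_star f) (fst s)) (fst r) * coeff (coeff (\<Delta>_star g) (snd s)) (snd r) = (\<Sum>x\<in>W \<times> W.
      coeff f (fst x) * coeff g (snd x) * (coeff (coeff (?S (fst x)) (fst s)) (fst r) * coeff (coeff (?S (snd x)) (snd s)) (snd r)))"
      by (simp add: D sum_product sum.cartesian_product case_prod_unfold mult_ac)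
  qed
  also have "\<dots> = (\<Sum>x\<in>W \<times> W. \<Sum>s\<in>splits p. \<Sum>r\<in>splits q.
      coeff f (fst x) * coeff g (snd x) * (coeff (coeff (?S (fst x)) (fst s)) (fst r) * coeff (coeff (?S (snd x)) (snd s)) (snd r)))"
    by (rule trans [OF sum.cong [OF refl sum.swap] sum.swap])
  also have "\<dots> = (\<Sum>x\<in>W \<times> W. ?T x)"
    by (simp add: coeff2_mult sum_distrib_left)
  also have "\<dots> = (\<Sum>x\<in>{x. ?l (fst x @ snd x) \<le> N}. ?T x)"
  proof (rule sum.mono_neutral_right)
    show "\<forall>x\<in>W \<times> W - {x. ?l (fst x @ snd x) \<le> N}. ?T x = 0"
    proof
      fix x assume "x \<in> W \<times> W - {x. ?l (fst x @ snd x) \<le> N}"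
      then have "?l p + ?l q \<noteq> ?l (fst x @ snd x)" by (simp add: N_def)
      then have "coeff (coeff (?S (fst x @ snd x)) p) q = 0" using shuffle_word_weight by blast
      then show "?T x = 0" by (simp only: mult_zero_right)
    qed
  qed (use W in \<open>auto simp: W_def\<close>)
  also have "\<dots> = (\<Sum>(P, x)\<in>(SIGMA P:W. splits P). ?T x)"
    by (rule sum.reindex_bij_witness [where i = "\<lambda>(P, x). x" and j = "\<lambda>x. (fst x @ snd x, x)"])
      (auto simp: W_def splits_def)
  also have "\<dots> = (\<Sum>P\<in>W. \<Sum>x\<in>splits P. ?T x)"
    by (rule sum.Sigma [symmetric]) (use W in auto)
  also have "\<dots> = (\<Sum>P\<in>W. coeff (f * g) P * coeff (coeff (?S P) p) q)"
    unfolding coeff_mult sum_distrib_right case_prod_unfold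
    by (intro sum.cong refl) (auto simp: splits_def)
  also have "\<dots> = coeff (coeff (\<Delta>_star (f * g)) p) q"
    by (rule D [symmetric]) (simp add: N_def)
  finally show "coeff (coeff (\<Delta>_star (f * g)) p) q = coeff (coeff (\<Delta>_star f * \<Delta>_star g) p) q" ..
qed

section \<open>Series in Y1\<close>

abbreviation y1_word :: "nat \<Rightarrow> yletter list" where
  "y1_word n \<equiv> replicate n (YSuc 0)"

definition y1_series :: "'r::comm_ring_1 fps \<Rightarrow> 'r yseries" where
  "y1_series f = Abs_ncps (\<lambda>p. if p = y1_word (length p) then f $ length p else 0)"

lemma coeff_y1_series: "coeff (y1_series f) p = (if p = y1_word (length p) then f $ length p else 0)"
  by (simp add: y1_series_def)

lemma y1_word_append: "p @ q = y1_word (length (p @ q)) \<longleftrightarrow> p = y1_word (length p) \<and> q = y1_word (length q)"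
  by (auto simp: replicate_add)

lemma sum_splits_y1_word:
  fixes G :: "nat \<Rightarrow> nat \<Rightarrow> 'b::comm_monoid_add"
  shows "(\<Sum>s\<in>splits (y1_word n). G (length (fst s)) (length (snd s))) = (\<Sum>i=0..n. G i (n - i))"
proof (rule sum.reindex_bij_witness [where i = "\<lambda>i. (y1_word i, y1_word (n - i))" and j = "\<lambda>s. length (fst s)"])
  fix s assume "s \<in> splits (y1_word n)"
  then have s: "fst s @ snd s = y1_word n" by (auto simp: splits_def)
  then have l: "length (fst s) + length (snd s) = n" by (metis length_append length_replicate)
  have "fst s @ snd s = y1_word (length (fst s @ snd s))" using s l by simp
  then have "fst s = y1_word (length (fst s))" "snd s = y1_word (length (snd s))"
    by (simp_all only: y1_word_append)
  with l show "(y1_word (length (fst s)), y1_word (n - length (fst s))) = s"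
    by (metis add_diff_cancel_left' prod.collapse)
  show "length (fst s) \<in> {0..n}" using l by simp
  show "G (length (fst s)) (n - length (fst s)) = G (length (fst s)) (length (snd s))" using l by auto
qed (auto simp: splits_def replicate_add [symmetric])

lemma y1_series_mult: "y1_series (f * g) = y1_series f * y1_series g"
proof (rule ncps_eqI)
  fix p
  show "coeff (y1_series (f * g)) p = coeff (y1_series f * y1_series g) p"
  proof (cases "p = y1_word (length p)")
    case True
    have "coeff (y1_series f * y1_series g) p = (\<Sum>s\<in>splits p. f $ length (fst s) * g $ length (snd s))"
      unfolding coeff_mult case_prod_unfold
    proof (rule sum.cong)
      fix s assume "s \<in> splits p"
      then have "fst s @ snd s = y1_word (length (fst s @ snd s))" using True by (auto simp: splits_def)
      then show "coeff (y1_series f) (fst s) * coeff (y1_series g) (snd s) = f $ length (fst s) * g $ length (snd s)"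
        unfolding y1_word_append by (simp add: coeff_y1_series)
    qed simp
    also have "\<dots> = (\<Sum>s\<in>splits (y1_word (length p)). f $ length (fst s) * g $ length (snd s))"
      using True by simp
    also have "\<dots> = (f * g) $ length p"
      unfolding fps_mult_nth by (rule sum_splits_y1_word [where G = "\<lambda>i k. f $ i * g $ k"])
    finally show ?thesis using True by (simp add: coeff_y1_series)
  next
    case False
    have "coeff (y1_series f) (fst s) * coeff (y1_series g) (snd s) = 0" if "s \<in> splits p" for s
    proof -
      have "fst s @ snd s \<noteq> y1_word (length (fst s @ snd s))" using that False by (auto simp: splits_def)
      then show ?thesis unfolding y1_word_append by (auto simp: coeff_y1_series)
    qed
    then have "coeff (y1_series f * y1_series g) p = 0"
      unfolding coeff_mult case_prod_unfold by (intro sum.neutral) blast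
    then show ?thesis using False by (simp add: coeff_y1_series)
  qed
qed

lemma y1_series_one: "y1_series 1 = 1"
  by (rule ncps_eqI) (auto simp: coeff_y1_series)

lemma y1_series_power: "y1_series (f ^ n) = y1_series f ^ n"
  by (induction n) (simp_all add: y1_series_one y1_series_mult)

lemma fps_power_nth_eq_0:
  fixes f :: "'a::comm_ring_1 fps"
  assumes "f $ 0 = 0" "n < k"
  shows "f ^ k $ n = 0"
  using assms(2)
proof (induction k arbitrary: n)
  case (Suc k)
  have "f $ i * f ^ k $ (n - i) = 0" if "i \<le> n" for i
    using Suc.IH [of "n - i"] Suc.prems assms(1) that by (cases "i = 0") auto
  then show ?case by (simp add: fps_mult_nth)
qed simp

context k_algebra
begin

text \<open>
  The truncation at \<open>k \<le> n\<close> is harmless for series without constant term.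
\<close>

definition fps_expo :: "'r fps \<Rightarrow> 'r fps" where
  "fps_expo f = Abs_fps (\<lambda>n. \<Sum>k\<le>n. \<iota> (1 / fact k) * f ^ k $ n)"

lemma nc_exp_y1_series:
  assumes "f $ 0 = 0"
  shows "nc_exp \<iota> (y1_series f) = y1_series (fps_expo f)"
proof (rule ncps_eqI)
  fix p
  have "coeff (nc_exp \<iota> (y1_series f)) p = (\<Sum>k\<le>length p. \<iota> (1 / fact k) * coeff (y1_series (f ^ k)) p)"
    unfolding nc_exp_def nc_Sum_def coeff_Abs_ncps coeff_const_mult y1_series_power [symmetric]
  proof (rule Sum_any.expand_superset)
    show "{k. \<iota> (1 / fact k) * coeff (y1_series (f ^ k)) p \<noteq> 0} \<subseteq> {..length p}"
    proof
      fix k assume "k \<in> {k. \<iota> (1 / fact k) * coeff (y1_series (f ^ k)) p \<noteq> 0}"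
      then have "f ^ k $ length p \<noteq> 0" by (auto simp: coeff_y1_series split: if_splits)
      then have "\<not> length p < k" using fps_power_nth_eq_0 [OF assms] by blast
      then show "k \<in> {..length p}" by simp
    qed
  qed simp
  then show "coeff (nc_exp \<iota> (y1_series f)) p = coeff (y1_series (fps_expo f)) p"
    by (simp add: coeff_y1_series fps_expo_def)
qed

lemma euler_power: "euler (f ^ Suc k) = of_nat (Suc k) * (euler f * f ^ k)"
  for f :: "'a::comm_ring_1 fps"
proof (induction k)
  case (Suc k)
  have "euler (f ^ Suc (Suc k)) = euler f * f ^ Suc k + f * euler (f ^ Suc k)"
    by (simp only: power_Suc [of f "Suc k"] euler_mult)
  also have "\<dots> = euler f * f ^ Suc k + f * (of_nat (Suc k) * (euler f * f ^ k))"
    by (simp only: Suc.IH)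
  finally show ?case by (simp add: algebra_simps)
qed simp

lemma inverse_fact_Suc: "of_nat (Suc k) * \<iota> (1 / fact (Suc k)) = \<iota> (1 / fact k)"
proof -
  have "of_nat (Suc k) * \<iota> (1 / fact (Suc k)) = \<iota> (of_nat (Suc k) * (1 / fact (Suc k)))"
    by (simp only: map_mult map_of_nat)
  also have "of_nat (Suc k) * (1 / fact (Suc k)) = (1 / fact k :: 'k)"
    by (simp add: divide_simps del: of_nat_Suc)
  finally show ?thesis .
qed

lemma euler_fps_expo:
  assumes "f $ 0 = 0"
  shows "euler (fps_expo f) = euler f * fps_expo f"
proof (rule fps_ext)
  fix n
  show "euler (fps_expo f) $ n = (euler f * fps_expo f) $ n"
  proof (cases n)
    case 0
    then show ?thesis using assms by (simp add: euler_nth)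
  next
    case (Suc m)
    have E: "(\<Sum>k\<le>m. \<iota> (1 / fact k) * f ^ k $ (n - i)) = fps_expo f $ (n - i)" if "i \<noteq> 0" for i
      unfolding fps_expo_def fps_nth_Abs_fps
      by (rule sum.mono_neutral_right) (use that Suc assms in \<open>auto simp: not_le fps_power_nth_eq_0\<close>)
    have "euler (fps_expo f) $ n = (\<Sum>k\<le>n. \<iota> (1 / fact k) * euler (f ^ k) $ n)"
      by (simp add: euler_nth fps_expo_def sum_distrib_left mult_ac)
    also have "\<dots> = (\<Sum>k\<le>m. \<iota> (1 / fact (Suc k)) * euler (f ^ Suc k) $ n)"
      unfolding Suc sum.atMost_Suc_shift by (simp add: euler_def del: power_Suc fact_Suc)
    also have "\<dots> = (\<Sum>k\<le>m. \<iota> (1 / fact k) * (euler f * f ^ k) $ n)"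
    proof (rule sum.cong)
      fix k
      have "euler (f ^ Suc k) $ n = of_nat (Suc k) * (euler f * f ^ k) $ n"
        unfolding euler_power fps_of_nat [symmetric] by (rule fps_mult_left_const_nth)
      then have "\<iota> (1 / fact (Suc k)) * euler (f ^ Suc k) $ n
          = of_nat (Suc k) * \<iota> (1 / fact (Suc k)) * (euler f * f ^ k) $ n"
        by (simp only: mult_ac)
      then show "\<iota> (1 / fact (Suc k)) * euler (f ^ Suc k) $ n = \<iota> (1 / fact k) * (euler f * f ^ k) $ n"
        by (simp only: inverse_fact_Suc)
    qed simp
    also have "\<dots> = (\<Sum>k\<le>m. \<Sum>i=0..n. euler f $ i * (\<iota> (1 / fact k) * f ^ k $ (n - i)))"
      by (simp only: fps_mult_nth sum_distrib_left mult_ac)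
    also have "\<dots> = (\<Sum>i=0..n. euler f $ i * (\<Sum>k\<le>m. \<iota> (1 / fact k) * f ^ k $ (n - i)))"
      by (subst sum.swap) (simp only: sum_distrib_left)
    also have "\<dots> = (\<Sum>i=0..n. euler f $ i * fps_expo f $ (n - i))"
    proof (rule sum.cong)
      fix i
      show "euler f $ i * (\<Sum>k\<le>m. \<iota> (1 / fact k) * f ^ k $ (n - i)) = euler f $ i * fps_expo f $ (n - i)"
      proof (cases "i = 0")
        case False
        show ?thesis by (rule arg_cong [OF E [OF False]])
      qed (simp add: euler_nth)
    qed simp
    finally show ?thesis by (simp only: fps_mult_nth)
  qed
qed

definition corr_log :: "'r xseries \<Rightarrow> 'r fps" where
  "corr_log \<phi> = Abs_fps (\<lambda>n. if n = 0 then 0 else \<iota> ((- 1) ^ n / of_nat n) * coeff \<phi> (X0pow_X1 (n - 1)))"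

lemma \<phi>_corr_y1_series: "\<phi>_corr \<iota> \<phi> = y1_series (fps_expo (corr_log \<phi>))"
proof -
  have Y: "Yser 1 = y1_series (fps_X :: 'r fps)"
    by (rule ncps_eqI) (auto simp: coeff_y1_series nc_var_def)
  have "nc_Sum (\<lambda>n. if n = 0 then 0 else
      nc_const (\<iota> ((- 1) ^ n / of_nat n) * coeff \<phi> (X0pow_X1 (n - 1))) * Yser 1 ^ n) = y1_series (corr_log \<phi>)"
  proof (rule ncps_eqI)
    fix p
    have c: "coeff (if n = 0 then 0 else nc_const (\<iota> ((- 1) ^ n / of_nat n) * coeff \<phi> (X0pow_X1 (n - 1))) * Yser 1 ^ n) p
        = (if n = length p then coeff (y1_series (corr_log \<phi>)) p else 0)" for n
      unfolding Y y1_series_power [symmetric] by (simp add: coeff_y1_series corr_log_def)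
    show "coeff (nc_Sum (\<lambda>n. if n = 0 then 0 else
        nc_const (\<iota> ((- 1) ^ n / of_nat n) * coeff \<phi> (X0pow_X1 (n - 1))) * Yser 1 ^ n)) p
      = coeff (y1_series (corr_log \<phi>)) p"
      unfolding nc_Sum_def coeff_Abs_ncps c
      by (subst Sum_any.expand_superset [of "{length p}"]) auto
  qed
  then show ?thesis
    unfolding \<phi>_corr_def by (simp only:) (rule nc_exp_y1_series, simp add: corr_log_def)
qed

text \<open>
  The coefficients of \<open>\<phi>\<^sub>c\<^sub>o\<^sub>r\<^sub>r\<close> as a series in \<open>- Y\<^sub>1\<close>, which is the image of \<open>X1\<close>. The signs in the
  definition of \<open>\<phi>\<^sub>c\<^sub>o\<^sub>r\<^sub>r\<close> cancel, and the recursion below is that of the coboundary theorem.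
\<close>

definition corr_coeff :: "'r xseries \<Rightarrow> nat \<Rightarrow> 'r" where
  "corr_coeff \<phi> n = (- 1) ^ n * fps_expo (corr_log \<phi>) $ n"

lemma corr_coeff_0: "corr_coeff \<phi> 0 = 1"
  by (simp add: corr_coeff_def fps_expo_def map_one)

lemma map_sign: "\<iota> ((- 1) ^ n) = (- 1) ^ n"
proof -
  have "\<iota> (- 1) = - 1"
    using map_add [of 1 "- 1"] by (simp add: map_zero map_one eq_neg_iff_add_eq_0 add.commute)
  then show ?thesis by (induction n) (simp_all only: power_0 power_Suc map_one map_mult)
qed

lemma corr_coeff_rec:
  "of_nat n * corr_coeff \<phi> n = (\<Sum>i=1..n. coeff \<phi> (X0pow_X1 (i - 1)) * corr_coeff \<phi> (n - i))"
proof -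
  let ?E = "fps_expo (corr_log \<phi>)"
  have l: "(- 1) ^ i * (of_nat i * corr_log \<phi> $ i) = (if i = 0 then 0 else coeff \<phi> (X0pow_X1 (i - 1)))" for i
  proof (cases "i = 0")
    case False
    have "(- 1) ^ i * (of_nat i * \<iota> ((- 1) ^ i / of_nat i)) = \<iota> ((- 1) ^ i * (of_nat i * ((- 1) ^ i / of_nat i)))"
      by (simp only: map_mult map_sign map_of_nat)
    also have "(- 1) ^ i * (of_nat i * ((- 1) ^ i / of_nat i)) = (1 :: 'k)"
      using False by (simp add: power_mult_distrib [symmetric])
    finally have "(- 1) ^ i * (of_nat i * \<iota> ((- 1) ^ i / of_nat i)) * coeff \<phi> (X0pow_X1 (i - 1)) = coeff \<phi> (X0pow_X1 (i - 1))"
      by (simp add: map_one)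
    then show ?thesis using False by (simp add: corr_log_def mult.assoc)
  qed simp
  have "of_nat n * corr_coeff \<phi> n = (- 1) ^ n * euler ?E $ n"
    by (simp add: corr_coeff_def euler_nth mult_ac)
  also have "euler ?E $ n = (\<Sum>i=0..n. of_nat i * corr_log \<phi> $ i * ?E $ (n - i))"
    by (subst euler_fps_expo) (simp_all add: corr_log_def fps_mult_nth euler_nth)
  also have "(- 1) ^ n * \<dots> = (\<Sum>i=0..n. (- 1) ^ i * (of_nat i * corr_log \<phi> $ i) * corr_coeff \<phi> (n - i))"
    unfolding sum_distrib_left
  proof (rule sum.cong)
    fix i assume "i \<in> {0..n}"
    then have "(- 1) ^ n = (- 1) ^ i * (- 1 :: 'r) ^ (n - i)" by (simp add: power_add [symmetric])
    then show "(- 1) ^ n * (of_nat i * corr_log \<phi> $ i * ?E $ (n - i))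
        = (- 1) ^ i * (of_nat i * corr_log \<phi> $ i) * corr_coeff \<phi> (n - i)"
      by (simp only: corr_coeff_def mult_ac)
  qed simp
  also have "\<dots> = (\<Sum>i=1..n. coeff \<phi> (X0pow_X1 (i - 1)) * corr_coeff \<phi> (n - i))"
    unfolding l by (subst sum.atLeast_Suc_atMost) (auto intro!: sum.cong)
  finally show ?thesis .
qed

end

section \<open>Series in the two copies of Y1\<close>

text \<open>
  Series in the commuting variables \<open>x = - Y\<^sub>1 \<otimes> 1\<close> and \<open>y = - 1 \<otimes> Y\<^sub>1\<close>, given by their homogeneous
  components dehomogenized at \<open>x = 1\<close>: the coefficient of \<open>x^i y^k\<close> is \<open>F $ (i + k) $ k\<close>.
\<close>

definition y1_tensor :: "'r::comm_ring_1 fps fps \<Rightarrow> (yletter, 'r) ncps2" where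
  "y1_tensor F = Abs_ncps (\<lambda>p. Abs_ncps (\<lambda>q.
     if p = y1_word (length p) \<and> q = y1_word (length q)
     then (- 1) ^ (length p + length q) * F $ (length p + length q) $ length q else 0))"

lemma coeff_y1_tensor: "coeff (coeff (y1_tensor F) p) q =
   (if p = y1_word (length p) \<and> q = y1_word (length q)
     then (- 1) ^ (length p + length q) * F $ (length p + length q) $ length q else 0)"
  by (simp add: y1_tensor_def)

text \<open>
  The series that come from homogeneous components, without negative powers of \<open>x\<close>.
\<close>

definition degree_bounded :: "'r::comm_ring_1 fps fps \<Rightarrow> bool" where
  "degree_bounded F \<longleftrightarrow> (\<forall>n k. n < k \<longrightarrow> F $ n $ k = 0)"

lemma degree_bounded_mult: "degree_bounded F \<Longrightarrow> degree_bounded G \<Longrightarrow> degree_bounded (F * G)"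
  unfolding degree_bounded_def
proof (intro allI impI)
  fix n k :: nat
  assume F: "\<forall>n k. n < k \<longrightarrow> F $ n $ k = 0" and G: "\<forall>n k. n < k \<longrightarrow> G $ n $ k = 0" and "n < k"
  have "F $ i $ l * G $ (n - i) $ (k - l) = 0" if "i \<le> n" "l \<le> k" for i l
  proof -
    have "i < l \<or> n - i < k - l" using that \<open>n < k\<close> by linarith
    then show ?thesis using F G by auto
  qed
  then show "(F * G) $ n $ k = 0" by (simp add: fps_mult_nth fps_sum_nth)
qed

lemma y1_tensor_mult:
  assumes F: "degree_bounded F" and G: "degree_bounded G"
  shows "y1_tensor (F * G) = y1_tensor F * y1_tensor G"
proof (intro ncps_eqI)
  fix p q
  let ?P = "\<lambda>p. p = y1_word (length p)"
  show "coeff (coeff (y1_tensor (F * G)) p) q = coeff (coeff (y1_tensor F * y1_tensor G) p) q"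
  proof (cases "?P p \<and> ?P q")
    case True
    define i where "i = length p"
    define k where "k = length q"
    have pq: "p = y1_word i" "q = y1_word k" using True by (simp_all add: i_def k_def)
    let ?H = "\<lambda>a b c d. F $ (a + c) $ c * G $ (b + d) $ d"
    have "coeff (coeff (y1_tensor F * y1_tensor G) p) q
      = (\<Sum>s\<in>splits (y1_word i). \<Sum>r\<in>splits (y1_word k). (- 1) ^ (i + k) *
          ?H (length (fst s)) (length (snd s)) (length (fst r)) (length (snd r)))"
      unfolding coeff2_mult pq
    proof (intro sum.cong refl)
      fix s r assume "s \<in> splits (y1_word i)" "r \<in> splits (y1_word k)"
      then have a: "fst s @ snd s = y1_word i" "fst r @ snd r = y1_word k" by (auto simp: splits_def)
      then have l: "length (fst s) + length (snd s) = i" "length (fst r) + length (snd r) = k"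
        by (metis length_append length_replicate)+
      have "fst s @ snd s = y1_word (length (fst s @ snd s))" "fst r @ snd r = y1_word (length (fst r @ snd r))"
        using a l by simp_all
      then have "?P (fst s) \<and> ?P (snd s)" "?P (fst r) \<and> ?P (snd r)"
        unfolding y1_word_append by auto
      moreover have "i + k = (length (fst s) + length (fst r)) + (length (snd s) + length (snd r))" using l by simp
      then have "(- 1 :: 'a) ^ (i + k) = (- 1) ^ (length (fst s) + length (fst r)) * (- 1) ^ (length (snd s) + length (snd r))"
        by (simp only: power_add)
      ultimately show "coeff (coeff (y1_tensor F) (fst s)) (fst r) * coeff (coeff (y1_tensor G) (snd s)) (snd r)
        = (- 1) ^ (i + k) * ?H (length (fst s)) (length (snd s)) (length (fst r)) (length (snd r))"
        by (simp only: coeff_y1_tensor if_True simp_thms mult_ac)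
    qed
    also have "\<dots> = (- 1) ^ (i + k) * (\<Sum>a=0..i. \<Sum>c=0..k. ?H a (i - a) c (k - c))"
      by (simp only: sum_splits_y1_word [where G = "\<lambda>c d. (- 1) ^ (i + k) * ?H _ _ c d"]
          sum_splits_y1_word [where G = "\<lambda>a b. \<Sum>c=0..k. (- 1) ^ (i + k) * ?H a b c (k - c)"] sum_distrib_left)
    also have "(\<Sum>a=0..i. \<Sum>c=0..k. ?H a (i - a) c (k - c)) = (\<Sum>c=0..k. \<Sum>n=0..i + k. F $ n $ c * G $ (i + k - n) $ (k - c))"
    proof (subst sum.swap, rule sum.cong)
      fix c assume c: "c \<in> {0..k}"
      have "(\<Sum>n=0..i + k. F $ n $ c * G $ (i + k - n) $ (k - c)) = (\<Sum>n\<in>(\<lambda>a. a + c) ` {0..i}. F $ n $ c * G $ (i + k - n) $ (k - c))"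
      proof (rule sum.mono_neutral_right)
        show "\<forall>n\<in>{0..i + k} - (\<lambda>a. a + c) ` {0..i}. F $ n $ c * G $ (i + k - n) $ (k - c) = 0"
        proof
          fix n assume n: "n \<in> {0..i + k} - (\<lambda>a. a + c) ` {0..i}"
          \<comment> \<open>Outside the image one of the two monomials would have a negative power of \<open>x\<close>.\<close>
          have "n < c \<or> i + k - n < k - c"
          proof (rule ccontr)
            assume "\<not> ?thesis"
            then have "n = (n - c) + c" "n - c \<in> {0..i}" using c n by auto
            with n show False by blast
          qed
          then show "F $ n $ c * G $ (i + k - n) $ (k - c) = 0"
            using F G by (auto simp: degree_bounded_def)
        qed
      qed (use c in auto)
      also have "\<dots> = (\<Sum>a=0..i. ?H a (i - a) c (k - c))"
        by (subst sum.reindex) (use c in \<open>auto intro!: sum.cong arg_cong2 [where f = times] arg_cong [where f = "\<lambda>m. G $ m $ (k - c)"] simp: add.commute\<close>)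
      finally show "(\<Sum>a=0..i. ?H a (i - a) c (k - c)) = (\<Sum>n=0..i + k. F $ n $ c * G $ (i + k - n) $ (k - c))" ..
    qed simp
    also have "\<dots> = (F * G) $ (i + k) $ k"
      by (subst sum.swap) (simp add: fps_mult_nth fps_sum_nth)
    finally show ?thesis using True by (simp add: coeff_y1_tensor pq)
  next
    case False
    have "coeff (coeff (y1_tensor F) (fst s)) (fst r) * coeff (coeff (y1_tensor G) (snd s)) (snd r) = 0"
      if "s \<in> splits p" "r \<in> splits q" for s r
    proof -
      have "\<not> (?P (fst s @ snd s) \<and> ?P (fst r @ snd r))" using that False by (auto simp: splits_def)
      then show ?thesis unfolding y1_word_append by (auto simp: coeff_y1_tensor)
    qed
    then have "coeff (coeff (y1_tensor F * y1_tensor G) p) q = 0"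
      unfolding coeff2_mult by (intro sum.neutral ballI) 
    then show ?thesis by (simp only: coeff_y1_tensor [of "F * G"] if_not_P [OF False])
  qed
qed

text \<open>
  The series \<open>\<Sum> c n s^n\<close> for a linear form \<open>s\<close>, which is \<open>1\<close>, \<open>fps_X\<close> or \<open>1 + fps_X\<close> for \<open>x\<close>, \<open>y\<close>, \<open>x + y\<close>.
\<close>

definition along :: "'r::comm_ring_1 fps \<Rightarrow> (nat \<Rightarrow> 'r) \<Rightarrow> 'r fps fps" where
  "along s c = Abs_fps (\<lambda>n. fps_const (c n) * s ^ n)"

lemma fps_X_power_nth_nth: "(fps_X ^ n :: 'a::comm_ring_1 fps) $ k = (if k = n then 1 else 0)"
  by (simp add: fps_X_power_iff)

lemma one_plus_X_power_degree: "n < k \<Longrightarrow> ((1 + fps_X) ^ n :: 'a::comm_ring_1 fps) $ k = 0"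
proof (induction n arbitrary: k)
  case (Suc n)
  then show ?case by (cases k) (simp_all add: distrib_right)
qed simp

lemma degree_bounded_along:
  "degree_bounded (along 1 c)" "degree_bounded (along fps_X c)" "degree_bounded (along (1 + fps_X) c)"
  by (simp_all add: degree_bounded_def along_def fps_X_power_nth_nth one_plus_X_power_degree)

lemma y1_tensor_along_1: "y1_tensor (along 1 (\<lambda>n. (- 1) ^ n * f $ n)) = tens (y1_series f) 1"
  by (intro ncps_eqI) (auto simp: coeff_y1_tensor along_def coeff_y1_series mult.assoc [symmetric] power_mult_distrib [symmetric])

lemma y1_tensor_along_X: "y1_tensor (along fps_X (\<lambda>n. (- 1) ^ n * f $ n)) = tens 1 (y1_series f)"
  by (intro ncps_eqI) (auto simp: coeff_y1_tensor along_def coeff_y1_series fps_X_power_nth_nth mult.assoc [symmetric] power_mult_distrib [symmetric])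

lemma y1_tensor_one: "y1_tensor 1 = 1"
  by (intro ncps_eqI) (auto simp: coeff_y1_tensor)

lemma shuffle_letter_power:
  "shuffle_letter (YSuc 0) ^ n = y1_tensor (Abs_fps (\<lambda>m. if m = n then (- 1) ^ n * (1 + fps_X) ^ n else 0))"
  (is "_ = y1_tensor (?F n)")
proof (induction n)
  case 0
  have "?F 0 = 1" by (rule fps_ext) simp
  then show ?case by (simp add: y1_tensor_one)
next
  case (Suc n)
  have b: "degree_bounded (?F n)" for n
    by (auto simp: degree_bounded_def one_plus_X_power_degree) (cases "even n"; simp add: uminus_power_if one_plus_X_power_degree)
  have s: "shuffle_letter (YSuc 0) = y1_tensor (?F 1)"
  proof (intro ncps_eqI)
    fix p q
    show "coeff (coeff (shuffle_letter (YSuc 0)) p) q = coeff (coeff (y1_tensor (?F 1)) p) q"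
      by (auto simp: coeff_y1_tensor nc_var_def length_Suc_conv)
  qed
  have "?F 1 * ?F n = ?F (Suc n)"
  proof (rule fps_ext)
    fix m
    have "(?F 1 * ?F n) $ m = (\<Sum>i=0..m. if i = 1 then ?F 1 $ 1 * ?F n $ (m - 1) else 0)"
      unfolding fps_mult_nth by (rule sum.cong) auto
    then show "(?F 1 * ?F n) $ m = ?F (Suc n) $ m" by (auto simp: algebra_simps)
  qed
  then have "y1_tensor (?F (Suc n)) = y1_tensor (?F 1) * y1_tensor (?F n)"
    by (simp only: y1_tensor_mult [OF b b, symmetric])
  also have "\<dots> = shuffle_letter (YSuc 0) * shuffle_letter (YSuc 0) ^ n"
    unfolding s [symmetric] Suc.IH [symmetric] ..
  finally show ?case by (simp only: power_Suc)
qed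

lemma \<Delta>_star_y1_series:
  "\<Delta>_star (y1_series f) = y1_tensor (along (1 + fps_X) (\<lambda>n. (- 1) ^ n * f $ n))"
proof (intro ncps_eqI)
  fix p q
  let ?n = "length (x_word p) + length (x_word q)"
  have inj: "inj_on y1_word A" for A by (rule inj_onI) (metis length_replicate)
  \<comment> \<open>Powers of \<open>Y\<^sub>1\<close> are added to the words of the right weight in order to index the sum by exponents.\<close>
  let ?W = "{P. length (x_word P) = ?n} \<union> y1_word ` {..?n}"
  have x: "x_word (y1_word n) = replicate n X1" for n
    by (induction n) (simp_all add: X0pow_X1_def)
  have "coeff (coeff (\<Delta>_star (y1_series f)) p) q
     = (\<Sum>P\<in>?W. coeff (y1_series f) P * coeff (coeff (prod_list (map shuffle_letter P)) p) q)"
    by (rule coeff_\<Delta>_star) (auto intro: finite_x_word)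
  also have "\<dots> = (\<Sum>P\<in>y1_word ` {..?n}. coeff (y1_series f) P * coeff (coeff (prod_list (map shuffle_letter P)) p) q)"
  proof (rule sum.mono_neutral_right)
    show "\<forall>P\<in>?W - y1_word ` {..?n}. coeff (y1_series f) P * coeff (coeff (prod_list (map shuffle_letter P)) p) q = 0"
    proof
      fix P assume P: "P \<in> ?W - y1_word ` {..?n}"
      have "P \<noteq> y1_word (length P)"
      proof
        assume eq: "P = y1_word (length P)"
        then have "length (x_word P) = length P" using x [of "length P"] by (metis length_replicate)
        with P eq show False by auto
      qed
      then show "coeff (y1_series f) P * coeff (coeff (prod_list (map shuffle_letter P)) p) q = 0"
        by (simp add: coeff_y1_series)
    qed
  qed (auto intro: finite_x_word)
  also have "\<dots> = (\<Sum>n\<le>?n. f $ n * coeff (coeff (shuffle_letter (YSuc 0) ^ n) p) q)"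
    by (subst sum.reindex [OF inj]) (simp add: coeff_y1_series prod_list_replicate)
  also have "\<dots> = coeff (coeff (y1_tensor (along (1 + fps_X) (\<lambda>n. (- 1) ^ n * f $ n))) p) q"
  proof (cases "p = y1_word (length p) \<and> q = y1_word (length q)")
    case True
    then have l: "length (x_word p) = length p" "length (x_word q) = length q" 
      using x by (metis length_replicate)+
    let ?m = "length p + length q"
    have "(\<Sum>n\<le>?n. f $ n * coeff (coeff (shuffle_letter (YSuc 0) ^ n) p) q)
      = (\<Sum>n\<le>?m. if n = ?m then f $ ?m * (1 + fps_X) ^ ?m $ length q else 0)"
      unfolding l shuffle_letter_power coeff_y1_tensor
    proof (rule sum.cong)
      fix n
      have sg: "(- 1) ^ ?m * ((- 1) ^ ?m * g) $ k = g $ k" for g :: "'a fps" and k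
        by (cases "even ?m") (simp_all add: uminus_power_if)
      show "f $ n * (if p = y1_word (length p) \<and> q = y1_word (length q) then (- 1) ^ ?m *
          Abs_fps (\<lambda>m. if m = n then (- 1) ^ n * (1 + fps_X) ^ n else 0) $ ?m $ length q else 0)
        = (if n = ?m then f $ ?m * (1 + fps_X) ^ ?m $ length q else 0)"
        using True sg by auto
    qed simp
    also have "\<dots> = f $ ?m * (1 + fps_X) ^ ?m $ length q" by simp
    finally show ?thesis using True
      by (simp add: coeff_y1_tensor along_def mult.assoc [symmetric] power_mult_distrib [symmetric])
  next
    case False
    then show ?thesis
      unfolding shuffle_letter_power coeff_y1_tensor
      by (simp only: if_False mult_zero_right sum.neutral_const)
  qed
  finally show "coeff (coeff (\<Delta>_star (y1_series f)) p) q
    = coeff (coeff (y1_tensor (along (1 + fps_X) (\<lambda>n. (- 1) ^ n * f $ n))) p) q" .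
qed

section \<open>Associators satisfy the double shuffle relation\<close>

lemma word_at_a1_b1:
  "word_at a1 b1 w = tens (nc_word (replicate (count_list w X0) X1)) (nc_word (replicate (count_list w X1) X1))"
proof (induction w)
  case (Cons l w)
  then show ?case by (cases l) (simp_all add: tens_mult)
qed (simp add: tens_one_one)

lemma count_letters: "count_list w X0 + count_list w X1 = length w"
  by (induction w) (auto, metis letter.exhaust)

lemma coeff_at_pair_a1_b1:
  "coeff (coeff (at_pair jT a1 b1 f $ n) u) v = (\<Sum>w | length w = n. coeff f w *
     (if u = replicate (count_list w X0) X1 \<and> v = replicate (count_list w X1) X1 then 1 else 0))"
  unfolding gev_nth coeff_sum coeff_jT_mult word_at_a1_b1 by (rule sum.cong) (simp_all add: coeff_mono del: map_replicate)

lemma cocycle_series_support: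
  assumes "coeff (coeff (at_pair jT a1 b1 f $ n) u) v \<noteq> 0"
  shows "u = replicate (length u) X1" "v = replicate (length v) X1" "length u + length v = n"
proof -
  obtain w where w: "length w = n" "u = replicate (count_list w X0) X1" "v = replicate (count_list w X1) X1"
    using assms unfolding coeff_at_pair_a1_b1
    by (elim sum.not_neutral_contains_not_neutral) (auto split: if_splits)
  then show "u = replicate (length u) X1" "v = replicate (length v) X1" "length u + length v = n"
    by (simp_all add: count_letters)
qed

lemma x_word_y1_word: "x_word (y1_word n) = replicate n X1"
  by (induction n) (simp_all add: X0pow_X1_def)

lemma x_word_eq_replicate: "x_word p = replicate n X1 \<longleftrightarrow> p = y1_word n"
  using x_word_inj [of p "y1_word n"] by (simp only: x_word_y1_word)

lemma to_Y_cocycle_series: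
  "to_Y (at_pair jT a1 b1 f) = y1_tensor (at_pair fps_const 1 fps_X f)"
proof (intro ncps_eqI)
  fix p q
  show "coeff (coeff (to_Y (at_pair jT a1 b1 f)) p) q = coeff (coeff (y1_tensor (at_pair fps_const 1 fps_X f)) p) q"
  proof (cases "p = y1_word (length p) \<and> q = y1_word (length q)")
    case True
    then have x: "x_word p = replicate (length p) X1" "x_word q = replicate (length q) X1"
      using x_word_y1_word by metis+
    have W: "word_at 1 fps_X w = (fps_X ^ count_list w X1 :: 'a fps)" for w
      by (induction w) (simp_all split: letter.split)
    have "coeff (coeff (at_pair jT a1 b1 f $ (length p + length q)) (x_word p)) (x_word q)
      = (\<Sum>w | length w = length p + length q. coeff f w * (if length q = count_list w X1 then 1 else 0))"
      unfolding coeff_at_pair_a1_b1 x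
    proof (rule sum.cong)
      fix w :: "letter list" assume "w \<in> {w. length w = length p + length q}"
      then have "length p = count_list w X0 \<longleftrightarrow> length q = count_list w X1"
        using count_letters [of w] by auto
      then show "coeff f w * (if replicate (length p) X1 = replicate (count_list w X0) X1 \<and>
          replicate (length q) X1 = replicate (count_list w X1) X1 then 1 else 0)
        = coeff f w * (if length q = count_list w X1 then 1 else 0)"
        by (auto simp: replicate_eq_replicate)
    qed simp
    also have "\<dots> = at_pair fps_const 1 fps_X f $ (length p + length q) $ length q"
      unfolding gev_nth W by (simp add: fps_sum_nth fps_X_power_nth_nth)
    finally show ?thesis using True by (simp add: coeff_to_Y coeff_to_Y2 coeff_y1_tensor x)
  next
    case False
    have "coeff (coeff (at_pair jT a1 b1 f $ n) (x_word p)) (x_word q) = 0" for n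
      using cocycle_series_support [of f n "x_word p" "x_word q"] False
      by (metis x_word_eq_replicate length_replicate)
    then show ?thesis
      by (simp only: coeff_to_Y coeff_to_Y2 coeff_y1_tensor if_not_P [OF False] mult_zero_right)
  qed
qed

lemma degree_bounded_at_pair: "degree_bounded (at_pair fps_const 1 fps_X f)"
proof -
  have W: "word_at 1 fps_X w = (fps_X ^ count_list w X1 :: 'a fps)" for w
    by (induction w) (simp_all split: letter.split)
  have "count_list w X1 \<le> length w" for w using count_letters [of w] by simp
  then show ?thesis
    by (auto simp: degree_bounded_def gev_nth W fps_sum_nth fps_X_power_nth_nth intro!: sum.neutral)
      (metis leD)
qed

text \<open>
  The series \<open>\<pi>\<^sub>Y \<phi>\<close> is group-like for the harmonic coproduct up to the cocycle \<open>B\<close>.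
\<close>

theorem harmonic_coproduct_of_associator:
  assumes "pentagon \<phi>" "commutator_like \<phi>"
  shows "y1_tensor (at_pair fps_const 1 fps_X (trim \<phi>)) * \<Delta>_star (\<pi>\<^sub>Y \<phi>) = tens (\<pi>\<^sub>Y \<phi>) (\<pi>\<^sub>Y \<phi>)"
proof -
  let ?B = "at_pair jT a1 b1 (trim \<phi>)"
  have adm: "admissible (replicate n X1)" for n by (cases "n = 0") (auto simp: admissible_def)
  have "to_Y (?B * harmonic_series \<phi>) = to_Y ?B * to_Y (harmonic_series \<phi>)"
  proof (rule to_Y_mult)
    show "admissible2 (?B $ n)" for n
      unfolding admissible2_def using cocycle_series_support adm by metis
    show "homogeneous2 n (?B $ n)" for n
      unfolding homogeneous2_def using cocycle_series_support by blast
  qed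
  moreover have "to_Y (?B * harmonic_series \<phi>) = to_Y (at_pair jT a0 a1 \<phi> * at_pair jT b0 b1 (trim \<phi>))"
    by (rule to_Y_cong_negligible) (rule harmonic_identity [OF assms])
  ultimately show ?thesis
    by (simp only: to_Y_right_side to_Y_harmonic_series to_Y_cocycle_series)
qed

lemma torsion_free_fps:
  assumes "torsion_free TYPE('r::comm_ring_1)"
  shows "torsion_free TYPE('r fps)"
  unfolding torsion_free_def
proof (intro allI impI)
  fix m :: nat and f :: "'r fps"
  assume "m > 0" "of_nat m * f = 0"
  then have "of_nat m * f $ n = 0" for n
    by (metis fps_mult_left_const_nth fps_of_nat fps_zero_nth)
  then have "f $ n = 0" for n using torsion_freeD [OF assms \<open>m > 0\<close>] by blast
  then show "f = 0" by (intro fps_ext) simp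
qed

text \<open>
  The correction factor is a series in \<open>Y\<^sub>1\<close>, which is primitive for \<open>\<Delta>\<^sub>*\<close>. Its coproduct therefore
  compares \<open>C(x + y)\<close> with \<open>C(x) C(y)\<close>, and the discrepancy is exactly the cocycle in the coproduct of
  \<open>\<pi>\<^sub>Y \<phi>\<close>.
\<close>

theorem (in k_algebra) associator_double_shuffle:
  assumes "pentagon \<phi>" "commutator_like \<phi>"
  shows "double_shuffle \<iota> \<phi>"
proof -
  define f where "f = fps_expo (corr_log \<phi>)"
  let ?B = "at_pair fps_const 1 fps_X (trim \<phi>)"
  define c where "c = (\<lambda>n. (- 1) ^ n * f $ n)"
  have c: "c = corr_coeff \<phi>" by (simp add: c_def f_def corr_coeff_def fun_eq_iff)
  have "scalars (fps_const :: 'r \<Rightarrow> 'r fps)"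
    by standard (simp_all add: mult.commute)
  note coboundary = B_coboundary [OF this assms torsion_free_fps [OF torsion_free]]
  have "along (1 + fps_X) c = along 1 c * along fps_X c * ?B"
    unfolding along_def by (rule coboundary) (simp_all only: c corr_coeff_0 corr_coeff_rec)
  then have "\<Delta>_star (y1_series f) = y1_tensor (along 1 c) * y1_tensor (along fps_X c) * y1_tensor ?B"
    unfolding \<Delta>_star_y1_series c_def [symmetric]
    by (simp only: y1_tensor_mult degree_bounded_along degree_bounded_at_pair degree_bounded_mult)
  also have "\<dots> = tens (y1_series f) (y1_series f) * y1_tensor ?B"
    by (simp only: c_def y1_tensor_along_1 y1_tensor_along_X tens_mult mult_1_left mult_1_right)
  finally have corr: "\<Delta>_star (y1_series f) = tens (y1_series f) (y1_series f) * y1_tensor ?B" .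
  have "\<phi>_star \<iota> \<phi> = y1_series f * \<pi>\<^sub>Y \<phi>"
    by (simp add: \<phi>_star_def \<phi>_corr_y1_series f_def)
  then show ?thesis
    unfolding double_shuffle_def
    by (simp only: \<Delta>_star_mult corr mult.assoc harmonic_coproduct_of_associator [OF assms] tens_mult)
qed

lemma GT_relations_pentagon: "GT_relations \<iota> \<mu> \<phi> \<Longrightarrow> pentagon \<phi>"
  by (simp add: GT_relations_def pentagon_def Let_def)

theorem (in k_algebra) GT_relations_imp_DMR:
  assumes gl: "group_like \<phi>" and gt: "GT_relations \<iota> \<mu> \<phi>"
  shows "\<phi> \<in> DMR_pts \<iota> \<mu>"
proof -
  have pent: "pentagon \<phi>" using gt by (rule GT_relations_pentagon)
  note lin = pentagon_linear_part [OF gl pent]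
  have cl: "commutator_like \<phi>"
    unfolding commutator_like_def using group_like_power_coeff [OF torsion_free gl] lin gl by blast
  show ?thesis
    unfolding DMR_pts_def
    using gl lin associator_double_shuffle [OF pent cl] hexagon_quadratic_part [OF k_algebra_axioms gt cl]
    by blast
qed

theorem corollary0p4:
  fixes \<iota> :: "'k::field_char_0 \<Rightarrow> 'r::comm_ring_1" and \<mu> :: 'k
  assumes "k_algebra \<iota>" and "\<mu> \<noteq> 0"
  shows "equivariant_embedding
     (M_pts \<iota> \<mu>) (GRT1 \<iota>) (\<odot>)
     (DMR_pts \<iota> \<mu>) (DMR0 \<iota>) (\<odot>)
     (\<lambda>\<phi>. \<phi>) (\<lambda>\<phi>. \<phi>)"
proof -
  interpret k_algebra \<iota> by fact
  have "M_pts \<iota> \<mu> \<subseteq> DMR_pts \<iota> \<mu>"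
    using GT_relations_imp_DMR by (auto simp: M_pts_def)
  moreover have "carrier (GRT1 \<iota>) \<subseteq> carrier (DMR0 \<iota>)"
    using GT_relations_imp_DMR by (auto simp: GRT1_def DMR0_def)
  ultimately show ?thesis
    unfolding equivariant_embedding_def hom_def
    by (auto simp: GRT1_def DMR0_def)
qed

end
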